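(* Let $\mathbb{K}$ be a field and let $G$ be a connected graph with vertex set $[\ell]=\{1,\dots,\ell\}$. Then for all $i$, $$\mathrm{Hilb}\big(H^i_{\mathfrak{m}_S}(D(\mathcal{A}_G)),t\big)=\sum_{\sigma\in P_G}\Big(\dim_{\mathbb{K}}\widetilde H_{i-\mathrm{rank}(\sigma)-2}\big(\mathrm{lk}_{P_G}(\sigma)\big)\Big)\frac{t^{-\mathrm{rank}(\sigma)-1}}{(1-t^{-1})^{\mathrm{rank}(\sigma)+1}},$$ where the right-hand side is expanded as a power series in $t^{-1}$.
   Context: Graphs are finite and simple, $\ell\ge1$. $S=\mathbb{K}[x_1,\dots,x_\ell]$ with the standard grading and graded maximal ideal $\mathfrak{m}_S=(x_1,\dots,x_\ell)$; $\mathrm{Der}(S)=\bigoplus_{i=1}^\ell S\,\partial_{x_i}$ is graded with each $\partial_{x_i}$ in degree $0$. The logarithmic vector field of the graphic arrangement $\mathcal{A}_G$ is the graded $S$-module $D(\mathcal{A}_G)=\{\theta\in \mathrm{Der}(S)\mid \theta(x_u-x_v)\in (x_u-x_v)S \text{ for every edge }\{u,v\}\text{ of }G\}$. $H^i_{\mathfrak{m}_S}(-)$ is graded local cohomology, and for a graded $\mathbb{K}$-vector space $M$, $\mathrm{Hilb}(M,t)=\sum_{i\in\mathbb{Z}}(\dim_{\mathbb{K}}M_i)t^i$. $P_G=\{(V(C),T)\mid T\subsetneq[\ell],\ C \text{ a connected component of } G-T\}$, where $G-T$ is obtained from $G$ by deleting the vertices in $T$ and $V(C)$ is the vertex set of $C$;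 order: $(W,T)\le(W',T')$ iff $W\supset W'$ and $T\subset T'$. For connected $G$, $P_G$ is a simplicial poset (a finite poset with minimal element $\hat0$ all of whose intervals $[\hat0,\sigma]$ are Boolean algebras), and $\mathrm{rank}(W,T)=|T|$ is the rank of the Boolean algebra $[\hat 0,(W,T)]$. For a poset $P$ and $\sigma\in P$, $\mathrm{lk}_P(\sigma)=\{\tau\in P\mid\tau\ge\sigma\}$; if $P$ is simplicial this is a simplicial poset with minimal element $\sigma$. Every simplicial poset $P$ is the face poset (with $\hat0$ as the empty face) of a regular CW-complex $\Gamma(P)$, and $\widetilde H_i(P)$ denotes the $i$th reduced homology of $\Gamma(P)$ with coefficients in $\mathbb{K}$; conventions: $\widetilde H_i(P)=0$ for $i<0$ if $P\ne\{\hat0\}$, while $\widetilde H_{-1}(\{\hat0\})\cong\mathbb{K}$ and $\widetilde H_i(\{\hat 0\})=0$ for $i\neq -1$. *)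

theory Defs
  imports
    "HOL-Library.Poly_Mapping"
    "HOL-Library.Function_Algebras"
    "HOL-Computational_Algebra.Fraction_Field"
    "HOL-Computational_Algebra.Formal_Laurent_Series"
begin

section \<open>Dimension of a quotient of vector spaces\<close>

text \<open>\<open>X\<close> is a finite set of elements of \<open>Z\<close> whose cosets are pairwise distinct and form
  a basis of \<open>Z / B\<close>. The field acts on the ambient space by \<open>scl\<close>.\<close>

definition quot_basis ::
  "('k::field \<Rightarrow> 'v::ab_group_add \<Rightarrow> 'v) \<Rightarrow> 'v set \<Rightarrow> 'v set \<Rightarrow> 'v set \<Rightarrow> bool" where
  "quot_basis scl Z B X \<longleftrightarrow> finite X \<and> X \<subseteq> Z \<and>
     (\<forall>z\<in>Z. \<exists>!a. (\<forall>x. x \<notin> X \<longrightarrow> a x = 0) \<and> z - (\<Sum>x\<in>X. scl (a x) x) \<in> B)"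

definition quot_finite_dim ::
  "('k::field \<Rightarrow> 'v::ab_group_add \<Rightarrow> 'v) \<Rightarrow> 'v set \<Rightarrow> 'v set \<Rightarrow> bool" where
  "quot_finite_dim scl Z B \<longleftrightarrow> (\<exists>X. quot_basis scl Z B X)"

text \<open>Only meaningful when \<open>quot_finite_dim scl Z B\<close> holds.\<close>

definition quot_dim ::
  "('k::field \<Rightarrow> 'v::ab_group_add \<Rightarrow> 'v) \<Rightarrow> 'v set \<Rightarrow> 'v set \<Rightarrow> nat" where
  "quot_dim scl Z B = card (SOME X. quot_basis scl Z B X)"


section \<open>Polynomials and derivations\<close>

text \<open>\<open>('n, 'k) mpoly\<close> is the polynomial ring with coefficients in \<open>'k\<close> and one variable for
  each element of \<open>'n\<close>. With \<open>'n\<close> a finite linearly ordered type it plays the role of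
  \<open>K[x\<^sub>1, \<dots>, x\<^sub>l]\<close>, where \<open>l = CARD('n)\<close>; the order makes it an instance of \<open>idom\<close> and
  fixes the signs in the Cech complex.\<close>

type_synonym ('n, 'k) mpoly = "('n \<Rightarrow>\<^sub>0 nat) \<Rightarrow>\<^sub>0 'k"

definition mconst :: "'k::field \<Rightarrow> ('n, 'k) mpoly" where
  "mconst a = Poly_Mapping.single 0 a"

definition mvar :: "'n \<Rightarrow> ('n, 'k::field) mpoly" where
  "mvar v = Poly_Mapping.single (Poly_Mapping.single v 1) 1"

definition homogeneous :: "int \<Rightarrow> ('n::finite, 'k::field) mpoly \<Rightarrow> bool" where
  "homogeneous e p \<longleftrightarrow>
     (\<forall>m\<in>Poly_Mapping.keys p. int (\<Sum>v\<in>UNIV. Poly_Mapping.lookup m v) = e)"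

definition partial_deriv :: "'n \<Rightarrow> ('n, 'k::field) mpoly \<Rightarrow> ('n, 'k) mpoly" where
  "partial_deriv v p = (\<Sum>m\<in>Poly_Mapping.keys p.
     Poly_Mapping.single (m - Poly_Mapping.single v 1)
       (of_nat (Poly_Mapping.lookup m v) * Poly_Mapping.lookup p m))"

text \<open>A function \<open>\<theta> :: 'n \<Rightarrow> ('n, 'k) mpoly\<close> stands for the derivation
  \<open>\<Sum>v. \<theta> v \<partial>\<^sub>v\<close>.\<close>

definition der_apply ::
  "('n::finite \<Rightarrow> ('n, 'k::field) mpoly) \<Rightarrow> ('n, 'k) mpoly \<Rightarrow> ('n, 'k) mpoly" where
  "der_apply \<theta> p = (\<Sum>v\<in>UNIV. \<theta> v * partial_deriv v p)"

text \<open>Each \<open>\<partial>\<^sub>v\<close> has degree \<open>0\<close>.\<close>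

definition der_homogeneous :: "int \<Rightarrow> ('n::finite \<Rightarrow> ('n, 'k::field) mpoly) \<Rightarrow> bool" where
  "der_homogeneous e \<theta> \<longleftrightarrow> (\<forall>v. homogeneous e (\<theta> v))"


section \<open>Graded local cohomology at the graded maximal ideal\<close>

text \<open>For a graded submodule \<open>M\<close> of \<open>Der(S)\<close>, the local cohomology with support in
  \<open>(x\<^sub>1, \<dots>, x\<^sub>l)\<close> is the cohomology of the Cech complex on the variables, whose \<open>i\<close>-th term
  is the direct sum of the localizations \<open>M\<^bsub>x_F\<^esub>\<close> over the sets \<open>F\<close> of \<open>i\<close> variables, where
  \<open>x_F\<close> is the product of the variables in \<open>F\<close>. As \<open>M\<close> is torsion-free, \<open>M\<^bsub>x_F\<^esub>\<close> is the
  set of fractions with numerator in \<open>M\<close> and denominator a power of \<open>x_F\<close>, taken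
  coordinatewise in the fraction field of \<open>S\<close>. Everything is done one degree \<open>d\<close> at a time.\<close>

definition loc_part ::
  "('n::{finite,linorder} \<Rightarrow> ('n, 'k::field) mpoly) set \<Rightarrow> 'n set \<Rightarrow> int
     \<Rightarrow> ('n \<Rightarrow> ('n, 'k) mpoly fract) set" where
  "loc_part M F d = {(\<lambda>v. Fraction_Field.Fract (\<theta> v) ((\<Prod>u\<in>F. mvar u) ^ k)) | \<theta> k.
     \<theta> \<in> M \<and> der_homogeneous (d + int (k * card F)) \<theta>}"

definition cech_cochains ::
  "('n::{finite,linorder} \<Rightarrow> ('n, 'k::field) mpoly) set \<Rightarrow> int \<Rightarrow> int
     \<Rightarrow> ('n set \<Rightarrow> 'n \<Rightarrow> ('n, 'k) mpoly fract) set" where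
  "cech_cochains M i d =
     {c. \<forall>F. if int (card F) = i then c F \<in> loc_part M F d else c F = 0}"

definition cech_diff ::
  "('n::{finite,linorder} set \<Rightarrow> 'n \<Rightarrow> ('n, 'k::field) mpoly fract)
     \<Rightarrow> 'n set \<Rightarrow> 'n \<Rightarrow> ('n, 'k) mpoly fract" where
  "cech_diff c F w = (\<Sum>v\<in>F. (- 1) ^ card {u\<in>F. u < v} * c (F - {v}) w)"

definition cech_cocycles ::
  "('n::{finite,linorder} \<Rightarrow> ('n, 'k::field) mpoly) set \<Rightarrow> int \<Rightarrow> int
     \<Rightarrow> ('n set \<Rightarrow> 'n \<Rightarrow> ('n, 'k) mpoly fract) set" where
  "cech_cocycles M i d = {c \<in> cech_cochains M i d. cech_diff c = 0}"

definition cech_coboundaries ::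
  "('n::{finite,linorder} \<Rightarrow> ('n, 'k::field) mpoly) set \<Rightarrow> int \<Rightarrow> int
     \<Rightarrow> ('n set \<Rightarrow> 'n \<Rightarrow> ('n, 'k) mpoly fract) set" where
  "cech_coboundaries M i d = cech_diff ` cech_cochains M (i - 1) d"

definition cech_scale ::
  "'k::field \<Rightarrow> ('n::{finite,linorder} set \<Rightarrow> 'n \<Rightarrow> ('n, 'k) mpoly fract)
     \<Rightarrow> 'n set \<Rightarrow> 'n \<Rightarrow> ('n, 'k) mpoly fract" where
  "cech_scale a c = (\<lambda>F v. Fraction_Field.Fract (mconst a) 1 * c F v)"

definition lc_finite_dim ::
  "('n::{finite,linorder} \<Rightarrow> ('n, 'k::field) mpoly) set \<Rightarrow> int \<Rightarrow> int \<Rightarrow> bool" where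
  "lc_finite_dim M i d \<longleftrightarrow>
     quot_finite_dim cech_scale (cech_cocycles M i d) (cech_coboundaries M i d)"

text \<open>The Hilbert series of the \<open>i\<close>-th local cohomology of \<open>M\<close>, as the family of its
  coefficients: \<open>lc_hilb M i d\<close> is the coefficient of \<open>t\<close> to the power \<open>d\<close>.\<close>

definition lc_hilb ::
  "('n::{finite,linorder} \<Rightarrow> ('n, 'k::field) mpoly) set \<Rightarrow> int \<Rightarrow> int \<Rightarrow> nat" where
  "lc_hilb M i d = quot_dim cech_scale (cech_cocycles M i d) (cech_coboundaries M i d)"


section \<open>Reduced homology of a finite simplicial poset\<close>

text \<open>A poset is given by its order \<open>le\<close> and its underlying set \<open>P\<close>.\<close>

definition poset_bot :: "('a \<Rightarrow> 'a \<Rightarrow> bool) \<Rightarrow> 'a set \<Rightarrow> 'a" where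
  "poset_bot le P = (THE b. b \<in> P \<and> (\<forall>x\<in>P. le b x))"

definition poset_atoms :: "('a \<Rightarrow> 'a \<Rightarrow> bool) \<Rightarrow> 'a set \<Rightarrow> 'a set" where
  "poset_atoms le P = {a \<in> P. a \<noteq> poset_bot le P \<and>
     (\<forall>x\<in>P. le x a \<longrightarrow> x = poset_bot le P \<or> x = a)}"

definition atoms_below :: "('a \<Rightarrow> 'a \<Rightarrow> bool) \<Rightarrow> 'a set \<Rightarrow> 'a \<Rightarrow> 'a set" where
  "atoms_below le P \<tau> = {a \<in> poset_atoms le P. le a \<tau>}"

text \<open>The rank of the Boolean algebra below \<open>\<tau>\<close>; the cell of \<open>\<tau>\<close> has dimension
  one less.\<close>

definition poset_rank :: "('a \<Rightarrow> 'a \<Rightarrow> bool) \<Rightarrow> 'a set \<Rightarrow> 'a \<Rightarrow> nat" where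
  "poset_rank le P \<tau> = card (atoms_below le P \<tau>)"

text \<open>An arbitrary total order on the vertices, used to orient the cells.\<close>

definition atom_index :: "('a \<Rightarrow> 'a \<Rightarrow> bool) \<Rightarrow> 'a set \<Rightarrow> 'a \<Rightarrow> nat" where
  "atom_index le P = (SOME f. inj_on f (poset_atoms le P))"

text \<open>The incidence number of a facet \<open>\<rho>\<close> of \<open>\<tau>\<close>: the sign given by the position, among the
  vertices of \<open>\<tau>\<close>, of the single vertex that does not belong to \<open>\<rho>\<close>.\<close>

definition incidence :: "('a \<Rightarrow> 'a \<Rightarrow> bool) \<Rightarrow> 'a set \<Rightarrow> 'a \<Rightarrow> 'a \<Rightarrow> 'k::field" where
  "incidence le P \<rho> \<tau> = (- 1) ^ card {b \<in> atoms_below le P \<tau>.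
     \<forall>a \<in> atoms_below le P \<tau> - atoms_below le P \<rho>. atom_index le P b < atom_index le P a}"

text \<open>The augmented cellular chain complex of the regular CW complex whose face poset
  is \<open>P\<close>; the minimum of \<open>P\<close> is the empty face, in degree \<open>-1\<close>.\<close>

definition cell_chains ::
  "('a \<Rightarrow> 'a \<Rightarrow> bool) \<Rightarrow> 'a set \<Rightarrow> int \<Rightarrow> ('a \<Rightarrow> 'k::field) set" where
  "cell_chains le P j =
     {c. \<forall>\<tau>. c \<tau> \<noteq> 0 \<longrightarrow> \<tau> \<in> P \<and> int (poset_rank le P \<tau>) = j + 1}"

definition cell_boundary ::
  "('a \<Rightarrow> 'a \<Rightarrow> bool) \<Rightarrow> 'a set \<Rightarrow> ('a \<Rightarrow> 'k::field) \<Rightarrow> 'a \<Rightarrow> 'k" where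
  "cell_boundary le P c \<rho> =
     (if \<rho> \<in> P
      then \<Sum>\<tau> | \<tau> \<in> P \<and> le \<rho> \<tau> \<and> poset_rank le P \<tau> = poset_rank le P \<rho> + 1.
             incidence le P \<rho> \<tau> * c \<tau>
      else 0)"

definition reduced_betti ::
  "'k::field itself \<Rightarrow> ('a \<Rightarrow> 'a \<Rightarrow> bool) \<Rightarrow> 'a set \<Rightarrow> int \<Rightarrow> nat" where
  "reduced_betti K le P j = quot_dim (\<lambda>(a::'k) c \<tau>. a * c \<tau>)
     {c \<in> cell_chains le P j. cell_boundary le P c = 0}
     (cell_boundary le P ` cell_chains le P (j + 1))"

definition poset_link :: "('a \<Rightarrow> 'a \<Rightarrow> bool) \<Rightarrow> 'a set \<Rightarrow> 'a \<Rightarrow> 'a set" where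
  "poset_link le P \<sigma> = {\<tau> \<in> P. le \<sigma> \<tau>}"


section \<open>Graphs and their posets\<close>

text \<open>The vertices are all the elements of the type, the edges are two-element sets.\<close>

definition simple_graph :: "'n set set \<Rightarrow> bool" where
  "simple_graph E \<longleftrightarrow> (\<forall>e\<in>E. card e = 2)"

text \<open>The connected component of the vertex \<open>v \<notin> T\<close> in the graph with the vertices in \<open>T\<close>
  deleted.\<close>

definition component_of :: "'n set set \<Rightarrow> 'n set \<Rightarrow> 'n \<Rightarrow> 'n set" where
  "component_of E T v = {w. (v, w) \<in> {(a, b). {a, b} \<in> E \<and> a \<notin> T \<and> b \<notin> T}\<^sup>*}"

definition connected_graph :: "'n set set \<Rightarrow> bool" where
  "connected_graph E \<longleftrightarrow> (\<forall>v. component_of E {} v = UNIV)"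

definition graph_poset :: "'n set set \<Rightarrow> ('n set \<times> 'n set) set" where
  "graph_poset E = {(W, T). T \<subset> UNIV \<and> (\<exists>v. v \<notin> T \<and> W = component_of E T v)}"

definition graph_poset_le :: "'n set \<times> 'n set \<Rightarrow> 'n set \<times> 'n set \<Rightarrow> bool" where
  "graph_poset_le \<sigma> \<tau> \<longleftrightarrow> fst \<tau> \<subseteq> fst \<sigma> \<and> snd \<sigma> \<subseteq> snd \<tau>"

definition graph_poset_rank :: "'n set \<times> 'n set \<Rightarrow> nat" where
  "graph_poset_rank \<sigma> = card (snd \<sigma>)"

definition log_der :: "'n set set \<Rightarrow> ('n::{finite,linorder} \<Rightarrow> ('n, 'k::field) mpoly) set" where
  "log_der E = {\<theta>. \<forall>u v. {u, v} \<in> E \<longrightarrow> (mvar u - mvar v) dvd der_apply \<theta> (mvar u - mvar v)}"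

end

theory Submission
  imports Defs "HOL-Computational_Algebra.Polynomial_Factorial"
begin

text \<open>
  Regard the logarithmic derivations as a graded ring \<open>D\<close> of functions on the vertices
  (componentwise multiplication). It contains the variables \<open>x\<^sub>v\<close>, the element \<open>z\<close> whose
  value at \<open>w\<close> is \<open>x\<^sub>w\<close>, and \<open>y\<^sub>v = z - x\<^sub>v\<close>. In \<open>D\<close> the ideals \<open>(x\<^sub>v)\<^sub>v\<close> and
  \<open>(z, y\<^sub>v)\<^sub>v\<close> have the same radical, because \<open>\<Prod>\<^sub>v (z - x\<^sub>v) = 0\<close>, so both families compute
  the local cohomology. With respect to \<open>z\<close> and the \<open>y\<^sub>v\<close>, the Cech complex is graded by
  exponents of Laurent monomials: the part of exponent \<open>\<beta>\<close> of the localisation at a set \<open>F\<close>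
  of generators consists of the functions on the vertices outside \<open>T\<close> that are constant on the
  components of \<open>G - T\<close>, where \<open>T\<close> collects the vertices \<open>v\<close> with \<open>y\<^sub>v\<close> in \<open>F\<close> or in the support of \<open>\<beta>\<close>. Exponents with
  an entry \<open>> 0\<close>, or \<open>\<ge> 0\<close> at \<open>z\<close>, give contractible complexes. For the others the complex is
  the sum, over the \<open>\<sigma> = (W, T)\<close> in the graph poset with \<open>T\<close> the support of \<open>\<beta>\<close>, of the
  cochain complexes of the links of \<open>\<sigma>\<close>, and counting the exponents of given support gives the
  rational functions in the formula.
\<close>

section \<open>Linear correspondences between quotient spaces\<close>

text \<open>The change of generators is what makes the problem combinatorial. At a vertex w the
  nonzero values of z and the y_v are the coordinates x_w and x_w - x_v, with v \<noteq> w. In them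
  the ideal attached to an edge {u, v} is generated by a single coordinate, and the coordinate
  systems at u and v agree modulo this ideal. Hence the logarithmic condition can be tested one
  monomial at a time, which is impossible in the variables x_v, where x_u - x_v is not a monomial.
  The price is that y_v is a zero divisor: it vanishes at v, and localising at it deletes the value
  at v. This deletion is the origin of the graphs G - T, and it is why idempotents are carried
  through all the differentials. An exponent attached to \<sigma> has rank(\<sigma>) + 1 negative
  entries, one for z and one for each deleted vertex. Each of them runs independently over the
  negative integers, which gives one factor t^-1 / (1 - t^-1) per entry.\<close>

definition lin_corr ::
  "('k::field \<Rightarrow> 'v::ab_group_add \<Rightarrow> 'v) \<Rightarrow> 'v set \<Rightarrow> 'v set \<Rightarrow>
   ('k \<Rightarrow> 'w::ab_group_add \<Rightarrow> 'w) \<Rightarrow> 'w set \<Rightarrow> 'w set \<Rightarrow> ('v \<Rightarrow> 'w \<Rightarrow> bool) \<Rightarrow> bool" where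
  "lin_corr s Z B s' Z' B' R \<longleftrightarrow>
     (\<forall>x y. R x y \<longrightarrow> x \<in> Z \<and> y \<in> Z' \<and> (x \<in> B \<longleftrightarrow> y \<in> B')) \<and>
     (\<forall>x\<in>Z. \<exists>y. R x y) \<and> (\<forall>y\<in>Z'. \<exists>x. R x y) \<and>
     (\<forall>x y x' y'. R x y \<longrightarrow> R x' y' \<longrightarrow> R (x + x') (y + y')) \<and>
     (\<forall>a x y. R x y \<longrightarrow> R (s a x) (s' a y))"

text \<open>Relations rather than maps: inverse and composite are the converse and the relational
  composite, and no section has to be chosen where a comparison map points against the direction of
  the chain of isomorphisms.\<close>

definition quot_iso ::
  "('k::field \<Rightarrow> 'v::ab_group_add \<Rightarrow> 'v) \<Rightarrow> 'v set \<Rightarrow> 'v set \<Rightarrow>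
   ('k \<Rightarrow> 'w::ab_group_add \<Rightarrow> 'w) \<Rightarrow> 'w set \<Rightarrow> 'w set \<Rightarrow> bool" where
  "quot_iso s Z B s' Z' B' \<longleftrightarrow> (\<exists>R. lin_corr s Z B s' Z' B' R)"

lemma lin_corrD:
  assumes "lin_corr s Z B s' Z' B' R"
  shows "\<And>x y. R x y \<Longrightarrow> x \<in> Z \<and> y \<in> Z' \<and> (x \<in> B \<longleftrightarrow> y \<in> B')"
    and "\<And>x. x \<in> Z \<Longrightarrow> \<exists>y. R x y" and "\<And>y. y \<in> Z' \<Longrightarrow> \<exists>x. R x y"
    and "\<And>x y x' y'. R x y \<Longrightarrow> R x' y' \<Longrightarrow> R (x + x') (y + y')"
    and "\<And>a x y. R x y \<Longrightarrow> R (s a x) (s' a y)"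
  using assms unfolding lin_corr_def by blast+

lemma quot_isoI:
  assumes "\<And>x y. R x y \<Longrightarrow> x \<in> Z \<and> y \<in> Z' \<and> (x \<in> B \<longleftrightarrow> y \<in> B')"
    and "\<And>x. x \<in> Z \<Longrightarrow> \<exists>y. R x y" and "\<And>y. y \<in> Z' \<Longrightarrow> \<exists>x. R x y"
    and "\<And>x y x' y'. R x y \<Longrightarrow> R x' y' \<Longrightarrow> R (x + x') (y + y')"
    and "\<And>a x y. R x y \<Longrightarrow> R (s a x) (s' a y)"
  shows "quot_iso s Z B s' Z' B'"
  unfolding quot_iso_def lin_corr_def using assms by (intro exI[of _ R]) blast

lemma quot_iso_sym:
  assumes "quot_iso s Z B s' Z' B'"
  shows "quot_iso s' Z' B' s Z B"
proof -
  obtain R where R: "lin_corr s Z B s' Z' B' R" using assms by (auto simp: quot_iso_def)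
  show ?thesis
    by (rule quot_isoI[where R = "\<lambda>y x. R x y"]) (use lin_corrD[OF R] in blast)+
qed

lemma quot_iso_trans:
  assumes "quot_iso s Z B s' Z' B'" "quot_iso s' Z' B' s'' Z'' B''"
  shows "quot_iso s Z B s'' Z'' B''"
proof -
  obtain R where R0: "lin_corr s Z B s' Z' B' R" using assms(1) by (auto simp: quot_iso_def)
  obtain S where S0: "lin_corr s' Z' B' s'' Z'' B'' S" using assms(2) by (auto simp: quot_iso_def)
  note R = lin_corrD[OF R0] and S = lin_corrD[OF S0]
  show ?thesis
  proof (rule quot_isoI[where R = "\<lambda>x z. \<exists>y. R x y \<and> S y z"])
    fix x z assume "\<exists>y. R x y \<and> S y z"
    then show "x \<in> Z \<and> z \<in> Z'' \<and> (x \<in> B \<longleftrightarrow> z \<in> B'')" using R(1) S(1) by blast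
  next
    fix x assume "x \<in> Z" then show "\<exists>z y. R x y \<and> S y z" using R(1,2) S(2) by meson
  next
    fix z assume "z \<in> Z''" then show "\<exists>x y. R x y \<and> S y z" using R(3) S(1,3) by meson
  next
    fix x z x' z' assume "\<exists>y. R x y \<and> S y z" "\<exists>y. R x' y \<and> S y z'"
    then show "\<exists>y. R (x + x') y \<and> S y (z + z')" using R(4) S(4) by meson
  next
    fix a x z assume "\<exists>y. R x y \<and> S y z"
    then show "\<exists>y. R (s a x) y \<and> S y (s'' a z)" using R(5) S(5) by meson
  qed
qed

text \<open>Dimensions are recorded as isomorphisms with \<open>coords I\<close> modulo zero; every
  quotient eventually takes this form.\<close>

definition coords :: "'i set \<Rightarrow> ('i \<Rightarrow> 'k::field) set" where
  "coords I = {f. \<forall>i. i \<notin> I \<longrightarrow> f i = 0}"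

definition pscale :: "'k::field \<Rightarrow> ('i \<Rightarrow> 'k) \<Rightarrow> 'i \<Rightarrow> 'k" where
  "pscale a f = (\<lambda>i. a * f i)"

lemma vector_space_pscale: "vector_space pscale"
  by unfold_locales (auto simp: pscale_def fun_eq_iff algebra_simps)

lemma sum_fun_apply: "(\<Sum>x\<in>A. f x) y = (\<Sum>x\<in>A. f x y)"
  by (induction A rule: infinite_finite_induct) auto

text \<open>Partners of the unit vectors under the correspondence represent a basis of Z /
  B.\<close>

lemma quot_iso_coords_basis:
  fixes s :: "'k::field \<Rightarrow> 'v::ab_group_add \<Rightarrow> 'v"
  assumes vs: "vector_space s" and iso: "quot_iso s Z B pscale (coords I) {0}" and I: "finite I"
  shows "\<exists>X. quot_basis s Z B X \<and> card X = card I"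
proof -
  interpret vector_space s by fact
  obtain R where R0: "lin_corr s Z B pscale (coords I) {0} R" using iso by (auto simp: quot_iso_def)
  note R = lin_corrD[OF R0]
  define e :: "'a \<Rightarrow> 'a \<Rightarrow> 'k" where "e i = (\<lambda>j. if j = i then 1 else 0)" for i
  have e: "e i \<in> coords I" if "i \<in> I" for i using that by (auto simp: e_def coords_def)
  define x where "x i = (SOME v. R v (e i))" for i
  have x: "R (x i) (e i)" if "i \<in> I" for i
    unfolding x_def using someI_ex[OF R(3)[OF e[OF that]]] .
  have R00: "R 0 0"
  proof -
    have "0 \<in> coords I" by (simp add: coords_def)
    then obtain v where "R v 0" using R(3) by blast
    from R(5)[OF this, of 0] have "R 0 (pscale 0 0)" by simp
    moreover have "pscale 0 0 = (0 :: 'a \<Rightarrow> 'k)" by (simp add: pscale_def fun_eq_iff)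
    ultimately show ?thesis by simp
  qed
  have Rminus: "R (v - w) (f - g)" if "R v f" "R w g" for v w f g
  proof -
    have "R (v + s (-1) w) (f + pscale (-1) g)" using R(4,5) that by blast
    moreover have "pscale (-1) g = - g" by (simp add: pscale_def fun_eq_iff)
    ultimately show ?thesis by simp
  qed
  have Rsum: "R (\<Sum>i\<in>J. s (a i) (x i)) (\<Sum>i\<in>J. pscale (a i) (e i))" if "J \<subseteq> I" for J a
    using finite_subset[OF that I] that
  proof (induction J rule: finite_induct)
    case empty then show ?case using R00 by (simp del: zero_fun_apply)
  next
    case (insert i J)
    then show ?case using R(4)[OF R(5)[OF x[of i], of "a i"] insert.IH] by (simp del: plus_fun_apply)
  qed
  have comb: "(\<Sum>i\<in>I. pscale (a i) (e i)) = (\<lambda>j. if j \<in> I then a j else 0)" for a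
    by (rule ext) (simp add: sum_fun_apply pscale_def e_def if_distrib[of "\<lambda>t. _ * t"] I cong: if_cong)
  have inj: "inj_on x I"
  proof (rule inj_onI)
    fix i j assume ij: "i \<in> I" "j \<in> I" "x i = x j"
    have "R (x i - x j) (e i - e j)" using Rminus x ij by blast
    then have "e i - e j = 0" using R(1) R00 ij by (metis diff_self singletonD singletonI)
    then have "e i i = e j i" by simp
    then show "i = j" by (simp add: e_def split: if_splits)
  qed
  have "quot_basis s Z B (x ` I)"
    unfolding quot_basis_def
  proof (intro conjI ballI)
    show "finite (x ` I)" using I by simp
    show "x ` I \<subseteq> Z" using x R(1) by blast
    fix z assume z: "z \<in> Z"
    then obtain f where f: "R z f" using R(2) by blast
    \<comment> \<open>The correspondence turns membership in B into vanishing, so the coordinates of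
      f are the only possible coefficients.\<close>
    have key: "z - (\<Sum>v\<in>x ` I. s (a v) v) \<in> B \<longleftrightarrow> (\<forall>i\<in>I. a (x i) = f i)" for a
    proof -
      have "(\<Sum>v\<in>x ` I. s (a v) v) = (\<Sum>i\<in>I. s (a (x i)) (x i))"
        by (simp add: sum.reindex[OF inj])
      moreover have "R (z - (\<Sum>i\<in>I. s (a (x i)) (x i))) (f - (\<lambda>j. if j \<in> I then a (x j) else 0))"
        using Rminus[OF f Rsum[OF subset_refl, of "\<lambda>i. a (x i)"]] by (simp add: comb)
      ultimately have "z - (\<Sum>v\<in>x ` I. s (a v) v) \<in> B \<longleftrightarrow> f - (\<lambda>j. if j \<in> I then a (x j) else 0) = 0"
        using R(1) by auto
      also have "\<dots> \<longleftrightarrow> (\<forall>i\<in>I. a (x i) = f i)"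
        using R(1)[OF f] by (auto simp: fun_eq_iff coords_def)
      finally show ?thesis .
    qed
    show "\<exists>!a. (\<forall>v. v \<notin> x ` I \<longrightarrow> a v = 0) \<and> z - (\<Sum>v\<in>x ` I. s (a v) v) \<in> B"
    proof (rule ex1I)
      show "(\<forall>v. v \<notin> x ` I \<longrightarrow> (\<lambda>v. if v \<in> x ` I then f (the_inv_into I x v) else 0) v = 0) \<and>
        z - (\<Sum>v\<in>x ` I. s ((\<lambda>v. if v \<in> x ` I then f (the_inv_into I x v) else 0) v) v) \<in> B"
        unfolding key by (simp add: the_inv_into_f_f[OF inj])
      fix a assume a: "(\<forall>v. v \<notin> x ` I \<longrightarrow> a v = 0) \<and> z - (\<Sum>v\<in>x ` I. s (a v) v) \<in> B"
      then show "a = (\<lambda>v. if v \<in> x ` I then f (the_inv_into I x v) else 0)"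
        unfolding key by (auto simp: fun_eq_iff the_inv_into_f_f[OF inj])
    qed
  qed
  then show ?thesis using card_image[OF inj] by blast
qed

lemma ex1_eqI: "\<exists>!x. P x \<Longrightarrow> P a \<Longrightarrow> P b \<Longrightarrow> a = b"
  by blast

text \<open>Replacing each x in X by a combination of Y congruent to it modulo B preserves
  independence, since a relation among the replacements is a relation among the elements of X modulo
  B. The exchange bound then applies in the span of Y. Applied in both directions, this makes the
  arbitrary choice in \<open>quot_dim\<close> harmless.\<close>

lemma quot_basis_card_le:
  fixes s :: "'k::field \<Rightarrow> 'v::ab_group_add \<Rightarrow> 'v"
  assumes vs: "vector_space s" and Z: "module.subspace s Z" and B: "module.subspace s B"
    and X: "quot_basis s Z B X" and Y: "quot_basis s Z B Y"
  shows "card X \<le> card Y"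
proof -
  interpret vector_space s by fact
  have fin: "finite X" "finite Y" and sub: "X \<subseteq> Z" "Y \<subseteq> Z" using X Y by (auto simp: quot_basis_def)
  have "\<forall>x\<in>X. \<exists>a. x - (\<Sum>y\<in>Y. s (a y) y) \<in> B" using Y sub unfolding quot_basis_def by blast
  then obtain a where a: "\<And>x. x \<in> X \<Longrightarrow> x - (\<Sum>y\<in>Y. s (a x y) y) \<in> B" by metis
  define p where "p x = (\<Sum>y\<in>Y. s (a x y) y)" for x
  have pB: "x - p x \<in> B" if "x \<in> X" for x using a[OF that] by (simp add: p_def)
  have zero: "\<forall>x\<in>X. c x = 0" if c: "(\<Sum>x\<in>X. s (c x) (p x)) = 0" for c
  proof -
    let ?z = "\<Sum>x\<in>X. s (c x) x"
    have zZ: "?z \<in> Z" using sub by (auto intro!: subspace_sum[OF Z] subspace_scale[OF Z])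
    have "?z = (\<Sum>x\<in>X. s (c x) (x - p x))"
      using c by (simp add: scale_right_diff_distrib sum_subtractf)
    also have "\<dots> \<in> B" using pB by (auto intro!: subspace_sum[OF B] subspace_scale[OF B])
    finally have zB: "?z \<in> B" .
    have ex1: "\<exists>!a. (\<forall>x. x \<notin> X \<longrightarrow> a x = 0) \<and> ?z - (\<Sum>x\<in>X. s (a x) x) \<in> B"
      using X zZ unfolding quot_basis_def by blast
    have "(\<lambda>x. if x \<in> X then c x else 0) = (\<lambda>x. 0)"
      using zB subspace_0[OF B] by (intro ex1_eqI[OF ex1] conjI) auto
    then show ?thesis by (metis (mono_tags))
  qed
  have inj: "inj_on p X"
  proof (rule inj_onI, rule ccontr)
    fix x y assume xy: "x \<in> X" "y \<in> X" "p x = p y" "x \<noteq> y"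
    let ?c = "\<lambda>v. if v = x then 1 else if v = y then - (1::'k) else 0"
    have "(\<Sum>v\<in>X. s (?c v) (p v)) = (\<Sum>v\<in>{x,y}. s (?c v) (p v))"
      using xy fin by (intro sum.mono_neutral_right) auto
    also have "\<dots> = 0" using xy by simp
    finally have "\<forall>v\<in>X. ?c v = 0" by (rule zero)
    then show False using xy by auto
  qed
  have ind: "independent (p ` X)"
  proof (rule independent_if_scalars_zero)
    show "finite (p ` X)" using fin by simp
    fix f v assume h: "(\<Sum>x\<in>p ` X. s (f x) x) = 0" "v \<in> p ` X"
    then show "f v = 0" using zero[of "\<lambda>x. f (p x)"] by (auto simp: sum.reindex[OF inj])
  qed
  have "p ` X \<subseteq> span Y"
    unfolding p_def by (intro image_subsetI span_sum span_scale) (rule span_base)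
  from independent_span_bound[OF fin(2) ind this] show ?thesis
    by (simp add: card_image[OF inj])
qed

lemma quot_dim_eq:
  fixes s :: "'k::field \<Rightarrow> 'v::ab_group_add \<Rightarrow> 'v"
  assumes vs: "vector_space s" and Z: "module.subspace s Z" and B: "module.subspace s B"
    and iso: "quot_iso s Z B pscale (coords I) {0}" and I: "finite I"
  shows "quot_finite_dim s Z B" "quot_dim s Z B = card I"
proof -
  obtain X where X: "quot_basis s Z B X" "card X = card I"
    using quot_iso_coords_basis[OF vs iso I] by blast
  show "quot_finite_dim s Z B" using X by (auto simp: quot_finite_dim_def)
  have "quot_basis s Z B (SOME X. quot_basis s Z B X)" by (rule someI) (rule X(1))
  then show "quot_dim s Z B = card I"
    unfolding quot_dim_def using quot_basis_card_le[OF vs Z B] X by (metis le_antisym)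
qed

text \<open>A family of coordinate vectors, one for each t, is the same thing as one function on the
  disjoint union of the index sets.\<close>

lemma quot_iso_direct_sum:
  fixes Z :: "'t \<Rightarrow> ('c \<Rightarrow> 'k::field) set" and X :: "'t \<Rightarrow> 'x set"
  assumes "\<And>t. t \<in> T \<Longrightarrow> quot_iso pscale (Z t) (B t) pscale (coords (X t)) {0}"
  shows "quot_iso (\<lambda>a \<phi> t. pscale a (\<phi> t))
     {\<phi>. \<forall>t. if t \<in> T then \<phi> t \<in> Z t else \<phi> t = 0}
     {\<phi>. \<forall>t. if t \<in> T then \<phi> t \<in> B t else \<phi> t = 0}
     pscale (coords (Sigma T X)) {0}"
proof -
  have "\<forall>t\<in>T. \<exists>R. lin_corr pscale (Z t) (B t) pscale (coords (X t)) {0} R"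
    using assms unfolding quot_iso_def by blast
  then obtain R0 where R0: "\<And>t. t \<in> T \<Longrightarrow> lin_corr pscale (Z t) (B t) pscale (coords (X t)) {0} (R0 t)"
    unfolding bchoice_iff by blast
  define R where "R = R0"
  note R = lin_corrD[OF R0, folded R_def]
  show ?thesis
  proof (rule quot_isoI[where R = "\<lambda>\<phi> h. (\<forall>t. if t \<in> T then R t (\<phi> t) (\<lambda>x. h (t, x)) else \<phi> t = 0)
        \<and> h \<in> coords (Sigma T X)"], goal_cases)
    case (1 \<phi> h)
    then have *: "\<And>t. t \<in> T \<Longrightarrow> R t (\<phi> t) (\<lambda>x. h (t, x))" by metis
    have "h = 0 \<longleftrightarrow> (\<forall>t\<in>T. (\<lambda>x. h (t, x)) = 0)"
      using 1 by (auto simp: fun_eq_iff coords_def)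
    then show ?case using 1 R(1)[OF _ *] by auto
  next
    case (2 \<phi>)
    then have "\<forall>t\<in>T. \<exists>y. R t (\<phi> t) y" using R(2) by (simp add: Ball_def split: if_splits)
    then obtain y where y: "\<And>t. t \<in> T \<Longrightarrow> R t (\<phi> t) (y t)" unfolding bchoice_iff by blast
    have yX: "y t \<in> coords (X t)" if "t \<in> T" for t using R(1)[OF that y[OF that]] by blast
    have "(\<lambda>x. if t \<in> T then y t x else 0) = y t" if "t \<in> T" for t using that by auto
    then show ?case using 2 y yX
      by (intro exI[of _ "\<lambda>(t, x). if t \<in> T then y t x else 0"]) (auto simp: coords_def)
  next
    case (3 h)
    have "\<forall>t\<in>T. \<exists>x. R t x (\<lambda>x. h (t, x))"
      using 3 R(3) by (auto simp: coords_def)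
    then obtain x where x: "\<And>t. t \<in> T \<Longrightarrow> R t (x t) (\<lambda>x. h (t, x))" unfolding bchoice_iff by blast
    then show ?case using 3
      by (intro exI[of _ "\<lambda>t. if t \<in> T then x t else 0"]) auto
  next
    case (4 \<phi> h \<phi>' h')
    have "R t (\<phi> t + \<phi>' t) (\<lambda>x. h (t, x) + h' (t, x))" if "t \<in> T" for t
      using R(4)[OF that, of "\<phi> t" "\<lambda>x. h (t, x)" "\<phi>' t" "\<lambda>x. h' (t, x)"] 4 that
      by (simp add: plus_fun_def split: if_splits)
    then show ?case using 4 by (simp add: coords_def split: if_splits)
  next
    case (5 a \<phi> h)
    have "R t (pscale a (\<phi> t)) (\<lambda>x. pscale a h (t, x))" if "t \<in> T" for t
      using R(5)[OF that, of "\<phi> t" "\<lambda>x. h (t, x)" a] 5 that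
      by (simp add: pscale_def split: if_splits)
    then show ?case using 5 by (simp add: coords_def pscale_def zero_fun_def split: if_splits)
  qed
qed

section \<open>Chain maps\<close>

text \<open>A degreewise surjective chain map with acyclic kernel is a quasi-isomorphism; this is
  the long exact sequence written out with elements. Injectivity uses acyclicity of the kernel in
  degree p, surjectivity uses it in degree p + 1. Every comparison of Cech complexes below is an
  instance.\<close>

lemma quot_iso_complex_map:
  fixes C :: "int \<Rightarrow> 'v::ab_group_add set" and C' :: "int \<Rightarrow> 'w::ab_group_add set"
    and s :: "'k::field \<Rightarrow> 'v \<Rightarrow> 'v" and s' :: "'k \<Rightarrow> 'w \<Rightarrow> 'w"
  assumes closed: "\<And>q x y. x \<in> C q \<Longrightarrow> y \<in> C q \<Longrightarrow> x + y \<in> C q"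
      "\<And>q x y. x \<in> C q \<Longrightarrow> y \<in> C q \<Longrightarrow> x - y \<in> C q" "\<And>q a x. x \<in> C q \<Longrightarrow> s a x \<in> C q"
    and d: "\<And>q x. x \<in> C q \<Longrightarrow> d x \<in> C (q + 1)" "\<And>x y. d (x + y) = d x + d y"
      "\<And>x y. d (x - y) = d x - d y" "\<And>q a x. x \<in> C q \<Longrightarrow> d (s a x) = s a (d x)"
      "\<And>q x. x \<in> C q \<Longrightarrow> d (d x) = 0"
    and s0: "\<And>a. s a 0 = 0"
    and f: "\<And>q x. x \<in> C q \<Longrightarrow> f x \<in> C' q" "\<And>q y. y \<in> C' q \<Longrightarrow> \<exists>x\<in>C q. f x = y"
      "\<And>q x y. x \<in> C q \<Longrightarrow> y \<in> C q \<Longrightarrow> f (x + y) = f x + f y"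
      "\<And>q x y. x \<in> C q \<Longrightarrow> y \<in> C q \<Longrightarrow> f (x - y) = f x - f y"
      "\<And>q a x. x \<in> C q \<Longrightarrow> f (s a x) = s' a (f x)"
      "\<And>q x. x \<in> C q \<Longrightarrow> f (d x) = d' (f x)"
    and acyclic: "\<And>q x. x \<in> C q \<Longrightarrow> f x = 0 \<Longrightarrow> d x = 0 \<Longrightarrow> \<exists>k\<in>C (q - 1). f k = 0 \<and> x = d k"
  shows "quot_iso s {x \<in> C p. d x = 0} (d ` C (p - 1)) s' {y \<in> C' p. d' y = 0} (d' ` C' (p - 1))"
proof (rule quot_isoI[where R = "\<lambda>x y. x \<in> C p \<and> d x = 0 \<and> y = f x"], goal_cases)
  case (1 x y)
  then have x: "x \<in> C p" "d x = 0" "y = f x" by auto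
  have d1: "d k \<in> C p" if "k \<in> C (p - 1)" for k using d(1)[OF that] by simp
  have "f 0 = 0" using f(4)[OF x(1) x(1)] by simp
  then have "d' (f x) = 0" using f(6)[OF x(1)] x by simp
  moreover have "x \<in> d ` C (p - 1) \<longleftrightarrow> f x \<in> d' ` C' (p - 1)"
  proof
    assume "x \<in> d ` C (p - 1)"
    then obtain b where "b \<in> C (p - 1)" "x = d b" by blast
    then show "f x \<in> d' ` C' (p - 1)" using f(1,6) by (metis imageI)
  next
    assume "f x \<in> d' ` C' (p - 1)"
    then obtain b' where "b' \<in> C' (p - 1)" "f x = d' b'" by blast
    then obtain b where b: "b \<in> C (p - 1)" "f x = d' (f b)" using f(2) by blast
    have "f (x - d b) = 0" using f(4)[OF x(1) d1[OF b(1)]] f(6)[OF b(1)] b by simp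
    moreover have "d (x - d b) = 0" using d(3) x d(5)[OF b(1)] by simp
    moreover have "x - d b \<in> C p" using closed(2) x d1 b by blast
    ultimately obtain k where "k \<in> C (p - 1)" "x - d b = d k" using acyclic by blast
    then have "x = d (k + b)" using d(2) by (simp add: algebra_simps)
    then show "x \<in> d ` C (p - 1)" using closed(1)[OF \<open>k \<in> _\<close> b(1)] by blast
  qed
  ultimately show ?case using x f(1) by auto
next
  case (2 x) then show ?case by auto
next
  case (3 y)
  then have y: "y \<in> C' p" "d' y = 0" by auto
  then obtain x where x: "x \<in> C p" "f x = y" using f(2) by blast
  have "f (d x) = 0" using f(6)[OF x(1)] x y by simp
  then obtain k where k: "k \<in> C p" "f k = 0" "d x = d k"
    using acyclic[OF d(1)[OF x(1)]] d(5)[OF x(1)] by auto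
  then have "x - k \<in> C p" "d (x - k) = 0" "f (x - k) = y"
    using closed(2) x d(3) f(4)[OF x(1) k(1)] by auto
  then show ?case by blast
next
  case (4 x y x' y') then show ?case using closed d(2) f(3) by auto
next
  case (5 a x y) then show ?case using closed d(4) f(5) s0 by auto
qed

section \<open>Homology and cohomology of a finite based complex\<close>

text \<open>Induction on I: on the kernel of the new \<open>f i\<close> the old functionals suffice,
  and the remaining error vanishes on that kernel, hence is a multiple of \<open>f i\<close>. The
  subspace V has to vary for this.\<close>

lemma functional_in_span:
  fixes f :: "'i \<Rightarrow> ('j \<Rightarrow> 'k::field) \<Rightarrow> 'k" and V :: "('j \<Rightarrow> 'k) set"
  assumes "finite I" "\<And>i. i \<in> I \<Longrightarrow> L (f i)" "L g"
    "\<And>y. y \<in> V \<Longrightarrow> \<forall>i\<in>I. f i y = 0 \<Longrightarrow> g y = 0"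
    and L: "\<And>h. L h \<longleftrightarrow> (\<forall>x y. h (x + y) = h x + h y) \<and> (\<forall>a x. h (pscale a x) = a * h x)"
    and V: "\<And>x y. x \<in> V \<Longrightarrow> y \<in> V \<Longrightarrow> x + y \<in> V" "\<And>a x. x \<in> V \<Longrightarrow> pscale a x \<in> V"
  shows "\<exists>\<psi>. \<forall>y\<in>V. g y = (\<Sum>i\<in>I. \<psi> i * f i y)"
  using assms(1-4) V
proof (induction I arbitrary: V rule: finite_induct)
  case empty then show ?case by auto
next
  case (insert i I)
  have add: "\<And>h x y. L h \<Longrightarrow> h (x + y) = h x + h y" and sc: "\<And>h a x. L h \<Longrightarrow> h (pscale a x) = a * h x"
    using L by auto
  note Li = insert.prems(1)[of i, simplified]
  have "\<exists>\<psi>. \<forall>y\<in>{y\<in>V. f i y = 0}. g y = (\<Sum>i\<in>I. \<psi> i * f i y)"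
  proof (rule insert.IH)
    show "x + y \<in> {y \<in> V. f i y = 0}" if "x \<in> {y \<in> V. f i y = 0}" "y \<in> {y \<in> V. f i y = 0}" for x y
      using that insert.prems(4)[of x y] add[OF Li, of x y] by (auto simp del: plus_fun_apply)
    show "pscale a x \<in> {y \<in> V. f i y = 0}" if "x \<in> {y \<in> V. f i y = 0}" for a x
      using that insert.prems(5)[of x a] sc[OF Li, of a x] by auto
  qed (use insert.prems in auto)
  then obtain \<psi> where \<psi>: "\<And>y. y \<in> V \<Longrightarrow> f i y = 0 \<Longrightarrow> g y = (\<Sum>i\<in>I. \<psi> i * f i y)" by blast
  define h where "h y = g y - (\<Sum>i\<in>I. \<psi> i * f i y)" for y
  have Lh: "L h" unfolding L h_def using insert.prems(1,2)
    by (auto simp: add sc algebra_simps sum.distrib sum_distrib_left)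
  have h0: "h y = 0" if "y \<in> V" "f i y = 0" for y using \<psi>[OF that] by (simp add: h_def)
  have "\<exists>c. \<forall>y\<in>V. h y = c * f i y"
  proof (cases "\<exists>v\<in>V. f i v \<noteq> 0")
    case True
    then obtain v where v: "v \<in> V" "f i v \<noteq> 0" by blast
    have "h y = (h v / f i v) * f i y" if y: "y \<in> V" for y
    proof -
      have "h (y + pscale (- (f i y / f i v)) v) = 0"
        using v y insert.prems(4,5) by (intro h0) (auto simp: add[OF Li] sc[OF Li] simp del: plus_fun_apply)
      then show ?thesis by (simp add: add[OF Lh] sc[OF Lh] field_simps)
    qed
    then show ?thesis by blast
  next
    case False then show ?thesis using h0 by auto
  qed
  then obtain c where c: "\<And>y. y \<in> V \<Longrightarrow> h y = c * f i y" by blast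
  have "g y = (\<Sum>j\<in>insert i I. (\<psi>(i := c)) j * f j y)" if "y \<in> V" for y
  proof -
    have "(\<Sum>j\<in>I. (\<psi>(i := c)) j * f j y) = (\<Sum>j\<in>I. \<psi> j * f j y)"
      using insert.hyps by (intro sum.cong) auto
    then show ?thesis using insert.hyps c[OF that] by (simp add: h_def algebra_simps)
  qed
  then show ?case by blast
qed

text \<open>Solvability criterion for a linear system with unknown \<psi>: a vector killed by all
  rows must be killed by the right-hand side. It takes the place of dimension counts in the duality
  below.\<close>

lemma fredholm_alternative:
  fixes a :: "'i \<Rightarrow> 'j \<Rightarrow> 'k::field"
  assumes "finite I" "finite J"
    and "\<And>y. \<forall>i\<in>I. (\<Sum>j\<in>J. a i j * y j) = 0 \<Longrightarrow> (\<Sum>j\<in>J. b j * y j) = 0"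
  shows "\<exists>\<psi>. \<forall>j\<in>J. b j = (\<Sum>i\<in>I. \<psi> i * a i j)"
proof -
  have "\<exists>\<psi>. \<forall>y\<in>UNIV. (\<Sum>j\<in>J. b j * y j) = (\<Sum>i\<in>I. \<psi> i * (\<Sum>j\<in>J. a i j * y j))"
    using assms
    by (intro functional_in_span[where L = "\<lambda>h. (\<forall>x y. h (x + y) = h x + h y) \<and> (\<forall>a x. h (pscale a x) = a * h x)"])
       (auto simp: pscale_def algebra_simps sum.distrib sum_distrib_left)
  then obtain \<psi> where \<psi>: "\<And>y. (\<Sum>j\<in>J. b j * y j) = (\<Sum>i\<in>I. \<psi> i * (\<Sum>j\<in>J. a i j * y j))" by blast
  have "b j = (\<Sum>i\<in>I. \<psi> i * a i j)" if "j \<in> J" for j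
    using \<psi>[of "\<lambda>k. if k = j then 1 else 0"] that assms(2)
    by (simp add: if_distrib[of "\<lambda>t. _ * t"] cong: if_cong)
  then show ?thesis by blast
qed

text \<open>Universal coefficients over a field, needed because the Betti numbers are defined by
  homology whereas the Cech complex yields the transposed matrices. A cocycle is sent to its values
  on the representing cycles in X; kernel and image of this map are both found by
  \<open>fredholm_alternative\<close>.\<close>

lemma quot_iso_cohomology:
  fixes m :: "'c \<Rightarrow> 'c \<Rightarrow> 'k::field"
  assumes fin: "finite Cm" "finite C0" "finite Cp"
    and X: "quot_basis pscale {c \<in> coords C0. \<forall>\<rho>\<in>Cm. (\<Sum>\<tau>\<in>C0. m \<rho> \<tau> * c \<tau>) = 0}
      ((\<lambda>c \<rho>. if \<rho> \<in> C0 then \<Sum>\<tau>\<in>Cp. m \<rho> \<tau> * c \<tau> else 0) ` coords Cp) X"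
  shows "quot_iso pscale {\<phi> \<in> coords C0. \<forall>\<tau>\<in>Cp. (\<Sum>\<rho>\<in>C0. m \<rho> \<tau> * \<phi> \<rho>) = 0}
      ((\<lambda>\<psi> \<tau>. if \<tau> \<in> C0 then \<Sum>\<rho>\<in>Cm. m \<rho> \<tau> * \<psi> \<rho> else 0) ` coords Cm)
      pscale (coords X) {0}"
proof -
  let ?Z = "{c \<in> coords C0. \<forall>\<rho>\<in>Cm. (\<Sum>\<tau>\<in>C0. m \<rho> \<tau> * c \<tau>) = 0}"
  let ?B = "(\<lambda>c \<rho>. if \<rho> \<in> C0 then \<Sum>\<tau>\<in>Cp. m \<rho> \<tau> * c \<tau> else 0) ` coords Cp"
  let ?Zc = "{\<phi> \<in> coords C0. \<forall>\<tau>\<in>Cp. (\<Sum>\<rho>\<in>C0. m \<rho> \<tau> * \<phi> \<rho>) = 0}"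
  let ?Bc = "(\<lambda>\<psi> \<tau>. if \<tau> \<in> C0 then \<Sum>\<rho>\<in>Cm. m \<rho> \<tau> * \<psi> \<rho> else 0) ` coords Cm"
  define pr where "pr \<phi> x = (\<Sum>\<rho>\<in>C0. \<phi> \<rho> * x \<rho>)" for \<phi> x :: "'c \<Rightarrow> 'k"
  have finX: "finite X" and XZ: "X \<subseteq> ?Z"
    and ex1: "\<And>z. z \<in> ?Z \<Longrightarrow> \<exists>!a. (\<forall>x. x \<notin> X \<longrightarrow> a x = 0) \<and> z - (\<Sum>x\<in>X. pscale (a x) x) \<in> ?B"
    using X unfolding quot_basis_def by blast+
  have prB: "pr \<phi> b = 0" if \<phi>: "\<phi> \<in> ?Zc" and bB: "b \<in> ?B" for \<phi> b
  proof -
    obtain c where b: "b = (\<lambda>\<rho>. if \<rho> \<in> C0 then \<Sum>\<tau>\<in>Cp. m \<rho> \<tau> * c \<tau> else 0)" using bB by auto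
    have "pr \<phi> b = (\<Sum>\<rho>\<in>C0. \<Sum>\<tau>\<in>Cp. c \<tau> * (m \<rho> \<tau> * \<phi> \<rho>))"
      unfolding pr_def b by (intro sum.cong refl) (simp add: sum_distrib_left mult_ac)
    also have "\<dots> = (\<Sum>\<tau>\<in>Cp. c \<tau> * (\<Sum>\<rho>\<in>C0. m \<rho> \<tau> * \<phi> \<rho>))"
      by (subst sum.swap) (simp add: sum_distrib_left)
    also have "\<dots> = 0" using \<phi> by (intro sum.neutral) auto
    finally show ?thesis .
  qed
  have pr_add: "pr \<phi> (x + y) = pr \<phi> x + pr \<phi> y" for \<phi> x y
    by (simp add: pr_def algebra_simps sum.distrib)
  have pr_sum: "pr \<phi> (\<Sum>x\<in>Y. pscale (a x) x) = (\<Sum>x\<in>Y. a x * pr \<phi> x)" for \<phi> a Y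
    by (simp add: pr_def sum_fun_apply pscale_def sum_distrib_left, subst sum.swap)
       (simp add: mult_ac)
  have cob: "\<phi> \<in> ?Bc \<longleftrightarrow> (\<forall>x\<in>X. pr \<phi> x = 0)" if \<phi>: "\<phi> \<in> ?Zc" for \<phi>
  proof
    assume "\<phi> \<in> ?Bc"
    then obtain \<psi> where p: "\<phi> = (\<lambda>\<tau>. if \<tau> \<in> C0 then \<Sum>\<rho>\<in>Cm. m \<rho> \<tau> * \<psi> \<rho> else 0)" by auto
    show "\<forall>x\<in>X. pr \<phi> x = 0"
    proof
      fix x assume "x \<in> X"
      then have x: "\<And>\<rho>. \<rho> \<in> Cm \<Longrightarrow> (\<Sum>\<tau>\<in>C0. m \<rho> \<tau> * x \<tau>) = 0" using XZ by blast
      have "pr \<phi> x = (\<Sum>\<tau>\<in>C0. \<Sum>\<rho>\<in>Cm. \<psi> \<rho> * (m \<rho> \<tau> * x \<tau>))"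
        unfolding pr_def p by (intro sum.cong refl) (simp add: sum_distrib_left sum_distrib_right mult_ac)
      also have "\<dots> = (\<Sum>\<rho>\<in>Cm. \<psi> \<rho> * (\<Sum>\<tau>\<in>C0. m \<rho> \<tau> * x \<tau>))"
        by (subst sum.swap) (simp add: sum_distrib_left)
      also have "\<dots> = 0" using x by (intro sum.neutral) auto
      finally show "pr \<phi> x = 0" .
    qed
  next
    assume x0: "\<forall>x\<in>X. pr \<phi> x = 0"
    have "\<exists>\<psi>. \<forall>\<tau>\<in>C0. \<phi> \<tau> = (\<Sum>\<rho>\<in>Cm. \<psi> \<rho> * m \<rho> \<tau>)"
    proof (rule fredholm_alternative[OF fin(1,2)])
      \<comment> \<open>A possible obstruction y is a cycle, hence modulo boundaries a combination
        of X, on which \<phi> vanishes by assumption.\<close>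
      fix y assume y: "\<forall>\<rho>\<in>Cm. (\<Sum>\<tau>\<in>C0. m \<rho> \<tau> * y \<tau>) = 0"
      let ?z = "\<lambda>\<tau>. if \<tau> \<in> C0 then y \<tau> else 0"
      have "?z \<in> ?Z" using y by (auto simp: coords_def)
      then obtain a where a: "?z - (\<Sum>x\<in>X. pscale (a x) x) \<in> ?B" using ex1 by blast
      have "pr \<phi> ?z = pr \<phi> (?z - (\<Sum>x\<in>X. pscale (a x) x)) + pr \<phi> (\<Sum>x\<in>X. pscale (a x) x)"
        by (subst pr_add[symmetric]) (simp del: minus_apply plus_fun_apply)
      also have "\<dots> = 0" using prB[OF \<phi> a] x0 by (simp add: pr_sum)
      finally show "(\<Sum>\<tau>\<in>C0. \<phi> \<tau> * y \<tau>) = 0" by (simp add: pr_def)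
    qed
    then obtain \<psi> where \<psi>: "\<forall>\<tau>\<in>C0. \<phi> \<tau> = (\<Sum>\<rho>\<in>Cm. \<psi> \<rho> * m \<rho> \<tau>)" by blast
    have "\<phi> = (\<lambda>\<tau>. if \<tau> \<in> C0 then \<Sum>\<rho>\<in>Cm. m \<rho> \<tau> * (if \<rho> \<in> Cm then \<psi> \<rho> else 0) else 0)"
      using \<phi> \<psi> by (auto simp: fun_eq_iff coords_def mult.commute)
    then show "\<phi> \<in> ?Bc"
      by (intro image_eqI[where x = "\<lambda>\<rho>. if \<rho> \<in> Cm then \<psi> \<rho> else 0"]) (auto simp: coords_def)
  qed
  have surj: "\<exists>\<phi>\<in>?Zc. \<forall>x\<in>X. pr \<phi> x = h x" for h
  proof -
    \<comment> \<open>A single system prescribes the values on X and imposes the cocycle condition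
      on \<open>Cp\<close>. An obstruction is a combination of X that is a boundary, so its
      coefficients on X are zero.\<close>
    have "\<exists>\<psi>. \<forall>j\<in>X <+> Cp. case_sum h (\<lambda>_. 0) j = (\<Sum>\<rho>\<in>C0. \<psi> \<rho> * case_sum (\<lambda>x. x \<rho>) (m \<rho>) j)"
    proof (rule fredholm_alternative[OF fin(2)])
      show "finite (X <+> Cp)" using finX fin by simp
      fix y assume y: "\<forall>\<rho>\<in>C0. (\<Sum>j\<in>X <+> Cp. case_sum (\<lambda>x. x \<rho>) (m \<rho>) j * y j) = 0"
      let ?z = "\<Sum>x\<in>X. pscale (y (Inl x)) x"
      interpret vector_space "pscale :: 'k \<Rightarrow> ('c \<Rightarrow> 'k) \<Rightarrow> _" by (rule vector_space_pscale)
      have sub: "subspace ?Z" by (rule subspaceI) (auto simp: coords_def pscale_def algebra_simps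
        sum.distrib simp flip: sum_distrib_left)
      have zZ: "?z \<in> ?Z"
        by (intro subspace_sum[OF sub] subspace_scale[OF sub]) (use XZ in blast)
      have "?z = (\<lambda>\<rho>. if \<rho> \<in> C0 then \<Sum>\<tau>\<in>Cp. m \<rho> \<tau> * (if \<tau> \<in> Cp then - y (Inr \<tau>) else 0) else 0)"
      proof
        fix \<rho>
        show "?z \<rho> = (if \<rho> \<in> C0 then \<Sum>\<tau>\<in>Cp. m \<rho> \<tau> * (if \<tau> \<in> Cp then - y (Inr \<tau>) else 0) else 0)"
        proof (cases "\<rho> \<in> C0")
          case True
          then have "(\<Sum>x\<in>X. x \<rho> * y (Inl x)) + (\<Sum>\<tau>\<in>Cp. m \<rho> \<tau> * y (Inr \<tau>)) = 0"
            using y finX fin by (auto simp: sum.Plus)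
          then show ?thesis using True
            by (simp add: sum_fun_apply pscale_def mult.commute sum_negf eq_neg_iff_add_eq_0)
        next
          case False then show ?thesis using zZ by (auto simp: coords_def)
        qed
      qed
      then have zB: "?z \<in> ?B"
        by (intro image_eqI[where x = "\<lambda>\<tau>. if \<tau> \<in> Cp then - y (Inr \<tau>) else 0"]) (auto simp: coords_def)
      have zero: "(0::'c \<Rightarrow> 'k) \<in> ?B" by (rule image_eqI[of _ _ 0]) (auto simp: coords_def fun_eq_iff)
      have "(\<lambda>x. if x \<in> X then y (Inl x) else 0) = (\<lambda>x. 0)"
        using zB zero by (intro ex1_eqI[OF ex1[OF zZ]] conjI) (auto simp: )
      then have "\<And>x. x \<in> X \<Longrightarrow> y (Inl x) = 0" by (metis (mono_tags))
      then show "(\<Sum>j\<in>X <+> Cp. case_sum h (\<lambda>_. 0) j * y j) = 0"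
        using finX fin by (simp add: sum.Plus)
    qed
    then obtain \<psi> where \<psi>: "\<And>x. x \<in> X \<Longrightarrow> h x = (\<Sum>\<rho>\<in>C0. \<psi> \<rho> * x \<rho>)"
      "\<And>\<tau>. \<tau> \<in> Cp \<Longrightarrow> 0 = (\<Sum>\<rho>\<in>C0. \<psi> \<rho> * m \<rho> \<tau>)" by force
    show ?thesis
      by (rule bexI[of _ "\<lambda>\<rho>. if \<rho> \<in> C0 then \<psi> \<rho> else 0"])
         (auto simp: pr_def coords_def \<psi>(1) mult.commute[of "m _ _"] simp flip: \<psi>(2))
  qed
  show ?thesis
  proof (rule quot_isoI[where R = "\<lambda>\<phi> h. \<phi> \<in> ?Zc \<and> h = (\<lambda>x. if x \<in> X then pr \<phi> x else 0)"], goal_cases)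
    case (1 \<phi> h) then show ?case using cob[of \<phi>] by (auto simp: coords_def fun_eq_iff)
  next
    case (2 \<phi>) then show ?case by blast
  next
    case (3 h)
    from surj[of h] obtain \<phi> where "\<phi> \<in> ?Zc" "\<forall>x\<in>X. pr \<phi> x = h x" by blast
    then show ?case using 3 by (intro exI[of _ \<phi>]) (auto simp: coords_def fun_eq_iff)
  next
    case (4 \<phi> h \<phi>' h')
    then show ?case by (auto simp: coords_def pr_def algebra_simps sum.distrib fun_eq_iff)
  next
    case (5 a \<phi> h)
    then show ?case by (auto simp: coords_def pr_def pscale_def algebra_simps fun_eq_iff simp flip: sum_distrib_left)
  qed
qed

text \<open>A basis of Z \<inter> B is extended to a basis of Z; the added vectors are the
  representatives.\<close>

lemma quot_basis_exists:
  fixes Z B :: "('c \<Rightarrow> 'k::field) set"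
  assumes "finite I" "Z \<subseteq> coords I" "module.subspace pscale Z" "module.subspace pscale B"
  shows "\<exists>X. quot_basis pscale Z B X"
proof -
  interpret vector_space "pscale :: 'k \<Rightarrow> ('c \<Rightarrow> 'k) \<Rightarrow> _" by (rule vector_space_pscale)
  define e :: "'c \<Rightarrow> 'c \<Rightarrow> 'k" where "e i = (\<lambda>j. if j = i then 1 else 0)" for i
  have span: "coords I \<subseteq> span (e ` I)"
  proof
    fix f :: "'c \<Rightarrow> 'k" assume f: "f \<in> coords I"
    have "f = (\<Sum>i\<in>I. pscale (f i) (e i))"
      using f assms(1) by (auto simp: fun_eq_iff sum_fun_apply pscale_def e_def coords_def
        if_distrib[of "\<lambda>t. _ * t"] cong: if_cong)
    also have "\<dots> \<in> span (e ` I)" by (intro span_sum span_scale span_base) auto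
    finally show "f \<in> span (e ` I)" .
  qed
  obtain Y where Y: "Y \<subseteq> Z \<inter> B" "independent Y" "Z \<inter> B \<subseteq> span Y"
    using maximal_independent_subset[of "Z \<inter> B"] by metis
  obtain W where W: "Y \<subseteq> W" "W \<subseteq> Z" "independent W" "Z \<subseteq> span W"
    using maximal_independent_subset_extend[of Y Z] Y by (metis le_inf_iff)
  have finW: "finite W"
    using independent_span_bound[of "e ` I" W] W assms span by blast
  have YB: "span Y \<subseteq> Z \<inter> B" using Y assms(3,4) by (intro span_minimal subspace_inter) auto
  have finY: "finite Y" using finW W finite_subset by blast
  have "quot_basis pscale Z B (W - Y)"
    unfolding quot_basis_def
  proof (intro conjI ballI)
    show "finite (W - Y)" using finW by simp
    show "W - Y \<subseteq> Z" using W by blast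
    fix z assume z: "z \<in> Z"
    then obtain u where u: "z = (\<Sum>w\<in>W. pscale (u w) w)"
      using W(4) span_finite[OF finW] by blast
    have "z - (\<Sum>w\<in>W - Y. pscale (u w) w) = (\<Sum>w\<in>Y. pscale (u w) w)"
      unfolding u using sum.subset_diff[OF W(1) finW, of "\<lambda>w. pscale (u w) w"] by (simp del: minus_apply)
    also have "\<dots> \<in> span Y" by (intro span_sum span_scale span_base)
    finally have ex: "z - (\<Sum>w\<in>W - Y. pscale (u w) w) \<in> B" using YB by blast
    show "\<exists>!a. (\<forall>x. x \<notin> W - Y \<longrightarrow> a x = 0) \<and> z - (\<Sum>x\<in>W - Y. pscale (a x) x) \<in> B"
    proof (rule ex1I[of _ "\<lambda>w. if w \<in> W - Y then u w else 0"])
      show "(\<forall>x. x \<notin> W - Y \<longrightarrow> (if x \<in> W - Y then u x else 0) = 0) \<and>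
        z - (\<Sum>x\<in>W - Y. pscale (if x \<in> W - Y then u x else 0) x) \<in> B"
        using ex by (auto simp del: Diff_iff minus_apply cong: sum.cong)
      fix a assume a: "(\<forall>x. x \<notin> W - Y \<longrightarrow> a x = 0) \<and> z - (\<Sum>x\<in>W - Y. pscale (a x) x) \<in> B"
      let ?t = "\<Sum>w\<in>W - Y. pscale (a w - u w) w"
      have "?t = (z - (\<Sum>w\<in>W - Y. pscale (u w) w)) - (z - (\<Sum>x\<in>W - Y. pscale (a x) x))"
        by (simp add: scale_left_diff_distrib sum_subtractf del: minus_apply)
      also have "\<dots> \<in> B" using ex a assms(4) subspace_diff by blast
      finally have "?t \<in> B" .
      moreover have "?t \<in> Z"
        by (intro subspace_sum[OF assms(3)] subspace_scale[OF assms(3)]) (use W(2) in blast)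
      ultimately have "?t \<in> span Y" using Y(3) by blast
      then obtain v where v: "?t = (\<Sum>w\<in>Y. pscale (v w) w)" using span_finite[OF finY] by blast
      have "(\<Sum>w\<in>W. pscale (if w \<in> Y then - v w else a w - u w) w) = 0"
        unfolding sum.subset_diff[OF W(1) finW] using v by (simp add: sum_negf)
      then have "\<forall>w\<in>W. (if w \<in> Y then - v w else a w - u w) = 0"
        using independentD[OF W(3) finW subset_refl, of "\<lambda>w. if w \<in> Y then - v w else a w - u w"] by blast
      then show "a = (\<lambda>w. if w \<in> W - Y then u w else 0)" using a by (auto simp: fun_eq_iff)
    qed
  qed
  then show ?thesis by blast
qed

section \<open>Complexes indexed by finite sets\<close>

definition csign :: "('i \<Rightarrow> nat) \<Rightarrow> 'i \<Rightarrow> 'i set \<Rightarrow> 'a::comm_ring_1" where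
  "csign ix v F = (- 1) ^ card {u \<in> F. ix u < ix v}"

text \<open>The factor \<open>prod e F\<close> restricts to the common support of the generators in
  F. It is present because generators may be zero divisors, and then the map from the localisation
  at \<open>F - {v}\<close> to the one at F is not an inclusion.\<close>

definition cdiff ::
  "('i \<Rightarrow> nat) \<Rightarrow> ('i \<Rightarrow> 'a::comm_ring_1) \<Rightarrow> 'i set \<Rightarrow> ('i set \<Rightarrow> 'a) \<Rightarrow> 'i set \<Rightarrow> 'a" where
  "cdiff ix e U c F =
     (if F \<subseteq> U then prod e F * (\<Sum>v\<in>F. csign ix v F * c (F - {v})) else 0)"

definition coch :: "'i set \<Rightarrow> ('i set \<Rightarrow> 'a::zero set) \<Rightarrow> int \<Rightarrow> ('i set \<Rightarrow> 'a) set" where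
  "coch U L p = {c. \<forall>F. if F \<subseteq> U \<and> int (card F) = p then c F \<in> L F else c F = 0}"

text \<open>The contraction attached to a partition of unity r, as for the Cech complex of a
  covering: multiplication by \<open>r i\<close> brings the value at \<open>insert i F\<close> back
  to F.\<close>

definition htpy ::
  "('i \<Rightarrow> nat) \<Rightarrow> 'i set \<Rightarrow> ('i \<Rightarrow> 'a::comm_ring_1) \<Rightarrow> ('i set \<Rightarrow> 'a) \<Rightarrow> 'i set \<Rightarrow> 'a" where
  "htpy ix U r c F =
     (if F \<subseteq> U then \<Sum>i\<in>U - F. csign ix i (insert i F) * (r i * c (insert i F)) else 0)"

lemma csign_sq [simp]: "csign ix v F * csign ix v F = (1::'a::comm_ring_1)"
  by (simp add: csign_def flip: power_add)

lemma csign_insert: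
  assumes "finite F" "i \<notin> F"
  shows "csign ix v (insert i F) = (if ix i < ix v then - 1 else 1) * csign ix v F"
proof (cases "ix i < ix v")
  case True
  then have "{u \<in> insert i F. ix u < ix v} = insert i {u \<in> F. ix u < ix v}" by auto
  then show ?thesis using assms True by (simp add: csign_def)
next
  case False
  then have "{u \<in> insert i F. ix u < ix v} = {u \<in> F. ix u < ix v}" by auto
  then show ?thesis using False by (simp add: csign_def)
qed

lemma csign_remove:
  assumes "finite F" "i \<in> F"
  shows "csign ix v (F - {i}) = (if ix i < ix v then - 1 else 1) * (csign ix v F :: 'a::comm_ring_1)"
proof -
  have F: "insert i (F - {i}) = F" using assms by blast
  have "(csign ix v F :: 'a) = (if ix i < ix v then - 1 else 1) * csign ix v (F - {i})"
    using csign_insert[of "F - {i}" i ix v, unfolded F] assms by blast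
  then show ?thesis by auto
qed

lemma csign_swap_remove:
  assumes "finite F" "v \<in> F" "w \<in> F" "ix v \<noteq> ix w"
  shows "csign ix v F * csign ix w (F - {v}) = - (csign ix w F * csign ix v (F - {w}))"
  using assms by (auto simp: csign_remove mult.commute)

lemma csign_swap:
  assumes "finite F" "v \<in> F" "i \<notin> F" "ix v \<noteq> ix i"
  shows "csign ix v F * csign ix i (insert i (F - {v})) =
    - (csign ix i (insert i F) * csign ix v (insert i F))"
  using assms by (auto simp: csign_remove csign_insert mult.commute)

text \<open>The pairs (v, w) and (w, v) are cancelled explicitly, so the argument also covers
  characteristic 2, where S = - S gives nothing.\<close>

lemma sum_antisym_zero:
  fixes t :: "'i \<Rightarrow> 'i \<Rightarrow> 'a::ab_group_add"
  assumes "finite F" "\<And>v w. v \<in> F \<Longrightarrow> w \<in> F \<Longrightarrow> v \<noteq> w \<Longrightarrow> t v w = - t w v"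
  shows "(\<Sum>v\<in>F. \<Sum>w\<in>F - {v}. t v w) = 0"
  using assms
proof (induction F rule: finite_induct)
  case (insert x F)
  have *: "(\<Sum>w\<in>insert x F - {v}. t v w) = t v x + (\<Sum>w\<in>F - {v}. t v w)" if "v \<in> F" for v
  proof -
    have "insert x F - {v} = insert x (F - {v})" using that insert.hyps by auto
    then show ?thesis using insert.hyps by simp
  qed
  have "(\<Sum>v\<in>insert x F. \<Sum>w\<in>insert x F - {v}. t v w) =
    (\<Sum>w\<in>F. t x w) + ((\<Sum>v\<in>F. t v x) + (\<Sum>v\<in>F. \<Sum>w\<in>F - {v}. t v w))"
    using insert.hyps by (simp add: * sum.distrib)
  also have "(\<Sum>v\<in>F. \<Sum>w\<in>F - {v}. t v w) = 0" using insert by blast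
  also have "(\<Sum>v\<in>F. t v x) = (\<Sum>v\<in>F. - t x v)"
  proof (intro sum.cong refl)
    fix v assume "v \<in> F"
    then have "v \<noteq> x" using insert.hyps by blast
    then show "t v x = - t x v" using \<open>v \<in> F\<close> insert.prems[of v x] by blast
  qed
  finally show ?case by (simp add: sum_negf)
qed simp

lemma cdiff_add: "cdiff ix e U (x + y) = cdiff ix e U x + cdiff ix e U y"
  by (auto simp: cdiff_def fun_eq_iff distrib_left sum.distrib)

lemma cdiff_minus: "cdiff ix e U (x - y) = cdiff ix e U x - cdiff ix e U y"
  by (auto simp: cdiff_def fun_eq_iff right_diff_distrib sum_subtractf)

lemma cdiff_scale: "cdiff ix e U (\<lambda>F. k * c F) = (\<lambda>F. k * cdiff ix e U c F)"
proof
  fix F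
  have "(\<Sum>v\<in>F. csign ix v F * (k * c (F - {v}))) = k * (\<Sum>v\<in>F. csign ix v F * c (F - {v}))"
    unfolding sum_distrib_left by (intro sum.cong refl) (rule mult.left_commute)
  then show "cdiff ix e U (\<lambda>F. k * c F) F = k * cdiff ix e U c F"
    by (simp add: cdiff_def mult.left_commute)
qed

lemma cdiff_cdiff:
  fixes e :: "'i \<Rightarrow> 'a::comm_ring_1"
  assumes "finite U" "inj_on ix U" "\<And>i. i \<in> U \<Longrightarrow> e i * e i = e i"
  shows "cdiff ix e U (cdiff ix e U c) = 0"
proof
  fix F
  show "cdiff ix e U (cdiff ix e U c) F = 0 F"
  proof (cases "F \<subseteq> U")
    case True
    then have fin: "finite F" using assms finite_subset by blast
    \<comment> \<open>Idempotency absorbs the inner restriction into the outer one.\<close>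
    have e: "prod e F * prod e (F - {v}) = prod e F" if "v \<in> F" for v
    proof -
      have "prod e (F - {v}) * prod e (F - {v}) = prod e (F - {v})"
        using True assms(3) by (subst prod.distrib[symmetric]) (auto intro!: prod.cong)
      then show ?thesis using prod.remove[OF fin that, of e] by (simp add: mult.assoc)
    qed
    have "cdiff ix e U (cdiff ix e U c) F =
       (\<Sum>v\<in>F. csign ix v F * (prod e F * prod e (F - {v}) *
          (\<Sum>w\<in>F - {v}. csign ix w (F - {v}) * c (F - {v} - {w}))))"
      using True by (auto simp: cdiff_def sum_distrib_left mult_ac intro!: sum.cong)
    also have "\<dots> = prod e F * (\<Sum>v\<in>F. \<Sum>w\<in>F - {v}.
        csign ix v F * csign ix w (F - {v}) * c (F - {v} - {w}))"
      by (simp add: e sum_distrib_left mult_ac)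
    also have "(\<Sum>v\<in>F. \<Sum>w\<in>F - {v}.
        csign ix v F * csign ix w (F - {v}) * c (F - {v} - {w})) = 0"
    proof (rule sum_antisym_zero[OF fin])
      fix v w assume vw: "v \<in> F" "w \<in> F" "v \<noteq> w"
      then have "ix v \<noteq> ix w" using True assms(2) by (auto dest: inj_onD)
      moreover have "F - {v} - {w} = F - {w} - {v}" by auto
      ultimately show "csign ix v F * csign ix w (F - {v}) * c (F - {v} - {w}) =
        - (csign ix w F * csign ix v (F - {w}) * c (F - {w} - {v}))"
        using csign_swap_remove[OF fin vw(1,2), of ix, where ?'b = 'a] by simp
    qed
    finally show ?thesis by simp
  qed (simp add: cdiff_def)
qed

text \<open>In the sum of the two composites the mixed terms cancel by \<open>csign_swap\<close>;
  only the terms where the same index is put in and taken out survive. Where the \<open>r i\<close>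
  sum to 1 on the support, this is a contraction.\<close>

lemma cdiff_htpy:
  fixes e r :: "'i \<Rightarrow> 'a::comm_ring_1"
  assumes U: "finite U" "inj_on ix U" and F: "F \<subseteq> U" and r: "\<And>i. i \<in> U \<Longrightarrow> r i * e i = r i"
  shows "cdiff ix e U (htpy ix U r c) F + htpy ix U r (cdiff ix e U c) F =
    prod e F * (\<Sum>i\<in>U. r i) * c F"
proof -
  have fin: "finite F" using U F finite_subset by blast
  let ?s = "csign ix :: 'i \<Rightarrow> 'i set \<Rightarrow> 'a"
  define X where "X = (\<Sum>v\<in>F. \<Sum>i\<in>U - F.
      ?s v F * ?s i (insert i (F - {v})) * (r i * c (insert i (F - {v}))))"
  have "htpy ix U r c (F - {v}) = ?s v F * (r v * c F) +
     (\<Sum>i\<in>U - F. ?s i (insert i (F - {v})) * (r i * c (insert i (F - {v}))))" if v: "v \<in> F" for v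
  proof -
    have "U - (F - {v}) = insert v (U - F)" using v F by auto
    moreover have "insert v (F - {v}) = F" using v by auto
    moreover have "F - {v} \<subseteq> U" using F by auto
    ultimately show ?thesis using U v by (simp add: htpy_def)
  qed
  then have 1: "cdiff ix e U (htpy ix U r c) F =
    prod e F * ((\<Sum>v\<in>F. ?s v F * ?s v F * (r v * c F)) + X)"
    unfolding cdiff_def X_def using F
    by (simp add: distrib_left sum.distrib sum_distrib_left mult.assoc del: csign_sq)
  have 2: "r i * cdiff ix e U c (insert i F) = prod e F *
     (?s i (insert i F) * (r i * c F) + (\<Sum>v\<in>F. ?s v (insert i F) * (r i * c (insert i (F - {v})))))"
    if i: "i \<in> U - F" for i
  proof -
    have "insert i F - {v} = insert i (F - {v})" if "v \<in> F" for v using that i by auto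
    moreover have "insert i F - {i} = F" using i by auto
    ultimately have "cdiff ix e U c (insert i F) = e i * prod e F *
      (?s i (insert i F) * c F + (\<Sum>v\<in>F. ?s v (insert i F) * c (insert i (F - {v}))))"
      using fin i F by (simp add: cdiff_def)
    then have "r i * cdiff ix e U c (insert i F) = (r i * e i) * (prod e F *
      (?s i (insert i F) * c F + (\<Sum>v\<in>F. ?s v (insert i F) * c (insert i (F - {v})))))"
      by (simp add: mult_ac)
    also have "\<dots> = prod e F *
     (?s i (insert i F) * (r i * c F) + (\<Sum>v\<in>F. ?s v (insert i F) * (r i * c (insert i (F - {v})))))"
      using r i by (simp add: distrib_left sum_distrib_left mult_ac)
    finally show ?thesis .
  qed
  define Y where "Y = (\<Sum>i\<in>U - F. \<Sum>v\<in>F.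
      ?s i (insert i F) * ?s v (insert i F) * (r i * c (insert i (F - {v}))))"
  have 3: "htpy ix U r (cdiff ix e U c) F =
    prod e F * ((\<Sum>i\<in>U - F. ?s i (insert i F) * ?s i (insert i F) * (r i * c F)) + Y)"
    unfolding htpy_def Y_def using F
    by (simp add: 2 distrib_left sum.distrib sum_distrib_left mult_ac)
  have "X = - Y"
  proof -
    have "X = (\<Sum>i\<in>U - F. \<Sum>v\<in>F.
      ?s v F * ?s i (insert i (F - {v})) * (r i * c (insert i (F - {v}))))"
      unfolding X_def by (rule sum.swap)
    also have "\<dots> = (\<Sum>i\<in>U - F. \<Sum>v\<in>F.
      - (?s i (insert i F) * ?s v (insert i F) * (r i * c (insert i (F - {v})))))"
    proof (intro sum.cong refl)
      fix i v assume "i \<in> U - F" "v \<in> F"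
      moreover from this have "ix v \<noteq> ix i" using F U by (metis Diff_iff inj_onD subsetD)
      ultimately show "?s v F * ?s i (insert i (F - {v})) * (r i * c (insert i (F - {v}))) =
        - (?s i (insert i F) * ?s v (insert i F) * (r i * c (insert i (F - {v}))))"
        using csign_swap[OF fin, of v i ix, where ?'b = 'a] by simp
    qed
    finally show ?thesis by (simp add: Y_def sum_negf)
  qed
  moreover have "(\<Sum>v\<in>F. r v * c F) + (\<Sum>i\<in>U - F. r i * c F) = (\<Sum>i\<in>U. r i) * c F"
    using sum.subset_diff[OF F U(1), of "\<lambda>i. r i * c F"] by (simp add: sum_distrib_right)
  ultimately show ?thesis unfolding 1 3 by (simp add: mult.assoc flip: distrib_left)
qed

text \<open>\<open>L F\<close> stands for the localisation at F, taken inside one ambient ring so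
  that values at different index sets can be added; \<kappa> embeds the scalars.\<close>

locale cech_complex =
  fixes ix :: "'i \<Rightarrow> nat" and e :: "'i \<Rightarrow> 'a::comm_ring_1" and U :: "'i set"
    and L :: "'i set \<Rightarrow> 'a set" and \<kappa> :: "'k::field \<Rightarrow> 'a"
  assumes finU: "finite U" and inj: "inj_on ix U"
    and idem: "\<And>i. i \<in> U \<Longrightarrow> e i * e i = e i"
    and L0: "\<And>F. F \<subseteq> U \<Longrightarrow> 0 \<in> L F"
    and Ladd: "\<And>F x y. F \<subseteq> U \<Longrightarrow> x \<in> L F \<Longrightarrow> y \<in> L F \<Longrightarrow> x + y \<in> L F"
    and Lneg: "\<And>F x. F \<subseteq> U \<Longrightarrow> x \<in> L F \<Longrightarrow> - x \<in> L F"
    and Lscale: "\<And>F a x. F \<subseteq> U \<Longrightarrow> x \<in> L F \<Longrightarrow> \<kappa> a * x \<in> L F"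
    and Lmono: "\<And>F v x. F \<subseteq> U \<Longrightarrow> v \<in> F \<Longrightarrow> x \<in> L (F - {v}) \<Longrightarrow> prod e F * x \<in> L F"
begin

lemma Lsum: "F \<subseteq> U \<Longrightarrow> (\<And>v. v \<in> V \<Longrightarrow> f v \<in> L F) \<Longrightarrow> (\<Sum>v\<in>V. f v) \<in> L F"
  by (induction V rule: infinite_finite_induct) (auto intro: L0 Ladd)

lemma Lsign: "F \<subseteq> U \<Longrightarrow> x \<in> L F \<Longrightarrow> csign ix v G * x \<in> L F"
  unfolding csign_def by (cases "even (card {u \<in> G. ix u < ix v})") (auto intro: Lneg)

lemma coch_add: "x \<in> coch U L q \<Longrightarrow> y \<in> coch U L q \<Longrightarrow> x + y \<in> coch U L q"
  unfolding coch_def by (auto intro: Ladd)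

lemma coch_diff: "x \<in> coch U L q \<Longrightarrow> y \<in> coch U L q \<Longrightarrow> x - y \<in> coch U L q"
  unfolding coch_def using Ladd[OF _ _ Lneg] by fastforce

lemma coch_scale: "x \<in> coch U L q \<Longrightarrow> (\<lambda>F. \<kappa> a * x F) \<in> coch U L q"
  unfolding coch_def by (auto intro: Lscale)

lemma coch_cdiff:
  assumes "c \<in> coch U L q"
  shows "cdiff ix e U c \<in> coch U L (q + 1)"
  unfolding coch_def
proof (intro CollectI allI)
  fix F
  show "if F \<subseteq> U \<and> int (card F) = q + 1 then cdiff ix e U c F \<in> L F else cdiff ix e U c F = 0"
  proof (cases "F \<subseteq> U")
    case F: True
    have fin: "finite F" using F finU finite_subset by blast
    have card: "int (card (F - {v})) = int (card F) - 1" if "v \<in> F" for v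
      using card_Suc_Diff1[OF fin that] by linarith
    have eq: "cdiff ix e U c F = (\<Sum>v\<in>F. csign ix v F * (prod e F * c (F - {v})))"
      using F by (simp add: cdiff_def sum_distrib_left mult_ac)
    show ?thesis
    proof (cases "int (card F) = q + 1")
      case True
      have "c (F - {v}) \<in> L (F - {v})" if "v \<in> F" for v
      proof -
        have "F - {v} \<subseteq> U" "int (card (F - {v})) = q" using F True card[OF that] by auto
        then show ?thesis using assms unfolding coch_def by auto
      qed
      then have "cdiff ix e U c F \<in> L F"
        unfolding eq by (intro Lsum Lsign Lmono F) auto
      then show ?thesis using F True by simp
    next
      case False
      have "c (F - {v}) = 0" if "v \<in> F" for v
        using assms False card[OF that] unfolding coch_def by auto
      then show ?thesis using False by (simp add: eq)
    qed
  qed (simp add: cdiff_def)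
qed

definition cocyc where "cocyc p = {c \<in> coch U L p. cdiff ix e U c = 0}"
definition cobd where "cobd p = cdiff ix e U ` coch U L (p - 1)"
definition csc where "csc a c = (\<lambda>F. \<kappa> a * c F)"

lemma quot_iso_from_cech:
  fixes C' :: "int \<Rightarrow> 'w::ab_group_add set"
  assumes f: "\<And>q x. x \<in> coch U L q \<Longrightarrow> f x \<in> C' q" "\<And>q y. y \<in> C' q \<Longrightarrow> \<exists>x\<in>coch U L q. f x = y"
      "\<And>q x y. x \<in> coch U L q \<Longrightarrow> y \<in> coch U L q \<Longrightarrow> f (x + y) = f x + f y"
      "\<And>q x y. x \<in> coch U L q \<Longrightarrow> y \<in> coch U L q \<Longrightarrow> f (x - y) = f x - f y"
      "\<And>q a x. x \<in> coch U L q \<Longrightarrow> f (csc a x) = s' a (f x)"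
      "\<And>q x. x \<in> coch U L q \<Longrightarrow> f (cdiff ix e U x) = d' (f x)"
    and acyclic: "\<And>q x. x \<in> coch U L q \<Longrightarrow> f x = 0 \<Longrightarrow> cdiff ix e U x = 0 \<Longrightarrow>
       \<exists>k\<in>coch U L (q - 1). f k = 0 \<and> x = cdiff ix e U k"
  shows "quot_iso csc (cocyc p) (cobd p) s' {y \<in> C' p. d' y = 0} (d' ` C' (p - 1))"
  unfolding cocyc_def cobd_def
proof (rule quot_iso_complex_map[where C = "coch U L" and f = f, OF coch_add coch_diff])
  show "csc a x \<in> coch U L q" if "x \<in> coch U L q" for a q x
    using coch_scale[OF that] by (simp add: csc_def)
  show "csc a 0 = 0" for a by (auto simp: csc_def)
  show "cdiff ix e U (csc a x) = csc a (cdiff ix e U x)" for a x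
    by (simp add: csc_def cdiff_scale)
qed (use f acyclic in \<open>auto intro: coch_cdiff simp: cdiff_add cdiff_minus cdiff_cdiff[OF finU inj idem]\<close>)

end

section \<open>Cech complexes of a graded ring of field-valued functions\<close>

lemma power_fun_apply [simp]: "((f :: 'a \<Rightarrow> 'b::comm_ring_1) ^ n) x = f x ^ n"
  by (induction n) auto

lemma prod_fun_apply: "(\<Prod>i\<in>A. (f i :: 'a \<Rightarrow> 'b::comm_ring_1)) x = (\<Prod>i\<in>A. f i x)"
  by (induction A rule: infinite_finite_induct) auto

text \<open>As \<open>1 / 0 = 0\<close>, a zero divisor \<open>f\<close> has the generalised inverse \<open>pinv f\<close>, and
  \<open>f * pinv f\<close> is the idempotent that cuts out the support of \<open>f\<close>. Hence localising a ring
  of functions at \<open>f\<close> amounts to adjoining \<open>pinv f\<close>.\<close>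

definition pinv :: "('w \<Rightarrow> 'f::field) \<Rightarrow> 'w \<Rightarrow> 'f" where
  "pinv f = (\<lambda>w. inverse (f w))"

locale graded_function_ring =
  fixes D :: "int \<Rightarrow> ('w \<Rightarrow> 'f::field) set" and g :: "'i::finite \<Rightarrow> 'w \<Rightarrow> 'f"
    and ix :: "'i \<Rightarrow> nat" and \<kappa> :: "'k::field \<Rightarrow> 'w \<Rightarrow> 'f"
  assumes D0: "0 \<in> D q" and Dadd: "x \<in> D q \<Longrightarrow> y \<in> D q \<Longrightarrow> x + y \<in> D q"
    and Dneg: "x \<in> D q \<Longrightarrow> - x \<in> D q"
    and Dmult: "x \<in> D q \<Longrightarrow> y \<in> D r \<Longrightarrow> x * y \<in> D (q + r)"
    and D1: "1 \<in> D 0" and Dg: "g i \<in> D 1" and D\<kappa>: "\<kappa> a \<in> D 0" and ix: "inj ix"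
begin

definition supp_idem :: "'i \<Rightarrow> 'w \<Rightarrow> 'f" where "supp_idem i = g i * pinv (g i)"

text \<open>\<open>k \<ge> 1\<close> matters: with exponent 0 the denominator would be 1 even where
  \<open>prod g F\<close> vanishes, and elements of \<open>D d\<close> would survive there.\<close>

definition loc :: "int \<Rightarrow> 'i set \<Rightarrow> ('w \<Rightarrow> 'f) set" where
  "loc d F = {a * pinv (prod g F) ^ k | a k. k \<ge> 1 \<and> a \<in> D (d + int (k * card F))}"

lemma Dmult': "x \<in> D q \<Longrightarrow> y \<in> D r \<Longrightarrow> q + r = t \<Longrightarrow> x * y \<in> D t"
  using Dmult by blast

lemma Dpower: "x \<in> D q \<Longrightarrow> x ^ n \<in> D (int n * q)"
  by (induction n) (auto intro: D1 Dmult' simp: algebra_simps)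

lemma Dprod: "prod g F \<in> D (int (card F))"
proof (induction F rule: infinite_finite_induct)
  case (insert i F)
  have "g i * prod g F \<in> D (int (card (insert i F)))"
    by (rule Dmult'[OF Dg insert.IH]) (use insert.hyps in simp)
  then show ?case using insert.hyps by (simp del: times_fun_apply)
qed (auto intro: D1 simp del: one_fun_apply)

text \<open>All larger exponents are available, not just one; this is what gives finitely many
  elements a common exponent in \<open>loc_common\<close>.\<close>

lemma loc_raise:
  assumes "x \<in> loc d F"
  shows "\<exists>K0\<ge>1. \<forall>K\<ge>K0. \<exists>a\<in>D (d + int (K * card F)). x = a * pinv (prod g F) ^ K"
proof -
  obtain a k where a: "k \<ge> 1" "a \<in> D (d + int (k * card F))" "x = a * pinv (prod g F) ^ k"
    using assms by (auto simp: loc_def)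
  have "\<exists>b\<in>D (d + int (K * card F)). x = b * pinv (prod g F) ^ K" if "K \<ge> k" for K
  proof (rule bexI)
    show "x = (a * prod g F ^ (K - k)) * pinv (prod g F) ^ K"
    proof
      fix w
      show "x w = ((a * prod g F ^ (K - k)) * pinv (prod g F) ^ K) w"
      proof (cases "prod g F w = 0")
        case True then show ?thesis using a that by (simp add: pinv_def power_0_left)
      next
        case False
        have "inverse (prod g F w) ^ K = inverse (prod g F w) ^ (K - k) * inverse (prod g F w) ^ k"
          using that by (simp flip: power_add)
        then show ?thesis using a False by (simp add: pinv_def field_simps)
      qed
    qed
    show "a * prod g F ^ (K - k) \<in> D (d + int (K * card F))"
    proof -
      have "d + int (k * card F) + int (K - k) * int (card F) = d + int (K * card F)"
        using that by (simp add: of_nat_diff left_diff_distrib)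
      then show ?thesis using Dmult'[OF a(2) Dpower[OF Dprod[of F], of "K - k"]] by blast
    qed
  qed
  then show ?thesis using a(1) by blast
qed

lemma loc_common:
  assumes "finite X" "\<And>x. x \<in> X \<Longrightarrow> f x \<in> loc d (h x)"
  shows "\<exists>K\<ge>1. \<forall>x\<in>X. \<exists>a\<in>D (d + int (K * card (h x))). f x = a * pinv (prod g (h x)) ^ K"
proof -
  have "\<forall>x\<in>X. \<exists>K0\<ge>1. \<forall>K\<ge>K0. \<exists>a\<in>D (d + int (K * card (h x))). f x = a * pinv (prod g (h x)) ^ K"
    using loc_raise[OF assms(2)] by blast
  then obtain K0 where K0: "\<And>x K. x \<in> X \<Longrightarrow> K \<ge> K0 x \<Longrightarrow>
      \<exists>a\<in>D (d + int (K * card (h x))). f x = a * pinv (prod g (h x)) ^ K"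
    unfolding bchoice_iff by blast
  show ?thesis
  proof (intro exI[of _ "Suc (sum K0 X)"] conjI ballI)
    fix x assume "x \<in> X"
    then have "Suc (sum K0 X) \<ge> K0 x" using member_le_sum[of x X K0] assms(1) by auto
    then show "\<exists>a\<in>D (d + int (Suc (sum K0 X) * card (h x))). f x = a * pinv (prod g (h x)) ^ Suc (sum K0 X)"
      using K0 \<open>x \<in> X\<close> by blast
  qed simp
qed

lemma loc_add: assumes "x \<in> loc d F" "y \<in> loc d F" shows "x + y \<in> loc d F"
proof -
  obtain K where K: "K \<ge> 1" "\<forall>z\<in>{x, y}. \<exists>a\<in>D (d + int (K * card F)). z = a * pinv (prod g F) ^ K"
    using loc_common[of "{x, y}" "\<lambda>x. x" d "\<lambda>_. F"] assms by auto
  then obtain a b where "a \<in> D (d + int (K * card F))" "b \<in> D (d + int (K * card F))"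
    "x = a * pinv (prod g F) ^ K" "y = b * pinv (prod g F) ^ K" by blast
  then show ?thesis unfolding loc_def using K(1) Dadd
    by (intro CollectI exI[of _ "a + b"] exI[of _ K]) (simp add: distrib_right)
qed

lemma loc_zero: "0 \<in> loc d F"
  unfolding loc_def by (intro CollectI exI[of _ 0] exI[of _ 1]) (auto intro: D0)

lemma loc_mult_D: assumes "x \<in> loc d F" "y \<in> D q" shows "y * x \<in> loc (q + d) F"
proof -
  obtain a k where a: "k \<ge> 1" "a \<in> D (d + int (k * card F))" "x = a * pinv (prod g F) ^ k"
    using assms by (auto simp: loc_def)
  then show ?thesis unfolding loc_def using Dmult'[OF assms(2) a(2)]
    by (intro CollectI exI[of _ "y * a"] exI[of _ k]) (simp add: mult.assoc add.assoc)
qed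

lemma loc_neg: "x \<in> loc d F \<Longrightarrow> - x \<in> loc d F"
  using loc_mult_D[OF _ Dneg[OF D1], of x d F] by simp

lemma loc_sum: "(\<And>v. v \<in> V \<Longrightarrow> f v \<in> loc d F) \<Longrightarrow> (\<Sum>v\<in>V. f v) \<in> loc d F"
  by (induction V rule: infinite_finite_induct) (auto intro: loc_zero loc_add)

lemma supp_idem_idem: "supp_idem i * supp_idem i = supp_idem i"
proof
  fix w show "(supp_idem i * supp_idem i) w = supp_idem i w"
    by (cases "g i w = 0") (simp_all add: supp_idem_def pinv_def)
qed

lemma prod_supp_idem: "prod supp_idem F w = (if prod g F w = 0 then 0 else 1)"
proof -
  have "prod supp_idem F w = prod g F w * inverse (prod g F w)"
    unfolding supp_idem_def prod.distrib by (induction F rule: infinite_finite_induct) (auto simp: pinv_def)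
  then show ?thesis by simp
qed

lemma loc_supp: assumes "x \<in> loc d F" shows "prod supp_idem F * x = x"
proof -
  obtain a k where "k \<ge> 1" "x = a * pinv (prod g F) ^ k"
    using assms by (auto simp: loc_def)
  then show ?thesis by (auto simp: fun_eq_iff prod_supp_idem pinv_def)
qed

lemma loc_zero_outside: assumes "x \<in> loc d F" "finite F" "i \<in> F" "g i w = 0" shows "x w = 0"
proof -
  have "prod g F w = 0" using assms by (auto simp: prod_fun_apply)
  then show ?thesis using loc_supp[OF assms(1)] prod_supp_idem[of F w]
    by (metis mult_zero_left times_fun_apply)
qed

text \<open>The localisation map: the fraction is expanded by \<open>g v ^ k\<close> and restricted
  to the smaller support.\<close>

lemma loc_extend:
  assumes "v \<in> F" "x \<in> loc d (F - {v})"
  shows "prod supp_idem F * x \<in> loc d F"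
proof -
  obtain a k where a: "k \<ge> 1" "a \<in> D (d + int (k * card (F - {v})))" "x = a * pinv (prod g (F - {v})) ^ k"
    using assms by (auto simp: loc_def)
  have F: "prod g F = g v * prod g (F - {v})" using assms by (simp add: prod.remove)
  have "prod supp_idem F * x = (a * g v ^ k) * pinv (prod g F) ^ k"
  proof
    fix w
    show "(prod supp_idem F * x) w = ((a * g v ^ k) * pinv (prod g F) ^ k) w"
      using a(1) by (auto simp: prod_supp_idem F a(3) pinv_def power_mult_distrib field_simps)
  qed
  moreover have "int (card F) = int (card (F - {v})) + 1"
    using card_Suc_Diff1[OF _ assms(1)] by fastforce
  then have "a * g v ^ k \<in> D (d + int (k * card F))"
    using Dmult'[OF a(2) Dpower[OF Dg[of v], of k]] by (simp add: algebra_simps)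
  ultimately show ?thesis unfolding loc_def using a(1) by blast
qed

lemma cech: "cech_complex ix supp_idem U (loc d) \<kappa>"
proof
  show "\<kappa> a * x \<in> loc d F" if "x \<in> loc d F" for F a x
    using loc_mult_D[OF that D\<kappa>] by simp
qed (use ix in \<open>auto intro: inj_on_subset loc_zero loc_add loc_neg loc_extend simp: supp_idem_idem\<close>)

definition cocycles where
  "cocycles d p U = {c \<in> coch U (loc d) p. cdiff ix supp_idem U c = 0}"

definition coboundaries where
  "coboundaries d p U = cdiff ix supp_idem U ` coch U (loc d) (p - 1)"

definition scl :: "'k \<Rightarrow> ('i set \<Rightarrow> 'w \<Rightarrow> 'f) \<Rightarrow> 'i set \<Rightarrow> 'w \<Rightarrow> 'f" where
  "scl a c = (\<lambda>F. \<kappa> a * c F)"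

text \<open>Says that \<open>g b\<close> lies in the radical of the ideal generated by A. It is
  phrased with the ideals of N-th powers, which have the same radical, and with homogeneous
  coefficients, because the complexes are treated one degree at a time.\<close>

definition radical_witness :: "'i set \<Rightarrow> 'i \<Rightarrow> bool" where
  "radical_witness A b \<longleftrightarrow> (\<forall>N. \<exists>M s. (\<forall>i\<in>A. s i \<in> D (int M - int N)) \<and> g b ^ M = (\<Sum>i\<in>A. s i * g i ^ N))"

lemma radical_witness_mono:
  assumes "radical_witness A b" "A \<subseteq> B"
  shows "radical_witness B b"
  unfolding radical_witness_def
proof
  fix N
  obtain M s where s: "\<forall>i\<in>A. s i \<in> D (int M - int N)" "g b ^ M = (\<Sum>i\<in>A. s i * g i ^ N)"
    using assms(1) unfolding radical_witness_def by meson
  have "(\<Sum>i\<in>A. s i * g i ^ N) = (\<Sum>i\<in>B. (if i \<in> A then s i else 0) * g i ^ N)"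
    using assms(2) by (intro sum.mono_neutral_cong_left) auto
  then show "\<exists>M s. (\<forall>i\<in>B. s i \<in> D (int M - int N)) \<and> g b ^ M = (\<Sum>i\<in>B. s i * g i ^ N)"
    using s D0 by (intro exI[of _ M] exI[of _ "\<lambda>i. if i \<in> A then s i else 0"]) auto
qed

text \<open>The kernel of the restriction to subsets of A is indexed by the sets containing b: it
  is, up to a shift, the Cech complex of A over the localisation at b. There the powers of the
  generators in A generate the unit ideal, and the resulting partition of unity contracts the
  kernel.\<close>

lemma quot_iso_insert:
  assumes b: "b \<notin> A" and rad: "radical_witness A b"
  shows "quot_iso scl (cocycles d p (insert b A)) (coboundaries d p (insert b A))
     scl (cocycles d p A) (coboundaries d p A)"
proof -
  let ?U = "insert b A"
  interpret cech_complex ix supp_idem ?U "loc d" \<kappa> by (rule cech)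
  have sc: "csc = scl" by (simp add: csc_def scl_def fun_eq_iff)
  define f where "f c = (\<lambda>F. if F \<subseteq> A then c F else 0)" for c :: "'i set \<Rightarrow> 'w \<Rightarrow> 'f"
  have "quot_iso csc (cocyc p) (cobd p) scl {y \<in> coch A (loc d) p. cdiff ix supp_idem A y = 0}
     (cdiff ix supp_idem A ` coch A (loc d) (p - 1))"
  proof (rule quot_iso_from_cech[where f = f])
    fix q c assume "c \<in> coch ?U (loc d) q"
    then have "c F \<in> loc d F" if "F \<subseteq> A" "int (card F) = q" for F
      using that unfolding coch_def by (metis (mono_tags, lifting) mem_Collect_eq subset_insertI2)
    moreover have "c F = 0" if "int (card F) \<noteq> q" for F
      using \<open>c \<in> _\<close> that unfolding coch_def by auto
    ultimately show "f c \<in> coch A (loc d) q" by (simp add: f_def coch_def)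
    show "f (cdiff ix supp_idem ?U c) = cdiff ix supp_idem A (f c)"
    proof
      fix F
      have "(\<Sum>v\<in>F. csign ix v F * f c (F - {v})) = (\<Sum>v\<in>F. csign ix v F * c (F - {v}))" if "F \<subseteq> A"
        using that by (intro sum.cong refl) (auto simp: f_def)
      then show "f (cdiff ix supp_idem ?U c) F = cdiff ix supp_idem A (f c) F"
        by (auto simp: f_def cdiff_def simp del: times_fun_apply)
    qed
  next
    fix q y assume y: "y \<in> coch A (loc d) q"
    have "if F \<subseteq> ?U \<and> int (card F) = q then y F \<in> loc d F else y F = 0" for F
    proof -
      have "if F \<subseteq> A \<and> int (card F) = q then y F \<in> loc d F else y F = 0"
        using y unfolding coch_def by blast
      then show ?thesis using loc_zero[of d F] by (auto split: if_splits simp del: zero_fun_apply)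
    qed
    then have "y \<in> coch ?U (loc d) q" by (simp add: coch_def)
    moreover have "f y = y" using y by (auto simp: coch_def f_def fun_eq_iff zero_fun_def)
    ultimately show "\<exists>x\<in>coch ?U (loc d) q. f x = y" by blast
  next
    fix q x assume x: "x \<in> coch ?U (loc d) q" "f x = 0" "cdiff ix supp_idem ?U x = 0"
    have xA: "x F = 0" if "F \<subseteq> A" for F using x(2) that by (metis f_def zero_fun_apply)
    have xloc: "x F \<in> loc d F" if "F \<subseteq> ?U" for F
      using x(1) that loc_zero unfolding coch_def by (metis (mono_tags, lifting) mem_Collect_eq)
    obtain K where K: "K \<ge> 1"
      "\<forall>F\<in>Pow ?U. \<exists>a\<in>D (d + int (K * card F)). x F = a * pinv (prod g F) ^ K"
      using loc_common[of "Pow ?U" x d "\<lambda>F. F"] xloc by auto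
    \<comment> \<open>K powers of \<open>g i\<close> clear the denominator of
      \<open>x (insert i F)\<close>. The extra power keeps the numerator zero at the zeros of
      \<open>g i\<close>, where the generalised inverse is 0.\<close>
    obtain M s where s: "\<And>i. i \<in> A \<Longrightarrow> s i \<in> D (int M - int (K + 1))"
      "g b ^ M = (\<Sum>i\<in>A. s i * g i ^ (K + 1))"
      using rad unfolding radical_witness_def by meson
    define r where "r i = (if i \<in> A then s i * g i ^ (K + 1) * pinv (g b) ^ M else 0)" for i
    have rsum: "(\<Sum>i\<in>?U. r i) = g b ^ M * pinv (g b) ^ M"
      using b by (simp add: r_def s(2) sum_distrib_right)
    have rid: "r i * supp_idem i = r i" for i
      by (auto simp: r_def supp_idem_def pinv_def fun_eq_iff)
    let ?k = "htpy ix ?U r x"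
    have kA: "?k F = 0" if "b \<notin> F" for F
    proof -
      have "r i * x (insert i F) = 0" if "i \<in> ?U - F" "F \<subseteq> ?U" for i
      proof (cases "i = b")
        case False
        then have "insert i F \<subseteq> A" using that \<open>b \<notin> F\<close> by auto
        then show ?thesis by (simp add: xA)
      qed (use b in \<open>simp add: r_def\<close>)
      then show ?thesis by (simp add: htpy_def)
    qed
    have kloc: "?k F \<in> loc d F" if F: "F \<subseteq> ?U" "b \<in> F" for F
    proof -
      have "r i * x (insert i F) \<in> loc d F" if i: "i \<in> A" "i \<notin> F" for i
      proof -
        have "insert i F \<in> Pow ?U" using F i by auto
        then obtain a where a: "a \<in> D (d + int (K * card (insert i F)))"
          "x (insert i F) = a * pinv (prod g (insert i F)) ^ K" using K(2) by blast
        \<comment> \<open>The factor \<open>prod g (F - {b}) ^ M\<close> turns the denominator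
          \<open>g b ^ M\<close> into a power of \<open>prod g F\<close>.\<close>
        let ?y = "s i * g i * a * prod g (F - {b}) ^ M"
        have "r i * x (insert i F) = ?y * pinv (prod g F) ^ (K + M)"
        proof
          fix w
          have F': "prod g F w = g b w * prod g (F - {b}) w" using F by (simp add: prod.remove)
          show "(r i * x (insert i F)) w = (?y * pinv (prod g F) ^ (K + M)) w"
          proof (cases "prod g F w = 0")
            case True
            then show ?thesis using K(1) i by (simp add: a(2) pinv_def power_0_left)
          next
            case False
            then have "g b w \<noteq> 0" "prod g (F - {b}) w \<noteq> 0" using F' by auto
            then show ?thesis using i
              by (cases "g i w = 0")
                 (auto simp: r_def a(2) pinv_def F' power_add field_simps)
          qed
        qed
        moreover have "?y \<in> D (d + int ((K + M) * card F))"
        proof -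
          have "int (card F) = int (card (F - {b})) + 1"
            using card_Suc_Diff1[OF _ F(2)] by fastforce
          then show ?thesis
            using Dmult'[OF Dmult'[OF Dmult'[OF s(1)[OF i(1)] Dg[of i] refl] a(1) refl]
                Dpower[OF Dprod[of "F - {b}"], of M]] i
            by (simp add: algebra_simps)
        qed
        ultimately show ?thesis unfolding loc_def using K(1)
          by (intro CollectI exI[of _ ?y] exI[of _ "K + M"]) auto
      qed
      moreover have "r b = 0" using b by (simp add: r_def)
      ultimately have "r i * x (insert i F) \<in> loc d F" if "i \<in> ?U - F" for i
        using that by (cases "i = b") (auto simp: loc_zero)
      then show ?thesis using F by (auto simp: htpy_def intro!: loc_sum Lsign)
    qed
    have "?k \<in> coch ?U (loc d) (q - 1)"
      unfolding coch_def
    proof (intro CollectI allI)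
      fix F
      have "x (insert i F) = 0" if "i \<in> ?U - F" "F \<subseteq> ?U" "int (card F) \<noteq> q - 1" for i
        using x(1) that unfolding coch_def by auto
      then have "?k F = 0" if "\<not> (F \<subseteq> ?U \<and> int (card F) = q - 1)"
        using that by (auto simp: htpy_def)
      then show "if F \<subseteq> ?U \<and> int (card F) = q - 1 then ?k F \<in> loc d F else ?k F = 0"
        using kloc kA loc_zero by (cases "b \<in> F") auto
    qed
    moreover have "f ?k = 0" using kA b by (auto simp: f_def fun_eq_iff)
    moreover have "x = cdiff ix supp_idem ?U ?k"
    proof
      fix F
      show "x F = cdiff ix supp_idem ?U ?k F"
      proof (cases "F \<subseteq> ?U")
        case F: True
        have "htpy ix ?U r (cdiff ix supp_idem ?U x) F = 0"
          unfolding x(3) by (simp add: htpy_def)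
        then have "cdiff ix supp_idem ?U ?k F = prod supp_idem F * (g b ^ M * pinv (g b) ^ M) * x F"
          using cdiff_htpy[OF finU inj F, of r supp_idem x, OF rid] by (simp add: rsum)
        also have "\<dots> = g b ^ M * pinv (g b) ^ M * x F"
          using loc_supp[OF xloc[OF F]] by (metis mult.commute mult.left_commute)
        \<comment> \<open>The idempotent of the support of \<open>g b\<close> acts as the identity
          on elements localised at b; for the other index sets x is zero.\<close>
        also have "\<dots> = x F"
        proof (cases "b \<in> F")
          case True
          then show ?thesis using loc_zero_outside[OF xloc[OF F] _ True]
            by (auto simp: fun_eq_iff pinv_def field_simps)
        next
          case False
          then have "F \<subseteq> A" using F by auto
          then show ?thesis by (simp add: xA)
        qed
        finally show ?thesis ..
      next
        case False then show ?thesis using x(1) by (auto simp: coch_def cdiff_def)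
      qed
    qed
    ultimately show "\<exists>k\<in>coch ?U (loc d) (q - 1). f k = 0 \<and> x = cdiff ix supp_idem ?U k" by blast
  qed (auto simp: f_def fun_eq_iff csc_def scl_def)
  then show ?thesis unfolding sc cocyc_def cobd_def cocycles_def coboundaries_def .
qed

lemma quot_iso_union:
  assumes "\<And>b. b \<in> B \<Longrightarrow> radical_witness A b"
  shows "quot_iso scl (cocycles d p (A \<union> B)) (coboundaries d p (A \<union> B))
     scl (cocycles d p A) (coboundaries d p A)"
proof -
  have "quot_iso scl (cocycles d p (A \<union> B')) (coboundaries d p (A \<union> B'))
     scl (cocycles d p A) (coboundaries d p A)" if "B' \<subseteq> B" for B'
    using finite[of B'] that
  proof (induction B' rule: finite_induct)
    case empty
    interpret cech_complex ix supp_idem A "loc d" \<kappa> by (rule cech)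
    show ?case
    proof (rule quot_isoI[where R = "\<lambda>x y. x = y \<and> x \<in> cocycles d p A"], goal_cases)
      case (4 x y x' y')
      then show ?case using coch_add[of x p x'] cdiff_add[of ix supp_idem A x x']
        by (auto simp: cocycles_def)
    next
      case (5 a x y)
      then show ?case using coch_scale[of x p a] cdiff_scale[of ix supp_idem A "\<kappa> a" x]
        by (auto simp: cocycles_def scl_def zero_fun_def simp del: times_fun_apply) (simp add: times_fun_def)
    qed auto
  next
    case (insert b B')
    show ?case
    proof (cases "b \<in> A \<union> B'")
      case True
      then have "A \<union> insert b B' = A \<union> B'" by auto
      then show ?thesis using insert by simp
    next
      case False
      have "radical_witness (A \<union> B') b"
        using radical_witness_mono[OF assms[of b]] insert.prems by blast
      then show ?thesis
        using quot_iso_trans[OF quot_iso_insert[OF False] insert.IH] insert.prems by simp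
    qed
  qed
  then show ?thesis by blast
qed

end

section \<open>Substitution in polynomials\<close>

definition mon :: "('n::finite \<Rightarrow> 'a::comm_ring_1) \<Rightarrow> ('n \<Rightarrow>\<^sub>0 nat) \<Rightarrow> 'a" where
  "mon f m = (\<Prod>v\<in>UNIV. f v ^ Poly_Mapping.lookup m v)"

definition poly_subst ::
  "('n::finite \<Rightarrow> ('n, 'k::field) mpoly) \<Rightarrow> ('n, 'k) mpoly \<Rightarrow> ('n, 'k) mpoly" where
  "poly_subst f p = (\<Sum>m\<in>Poly_Mapping.keys p. mconst (Poly_Mapping.lookup p m) * mon f m)"

lemma mon_0 [simp]: "mon f 0 = 1"
  by (simp add: mon_def)

lemma mon_add: "mon f (m + m') = mon f m * mon f m'"
  by (simp add: mon_def lookup_add power_add prod.distrib)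

lemma mconst_0 [simp]: "mconst 0 = 0"
  by (simp add: mconst_def)

lemma mconst_1 [simp]: "mconst 1 = 1"
  by (simp add: mconst_def)

lemma mconst_add: "mconst (a + b) = mconst a + mconst b"
  by (simp add: mconst_def single_add)

lemma mconst_minus: "mconst (- a) = - mconst a"
  by (simp add: mconst_def single_uminus)

lemma mconst_mult: "mconst (a * b) = mconst a * mconst b"
  by (simp add: mconst_def mult_single)

lemma mconst_times_single: "mconst a * Poly_Mapping.single m b = Poly_Mapping.single m (a * b)"
  by (simp add: mconst_def mult_single)

lemma sum_singles: "(\<Sum>m\<in>Poly_Mapping.keys p. Poly_Mapping.single m (Poly_Mapping.lookup p m)) = p"
proof (rule poly_mapping_eqI)
  fix k
  have "Poly_Mapping.lookup (\<Sum>m\<in>Poly_Mapping.keys p. Poly_Mapping.single m (Poly_Mapping.lookup p m)) k =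
    (\<Sum>m\<in>Poly_Mapping.keys p. if m = k then Poly_Mapping.lookup p m else 0)"
    by (simp add: lookup_sum lookup_single when_def)
  also have "\<dots> = Poly_Mapping.lookup p k" by (auto simp: in_keys_iff)
  finally show "Poly_Mapping.lookup (\<Sum>m\<in>Poly_Mapping.keys p. Poly_Mapping.single m (Poly_Mapping.lookup p m)) k
    = Poly_Mapping.lookup p k" .
qed

lemma poly_subst_superset:
  assumes "finite A" "Poly_Mapping.keys p \<subseteq> A"
  shows "poly_subst f p = (\<Sum>m\<in>A. mconst (Poly_Mapping.lookup p m) * mon f m)"
  unfolding poly_subst_def using assms by (intro sum.mono_neutral_left) (auto simp: in_keys_iff)

lemma poly_subst_add: "poly_subst f (p + q) = poly_subst f p + poly_subst f q"
proof -
  let ?A = "Poly_Mapping.keys p \<union> Poly_Mapping.keys q"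
  have "Poly_Mapping.keys (p + q) \<subseteq> ?A" by (rule keys_add)
  then show ?thesis
    by (simp add: poly_subst_superset[of ?A] lookup_add mconst_add distrib_right sum.distrib)
qed

lemma poly_subst_single: "poly_subst f (Poly_Mapping.single m c) = mconst c * mon f m"
  by (cases "c = 0") (simp_all add: poly_subst_def)

lemma poly_subst_0 [simp]: "poly_subst f 0 = 0"
  by (simp add: poly_subst_def)

lemma poly_subst_sum: "poly_subst f (sum h A) = (\<Sum>x\<in>A. poly_subst f (h x))"
  by (induction A rule: infinite_finite_induct) (auto simp: poly_subst_add)

lemma poly_subst_mult: "poly_subst f (p * q) = poly_subst f p * poly_subst f q"
proof -
  have "p * q = (\<Sum>m\<in>Poly_Mapping.keys p. \<Sum>m'\<in>Poly_Mapping.keys q.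
     Poly_Mapping.single (m + m') (Poly_Mapping.lookup p m * Poly_Mapping.lookup q m'))"
    using sum_product[of "\<lambda>m. Poly_Mapping.single m (Poly_Mapping.lookup p m)" "Poly_Mapping.keys p"
        "\<lambda>m. Poly_Mapping.single m (Poly_Mapping.lookup q m)" "Poly_Mapping.keys q"]
    by (simp add: sum_singles mult_single)
  then have "poly_subst f (p * q) = (\<Sum>m\<in>Poly_Mapping.keys p. \<Sum>m'\<in>Poly_Mapping.keys q.
     (mconst (Poly_Mapping.lookup p m) * mon f m) * (mconst (Poly_Mapping.lookup q m') * mon f m'))"
    by (simp add: poly_subst_sum poly_subst_single mon_add mconst_mult mult_ac)
  then show ?thesis by (simp add: poly_subst_def sum_product)
qed

lemma poly_subst_1 [simp]: "poly_subst f 1 = 1"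
  using poly_subst_single[of f 0 1] by (simp del: mconst_1) simp

lemma poly_subst_mconst [simp]: "poly_subst f (mconst c) = mconst c"
  using poly_subst_single[of f 0 c] by (simp flip: mconst_def)

lemma poly_subst_minus: "poly_subst f (p - q) = poly_subst f p - poly_subst f q"
  using poly_subst_add[of f "p - q" q] by (simp add: algebra_simps)

lemma poly_subst_power: "poly_subst f (p ^ n) = poly_subst f p ^ n"
  by (induction n) (auto simp: poly_subst_mult)

lemma poly_subst_prod: "poly_subst f (prod h A) = (\<Prod>x\<in>A. poly_subst f (h x))"
  by (induction A rule: infinite_finite_induct) (auto simp: poly_subst_mult)

lemma poly_subst_mon: "poly_subst f (mon h m) = mon (\<lambda>v. poly_subst f (h v)) m"
  by (simp add: mon_def poly_subst_prod poly_subst_power)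

lemma poly_subst_mvar [simp]: "poly_subst f (mvar v) = f v"
proof -
  have "mon f (Poly_Mapping.single v 1) = (\<Prod>u\<in>UNIV. if u = v then f u else 1)"
    unfolding mon_def by (intro prod.cong) (auto simp: lookup_single when_def)
  then show ?thesis by (simp add: mvar_def poly_subst_single)
qed

lemma poly_subst_subst: "poly_subst h (poly_subst f p) = poly_subst (\<lambda>v. poly_subst h (f v)) p"
  by (simp add: poly_subst_def[of f p] poly_subst_sum poly_subst_mult poly_subst_mon)
     (simp add: poly_subst_def)

lemma mon_mvar: "mon mvar m = Poly_Mapping.single m (1::'k::field)"
proof -
  have pw: "mvar v ^ n = Poly_Mapping.single (Poly_Mapping.single v n) (1::'k)" for v :: 'a and n
    by (induction n) (auto simp: mvar_def mult_single simp flip: single_add)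
  have "(\<Prod>v\<in>A. Poly_Mapping.single (h v) (1::'k)) = Poly_Mapping.single (\<Sum>v\<in>A. h v) 1"
    if "finite A" for A and h :: "'a \<Rightarrow> 'a \<Rightarrow>\<^sub>0 nat"
    using that by (induction A rule: finite_induct) (auto simp: mult_single)
  moreover have "(\<Sum>v\<in>UNIV. Poly_Mapping.single v (Poly_Mapping.lookup m v)) = m"
    by (rule poly_mapping_eqI) (simp add: lookup_sum lookup_single when_def)
  ultimately show ?thesis by (simp add: mon_def pw)
qed

lemma poly_subst_id: "poly_subst mvar p = p"
  by (simp add: poly_subst_def mon_mvar mconst_times_single sum_singles)

section \<open>The graded ring of logarithmic derivations\<close>

lemma partial_deriv_superset:
  assumes "finite A" "Poly_Mapping.keys p \<subseteq> A"
  shows "partial_deriv v p = (\<Sum>m\<in>A. Poly_Mapping.single (m - Poly_Mapping.single v 1)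
       (of_nat (Poly_Mapping.lookup m v) * Poly_Mapping.lookup p m))"
  unfolding partial_deriv_def using assms by (intro sum.mono_neutral_left) (auto simp: in_keys_iff)

lemma partial_deriv_diff: "partial_deriv v (p - q) = partial_deriv v p - partial_deriv v q"
proof -
  let ?A = "Poly_Mapping.keys p \<union> Poly_Mapping.keys q"
  have "Poly_Mapping.keys (p - q) \<subseteq> ?A" by (auto simp: in_keys_iff lookup_minus)
  then show ?thesis
    by (simp add: partial_deriv_superset[of ?A] lookup_minus right_diff_distrib single_diff sum_subtractf)
qed

lemma partial_deriv_mvar: "partial_deriv v (mvar u) = (if u = v then 1 else 0)"
  by (simp add: partial_deriv_def mvar_def lookup_single when_def)

lemma der_apply_edge: "der_apply \<theta> (mvar u - mvar v) = \<theta> u - \<theta> v"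
  by (simp add: der_apply_def partial_deriv_diff partial_deriv_mvar right_diff_distrib sum_subtractf
      if_distrib[of "\<lambda>t. _ * t"] cong: if_cong)

text \<open>In this form the logarithmic derivations are the splines on the graph, and closure under
  componentwise multiplication becomes visible.\<close>

lemma log_der_iff:
  "\<theta> \<in> log_der E \<longleftrightarrow> (\<forall>u v. {u, v} \<in> E \<longrightarrow> (mvar u - mvar v) dvd (\<theta> u - \<theta> v))"
  by (simp add: log_der_def der_apply_edge)

lemma homogeneous_0 [simp]: "homogeneous q 0"
  by (simp add: homogeneous_def)

lemma homogeneous_add: "homogeneous q a \<Longrightarrow> homogeneous q b \<Longrightarrow> homogeneous q (a + b)"
  using keys_add[of a b] by (auto simp: homogeneous_def)

lemma homogeneous_uminus: "homogeneous q a \<Longrightarrow> homogeneous q (- a)"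
  by (auto simp: homogeneous_def in_keys_iff)

lemma homogeneous_diff: "homogeneous q a \<Longrightarrow> homogeneous q b \<Longrightarrow> homogeneous q (a - b)"
  using homogeneous_add[OF _ homogeneous_uminus, of q a b] by simp

lemma homogeneous_mult: "homogeneous q a \<Longrightarrow> homogeneous r b \<Longrightarrow> homogeneous (q + r) (a * b)"
  using keys_mult[of a b] by (force simp: homogeneous_def lookup_add sum.distrib)

lemma homogeneous_mconst: "homogeneous 0 (mconst a)"
  by (cases "a = 0") (auto simp: homogeneous_def mconst_def)

lemma homogeneous_1: "homogeneous 0 1"
  using homogeneous_mconst[of 1] by simp

lemma homogeneous_mvar: "homogeneous 1 (mvar v)"
  by (simp add: homogeneous_def mvar_def lookup_single when_def)

lemma homogeneous_sum: "(\<And>x. x \<in> A \<Longrightarrow> homogeneous q (f x)) \<Longrightarrow> homogeneous q (sum f A)"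
  by (induction A rule: infinite_finite_induct) (auto intro: homogeneous_add)

lemma homogeneous_power: "homogeneous q a \<Longrightarrow> homogeneous (int n * q) (a ^ n)"
proof (induction n)
  case (Suc n)
  then show ?case using homogeneous_mult[of q a "int n * q" "a ^ n"] by (simp add: algebra_simps)
qed (simp add: homogeneous_1)

lemma homogeneous_prod:
  "(\<And>x. x \<in> A \<Longrightarrow> homogeneous (h x) (f x)) \<Longrightarrow> homogeneous (sum h A) (prod f A)"
  by (induction A rule: infinite_finite_induct) (auto intro: homogeneous_mult homogeneous_1)

text \<open>\<open>Zv\<close> will be the Euler derivation, \<open>Xv v\<close> the multiple by x_v
  of the derivation with all components 1, and \<open>Yv v\<close> their difference.\<close>

datatype 'n idx = Xv 'n | Yv 'n | Zv

lemma UNIV_idx: "UNIV = range Xv \<union> insert Zv (range Yv)"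
proof -
  have "i \<in> range Xv \<union> insert Zv (range Yv)" for i :: "'a idx" by (cases i) auto
  then show ?thesis by blast
qed

instance idx :: (finite) finite
  by standard (simp add: UNIV_idx)

definition gpoly :: "'n idx \<Rightarrow> 'n \<Rightarrow> ('n, 'k::field) mpoly" where
  "gpoly i w = (case i of Xv v \<Rightarrow> mvar v | Yv v \<Rightarrow> mvar w - mvar v | Zv \<Rightarrow> mvar w)"

definition gen :: "'n idx \<Rightarrow> 'n::{finite,linorder} \<Rightarrow> ('n, 'k::field) mpoly fract" where
  "gen i w = to_fract (gpoly i w)"

definition vpos :: "'n::{finite,linorder} \<Rightarrow> nat" where
  "vpos v = card {u. u < v}"

text \<open>On the \<open>Xv\<close> this order is that of the vertices, so the signs are those of
  the Cech complex in the statement. \<open>Zv\<close> comes last, so it never contributes to the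
  sign of some \<open>Yv v\<close>.\<close>

definition gix :: "'n::{finite,linorder} idx \<Rightarrow> nat" where
  "gix i = (case i of Xv v \<Rightarrow> vpos v | Yv v \<Rightarrow> card (UNIV :: 'n set) + vpos v | Zv \<Rightarrow> 2 * card (UNIV :: 'n set))"

definition log_ring :: "'n::{finite,linorder} set set \<Rightarrow> int \<Rightarrow> ('n \<Rightarrow> ('n, 'k::field) mpoly fract) set" where
  "log_ring E q = {(\<lambda>v. to_fract (\<theta> v)) | \<theta>. \<theta> \<in> log_der E \<and> der_homogeneous q \<theta>}"

definition const_fun :: "'k::field \<Rightarrow> 'n \<Rightarrow> ('n::{finite,linorder}, 'k) mpoly fract" where
  "const_fun a = (\<lambda>w. to_fract (mconst a))"

lemma vpos_less_iff: "vpos u < vpos v \<longleftrightarrow> u < (v::'n::{finite,linorder})"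
proof -
  have "vpos u < vpos v" if "u < v" for u v :: 'n
    unfolding vpos_def using that by (intro psubset_card_mono) auto
  then show ?thesis by (metis less_asym' linorder_neqE)
qed

lemma vpos_less: "vpos (v::'n::{finite,linorder}) < card (UNIV :: 'n set)"
  unfolding vpos_def by (intro psubset_card_mono) auto

lemma inj_gix: "inj gix"
proof (rule injI)
  fix i j :: "'n::{finite,linorder} idx"
  have "vpos u = vpos v \<longleftrightarrow> u = v" for u v :: 'n
    by (metis less_irrefl linorder_neqE vpos_less_iff)
  moreover assume "gix i = gix j"
  ultimately show "i = j"
    using vpos_less[where ?'n = 'n] by (auto simp: gix_def split: idx.splits)
       (metis add_less_cancel_left le_add1 less_le_not_le mult_2 nat_less_le trans_less_add1 not_add_less1)+
qed

lemma log_derI_const: "(\<lambda>_. p) \<in> log_der E"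
  by (simp add: log_der_iff)

lemma log_der_mult:
  assumes "\<theta> \<in> log_der E" "\<phi> \<in> log_der E"
  shows "(\<lambda>v. \<theta> v * \<phi> v) \<in> log_der E"
  unfolding log_der_iff
proof (intro allI impI)
  fix u v assume "{u, v} \<in> E"
  then have "mvar u - mvar v dvd \<theta> u - \<theta> v" "mvar u - mvar v dvd \<phi> u - \<phi> v"
    using assms by (auto simp: log_der_iff)
  moreover have "\<theta> u * \<phi> u - \<theta> v * \<phi> v = \<theta> u * (\<phi> u - \<phi> v) + (\<theta> u - \<theta> v) * \<phi> v"
    by (simp add: algebra_simps)
  ultimately show "mvar u - mvar v dvd \<theta> u * \<phi> u - \<theta> v * \<phi> v" by (simp add: dvd_add)
qed

lemma log_der_add:
  assumes "\<theta> \<in> log_der E" "\<phi> \<in> log_der E"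
  shows "(\<lambda>v. \<theta> v + \<phi> v) \<in> log_der E"
  unfolding log_der_iff using assms
  by (auto simp: log_der_iff add_diff_add intro!: dvd_add)

lemma gpoly_log_der: "gpoly i \<in> log_der E"
  by (cases i) (auto simp: log_der_iff gpoly_def)

lemma homogeneous_gpoly: "homogeneous 1 (gpoly i w)"
  by (cases i) (auto simp: gpoly_def intro: homogeneous_mvar homogeneous_diff)

lemma graded_function_ring_log_ring:
  "graded_function_ring (log_ring E :: int \<Rightarrow> ('n::{finite,linorder} \<Rightarrow> ('n, 'k::field) mpoly fract) set)
    gen gix const_fun"
proof -
  let ?R = "log_ring E :: int \<Rightarrow> ('n \<Rightarrow> ('n, 'k) mpoly fract) set"
  show ?thesis
  proof
  show "0 \<in> ?R q" for q
    unfolding log_ring_def using log_derI_const[of 0]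
    by (intro CollectI exI[of _ "\<lambda>_. 0"]) (auto simp: der_homogeneous_def fun_eq_iff)
  show "x + y \<in> ?R q" if xy: "x \<in> ?R q" "y \<in> ?R q" for x y q
  proof -
    obtain \<theta> \<phi> where *: "\<theta> \<in> log_der E" "\<phi> \<in> log_der E" "der_homogeneous q \<theta>" "der_homogeneous q \<phi>"
      "x = (\<lambda>v. to_fract (\<theta> v))" "y = (\<lambda>v. to_fract (\<phi> v))"
      using xy by (auto simp: log_ring_def)
    show ?thesis unfolding log_ring_def using * log_der_add[OF *(1,2)]
      by (intro CollectI exI[of _ "\<lambda>v. \<theta> v + \<phi> v"])
         (auto simp: der_homogeneous_def fun_eq_iff intro: homogeneous_add)
  qed
  show mult: "x * y \<in> ?R (q + r)" if xy: "x \<in> ?R q" "y \<in> ?R r" for x y q r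
  proof -
    obtain \<theta> \<phi> where *: "\<theta> \<in> log_der E" "\<phi> \<in> log_der E" "der_homogeneous q \<theta>" "der_homogeneous r \<phi>"
      "x = (\<lambda>v. to_fract (\<theta> v))" "y = (\<lambda>v. to_fract (\<phi> v))"
      using xy by (auto simp: log_ring_def)
    show ?thesis unfolding log_ring_def using * log_der_mult[OF *(1,2)]
      by (intro CollectI exI[of _ "\<lambda>v. \<theta> v * \<phi> v"])
         (auto simp: der_homogeneous_def fun_eq_iff intro: homogeneous_mult)
  qed
  show const: "const_fun a \<in> ?R 0" for a
    unfolding log_ring_def using log_derI_const[of "mconst a"]
    by (intro CollectI exI[of _ "\<lambda>_. mconst a"])
       (auto simp: der_homogeneous_def const_fun_def homogeneous_mconst)
  have "const_fun 1 = (1 :: 'n \<Rightarrow> ('n, 'k) mpoly fract)" by (simp add: const_fun_def fun_eq_iff)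
  then show "1 \<in> ?R 0" using const[of 1] by simp
  show "- x \<in> ?R q" if "x \<in> ?R q" for x q
  proof -
    have "const_fun (-1) * x = - x" by (simp add: const_fun_def fun_eq_iff mconst_minus)
    then show ?thesis using mult[OF const that, of "-1"] by simp
  qed
  show "gen i \<in> ?R 1" for i
    unfolding log_ring_def using gpoly_log_der[of i E] homogeneous_gpoly[of i]
    by (intro CollectI exI[of _ "gpoly i"]) (auto simp: der_homogeneous_def gen_def)
  show "inj gix" by (rule inj_gix)
qed
qed

section \<open>Equality of the radicals of the two families of generators\<close>

text \<open>Induction on m + n: splitting off one factor a - b lowers m in one summand and n in the
  other. In this way the degrees of s and t are controlled along with their existence.\<close>

lemma binomial_ideal:
  assumes "graded_function_ring D g ix \<kappa>" "a \<in> D 1" "b \<in> D 1"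
  shows "\<exists>s\<in>D (int n). \<exists>t\<in>D (int m). (a - b) ^ (m + n) = s * a ^ m + t * b ^ n"
proof -
  interpret graded_function_ring D g ix \<kappa> by fact
  have sub: "x - y \<in> D q" if "x \<in> D q" "y \<in> D q" for x y q
    using Dadd[OF that(1) Dneg[OF that(2)]] by simp
  show ?thesis
  proof (induction "m + n" arbitrary: m n)
    case 0
    show ?case
      by (rule bexI[of _ 1], rule bexI[of _ 0]) (use 0 D0 D1 in auto)
  next
    case (Suc k)
    consider "m = 0" | "n = 0" | m' n' where "m = Suc m'" "n = Suc n'" by (cases m; cases n) auto
    then show ?case
    proof cases
      case 1
      then show ?thesis using Dpower[OF sub[OF assms(2,3)], of n] D0[of m]
        by (intro bexI[of _ "(a - b) ^ n"] bexI[of _ 0]) auto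
    next
      case 2
      then show ?thesis using Dpower[OF sub[OF assms(2,3)], of m] D0[of n]
        by (intro bexI[of _ 0] bexI[of _ "(a - b) ^ m"]) auto
    next
      case 3
      obtain s t where st: "s \<in> D (int n)" "t \<in> D (int m')" "(a - b) ^ (m' + n) = s * a ^ m' + t * b ^ n"
        using Suc.hyps(1)[of m' n] Suc.hyps(2) 3 by auto
      obtain s' t' where st': "s' \<in> D (int n')" "t' \<in> D (int m)" "(a - b) ^ (m + n') = s' * a ^ m + t' * b ^ n'"
        using Suc.hyps(1)[of m n'] Suc.hyps(2) 3 by auto
      have "(a - b) ^ (m + n) = a * (a - b) ^ (m' + n) - b * (a - b) ^ (m + n')"
        using 3 by (simp add: left_diff_distrib)
      also have "\<dots> = (s - b * s') * a ^ m + (a * t - t') * b ^ n"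
        unfolding st(3) st'(3) using 3 by (simp add: algebra_simps)
      finally show ?thesis
        using sub[OF st(1) Dmult'[OF assms(3) st'(1)]] sub[OF Dmult'[OF assms(2) st(2)] st'(2)] 3
        by (intro bexI[of _ "s - b * s'"] bexI[of _ "a * t - t'"]) auto
    qed
  qed
qed

text \<open>Serves both directions of the exchange, since y = z - x and x = z - y.\<close>

lemma radical_witness_diff:
  assumes ring: "graded_function_ring D g ix \<kappa>" and "g c = g a - g b" "a \<noteq> b"
  shows "graded_function_ring.radical_witness D g {a, b} c"
proof -
  interpret graded_function_ring D g ix \<kappa> by fact
  show ?thesis unfolding radical_witness_def
  proof
    fix N
    obtain s t where "s \<in> D (int N)" "t \<in> D (int N)" "g c ^ (N + N) = s * g a ^ N + t * g b ^ N"
      using binomial_ideal[OF ring Dg Dg, of N N a b] assms(2) by auto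
    then show "\<exists>M u. (\<forall>i\<in>{a, b}. u i \<in> D (int M - int N)) \<and> g c ^ M = (\<Sum>i\<in>{a, b}. u i * g i ^ N)"
      using assms(3) by (intro exI[of _ "N + N"] exI[of _ "\<lambda>i. if i = a then s else t"]) auto
  qed
qed

context
  fixes E :: "'n::{finite,linorder} set set" and ty :: "'k::field itself"
begin

interpretation log: graded_function_ring "log_ring E :: int \<Rightarrow> ('n \<Rightarrow> ('n, 'k) mpoly fract) set"
    gen gix const_fun
  by (rule graded_function_ring_log_ring)

lemma log_radical_XZ_Y: "log.radical_witness (range Xv \<union> {Zv}) (Yv v)"
  by (rule log.radical_witness_mono[OF radical_witness_diff[OF log.graded_function_ring_axioms, of _ Zv "Xv v"]])
     (auto simp: gen_def gpoly_def fun_eq_iff)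

lemma log_radical_YZ_X: "log.radical_witness (insert Zv (range Yv)) (Xv v)"
  by (rule log.radical_witness_mono[OF radical_witness_diff[OF log.graded_function_ring_axioms, of _ Zv "Yv v"]])
     (auto simp: gen_def gpoly_def fun_eq_iff)

text \<open>On the component \<open>w\<close> the element \<open>Zv\<close> takes the value \<open>x\<^sub>w\<close>, hence
  \<open>\<Prod>\<^sub>v (z\<^sup>N - x\<^sub>v\<^sup>N) = 0\<close>.\<close>

lemma log_radical_X_Z: "log.radical_witness (range Xv) Zv"
  unfolding log.radical_witness_def
proof
  fix N
  let ?D = "log_ring E :: int \<Rightarrow> ('n \<Rightarrow> ('n, 'k) mpoly fract) set"
  let ?g = "gen :: 'n idx \<Rightarrow> 'n \<Rightarrow> ('n, 'k) mpoly fract"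
  have "\<exists>s. (\<forall>v\<in>V. s v \<in> ?D (int (N * card V) - int N)) \<and>
     (\<Prod>v\<in>V. ?g Zv ^ N - ?g (Xv v) ^ N) = ?g Zv ^ (N * card V) - (\<Sum>v\<in>V. s v * ?g (Xv v) ^ N)" for V
    using finite[of V]
  proof (induction V rule: finite_induct)
    case (insert x V)
    then obtain s where s: "\<forall>v\<in>V. s v \<in> ?D (int (N * card V) - int N)"
      "(\<Prod>v\<in>V. ?g Zv ^ N - ?g (Xv v) ^ N) = ?g Zv ^ (N * card V) - (\<Sum>v\<in>V. s v * ?g (Xv v) ^ N)"
      by blast
    \<comment> \<open>When the new factor is multiplied out, its part \<open>z^N\<close> goes into
      the old coefficients, while its part \<open>x^N\<close> receives the whole old product as
      coefficient.\<close>
    define s' where "s' v = (if v = x then (\<Prod>v\<in>V. ?g Zv ^ N - ?g (Xv v) ^ N) else ?g Zv ^ N * s v)" for v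
    have gp: "?g i ^ N \<in> ?D (int N)" for i using log.Dpower[OF log.Dg, of i N] by simp
    have dif: "?g Zv ^ N - ?g (Xv v) ^ N \<in> ?D (int N)" for v
      using log.Dadd[OF gp[of Zv] log.Dneg[OF gp[of "Xv v"]]] by simp
    have pr: "(\<Prod>v\<in>W. ?g Zv ^ N - ?g (Xv v) ^ N) \<in> ?D (int (N * card W))" for W
      using finite[of W]
    proof (induction W rule: finite_induct)
      case empty then show ?case using log.D1 by (simp del: one_fun_apply)
    next
      case (insert x W)
      have "int N + int (N * card W) = int (N * card (insert x W))"
        using insert.hyps by simp
      from log.Dmult'[OF dif[of x] insert.IH this] show ?case
        by (simp only: prod.insert[OF insert.hyps])
    qed
    have "(\<Sum>v\<in>V. s' v * ?g (Xv v) ^ N) = ?g Zv ^ N * (\<Sum>v\<in>V. s v * ?g (Xv v) ^ N)"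
      unfolding sum_distrib_left using insert.hyps by (intro sum.cong) (auto simp: s'_def mult.assoc)
    moreover have "(?g Zv ^ N - ?g (Xv x) ^ N) * (\<Prod>v\<in>V. ?g Zv ^ N - ?g (Xv v) ^ N) =
      ?g Zv ^ N * (?g Zv ^ (N * card V) - (\<Sum>v\<in>V. s v * ?g (Xv v) ^ N)) - s' x * ?g (Xv x) ^ N"
      unfolding left_diff_distrib s(2)[symmetric] by (simp add: s'_def mult.commute)
    ultimately have "(\<Prod>v\<in>insert x V. ?g Zv ^ N - ?g (Xv v) ^ N) =
      ?g Zv ^ (N * card (insert x V)) - (\<Sum>v\<in>insert x V. s' v * ?g (Xv v) ^ N)"
      using insert.hyps by (simp add: power_add right_diff_distrib)
    moreover have "s' v \<in> ?D (int (N * card (insert x V)) - int N)" if "v \<in> insert x V" for v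
    proof (cases "v = x")
      case True
      then show ?thesis using pr[of V] insert.hyps by (simp add: s'_def)
    next
      case False
      then show ?thesis using that log.Dmult'[OF gp[of Zv] s(1)[rule_format, of v]] insert.hyps by (simp add: s'_def)
    qed
    ultimately show ?case by blast
  qed simp
  then obtain s where s: "\<And>v. s v \<in> ?D (int (N * card (UNIV :: 'n set)) - int N)"
     "(\<Prod>v\<in>UNIV. ?g Zv ^ N - ?g (Xv v) ^ N) = ?g Zv ^ (N * card (UNIV :: 'n set)) - (\<Sum>v\<in>UNIV. s v * ?g (Xv v) ^ N)"
    by blast
  have "(\<Prod>v\<in>UNIV. ?g Zv ^ N - ?g (Xv v) ^ N) = 0"
  proof
    fix w
    show "(\<Prod>v\<in>UNIV. ?g Zv ^ N - ?g (Xv v) ^ N) w = 0 w"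
      by (simp add: prod_fun_apply) (rule exI[of _ w], simp add: gen_def gpoly_def)
  qed
  then have "?g Zv ^ (N * card (UNIV :: 'n set)) = (\<Sum>v\<in>UNIV. s v * ?g (Xv v) ^ N)"
    using s(2) by simp
  then show "\<exists>M u. (\<forall>i\<in>range Xv. u i \<in> ?D (int M - int N)) \<and> ?g Zv ^ M = (\<Sum>i\<in>range Xv. u i * ?g i ^ N)"
    using s(1) by (intro exI[of _ "N * card (UNIV :: 'n set)"] exI[of _ "\<lambda>i. case i of Xv v \<Rightarrow> s v | _ \<Rightarrow> 0"])
      (auto simp: sum.reindex inj_on_def)
qed

text \<open>Both families are compared with the set of all generators. On the side of the x_v, z is
  added before the y_v because the witness for y_v involves z.\<close>

lemma quot_iso_X_YZ:
  "quot_iso log.scl (log.cocycles d p (range Xv)) (log.coboundaries d p (range Xv))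
     log.scl (log.cocycles d p (insert Zv (range Yv))) (log.coboundaries d p (insert Zv (range Yv)))"
proof -
  let ?I = "\<lambda>A B. quot_iso log.scl (log.cocycles d p A) (log.coboundaries d p A)
     log.scl (log.cocycles d p B) (log.coboundaries d p B)"
  have 1: "?I (range Xv \<union> {Zv}) (range Xv)"
    by (rule log.quot_iso_union) (simp add: log_radical_X_Z)
  have 2: "?I (range Xv \<union> {Zv} \<union> range Yv) (range Xv \<union> {Zv})"
    by (rule log.quot_iso_union) (use log_radical_XZ_Y in blast)
  have 3: "?I (insert Zv (range Yv) \<union> range Xv) (insert Zv (range Yv))"
    by (rule log.quot_iso_union) (use log_radical_YZ_X in blast)
  have eq: "insert Zv (range Yv) \<union> range Xv = range Xv \<union> {Zv} \<union> range Yv" by auto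
  show ?thesis
    by (rule quot_iso_trans[OF quot_iso_sym[OF 1] quot_iso_trans[OF quot_iso_sym[OF 2] 3[unfolded eq]]])
qed

end

section \<open>Comparison with the Cech complex of the statement\<close>

lemma to_fract_power [simp]: "to_fract (p ^ n) = to_fract p ^ n"
  by (induction n) auto

lemma to_fract_prod: "to_fract (prod f A) = (\<Prod>x\<in>A. to_fract (f x))"
  by (induction A rule: infinite_finite_induct) auto

lemma to_fract_sum: "to_fract (sum f A) = (\<Sum>x\<in>A. to_fract (f x))"
  by (induction A rule: infinite_finite_induct) auto

lemma mvar_nonzero [simp]: "mvar v \<noteq> 0"
  by (metis homogeneous_0 lookup_single_eq lookup_zero mvar_def zero_neq_one)

lemma csign_Xv: "csign gix (Xv v) (Xv ` F) = (- 1) ^ card {u \<in> F. u < v}"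
proof -
  have "{u \<in> Xv ` F. gix u < gix (Xv v)} = Xv ` {u \<in> F. u < v}"
    by (auto simp: gix_def vpos_less_iff)
  then show ?thesis by (simp add: csign_def card_image inj_on_def)
qed

lemma vector_space_cech_scale: "vector_space cech_scale"
proof
  show "cech_scale a (x + y) = cech_scale a x + cech_scale a y" for a :: 'a and x y :: "'b set \<Rightarrow> _"
    by (simp add: cech_scale_def fun_eq_iff algebra_simps)
  show "cech_scale (a + b) x = cech_scale a x + cech_scale b x" for a b :: 'a and x :: "'b set \<Rightarrow> _"
    by (simp add: cech_scale_def fun_eq_iff mconst_add distrib_right flip: to_fract_def)
  show "cech_scale a (cech_scale b x) = cech_scale (a * b) x" for a b :: 'a and x :: "'b set \<Rightarrow> _"
    by (simp add: cech_scale_def fun_eq_iff mconst_mult mult.assoc flip: to_fract_def)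
  show "cech_scale 1 x = x" for x :: "'b set \<Rightarrow> _"
    by (simp add: cech_scale_def fun_eq_iff flip: to_fract_def)
qed

context
  fixes E :: "'n::{finite,linorder} set set" and ty :: "'k::field itself"
begin

interpretation log: graded_function_ring "log_ring E :: int \<Rightarrow> ('n \<Rightarrow> ('n, 'k) mpoly fract) set"
    gen gix const_fun
  by (rule graded_function_ring_log_ring)

lemma loc_part_eq_loc: "loc_part (log_der E) F d = (log.loc d (Xv ` F) :: ('n \<Rightarrow> ('n, 'k) mpoly fract) set)"
proof -
  let ?x = "(\<Prod>u\<in>F. mvar u) :: ('n, 'k) mpoly"
  have g: "prod gen (Xv ` F) w = to_fract ?x" for w
    by (simp add: prod.reindex inj_on_def prod_fun_apply gen_def gpoly_def to_fract_prod)
  have x0: "?x \<noteq> 0" by simp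
  have card: "card (Xv ` F) = card F" by (simp add: card_image inj_on_def)
  have fr: "(\<lambda>v. to_fract (\<theta> v)) * pinv (prod gen (Xv ` F)) ^ k = (\<lambda>v. Fraction_Field.Fract (\<theta> v) (?x ^ k))"
    for \<theta> :: "'n \<Rightarrow> ('n, 'k) mpoly" and k
    by (simp add: fun_eq_iff pinv_def g Fract_conv_to_fract power_inverse divide_inverse)
  show ?thesis
  proof (intro set_eqI iffI)
    fix c :: "'n \<Rightarrow> ('n, 'k) mpoly fract" assume "c \<in> loc_part (log_der E) F d"
    then obtain \<theta> k where c: "c = (\<lambda>v. Fraction_Field.Fract (\<theta> v) (?x ^ k))"
      "\<theta> \<in> log_der E" "der_homogeneous (d + int (k * card F)) \<theta>"
      unfolding loc_part_def by blast
    \<comment> \<open>The statement allows denominators with exponent 0; expanding once more by the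
      product of the variables yields the positive exponent that \<open>log.loc\<close>
      requires.\<close>
    define \<phi> where "\<phi> = (\<lambda>v. \<theta> v * ?x)"
    have "c = (\<lambda>v. to_fract (\<phi> v)) * pinv (prod gen (Xv ` F)) ^ Suc k"
      unfolding fr using x0 by (simp add: c(1) \<phi>_def fun_eq_iff eq_fract)
    moreover have "\<phi> \<in> log_der E" using log_der_mult[OF c(2) log_derI_const[of ?x]] by (simp add: \<phi>_def)
    moreover have "der_homogeneous (d + int (Suc k * card F)) \<phi>"
    proof -
      have "homogeneous (int (card F)) ?x"
        using homogeneous_prod[of F "\<lambda>_. 1" "mvar :: 'n \<Rightarrow> ('n, 'k) mpoly"] by (simp add: homogeneous_mvar)
      then show ?thesis using c(3) homogeneous_mult[of "d + int (k * card F)" _ "int (card F)" ?x]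
        by (simp add: \<phi>_def der_homogeneous_def algebra_simps)
    qed
    moreover have "1 \<le> Suc k" by simp
    ultimately show "c \<in> log.loc d (Xv ` F)"
      unfolding log.loc_def log_ring_def card by blast
  next
    fix c :: "'n \<Rightarrow> ('n, 'k) mpoly fract" assume "c \<in> log.loc d (Xv ` F)"
    then obtain \<theta> k where "c = (\<lambda>v. to_fract (\<theta> v)) * pinv (prod gen (Xv ` F)) ^ k"
      "\<theta> \<in> log_der E" "der_homogeneous (d + int (k * card F)) \<theta>"
      unfolding log.loc_def log_ring_def card by blast
    then show "c \<in> loc_part (log_der E) F d" unfolding loc_part_def fr by blast
  qed
qed

lemma cech_cochains_iff: "c \<in> cech_cochains (log_der E :: ('n \<Rightarrow> ('n, 'k) mpoly) set) p d \<longleftrightarrow>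
    (\<forall>F. if int (card F) = p then c F \<in> log.loc d (Xv ` F) else c F = 0)"
  by (simp add: cech_cochains_def loc_part_eq_loc)

lemma cech_diff_linear:
  "cech_diff (x + y) = cech_diff x + (cech_diff y :: 'n set \<Rightarrow> 'n \<Rightarrow> ('n, 'k) mpoly fract)"
  "cech_diff (cech_scale a x) = (cech_scale a (cech_diff x) :: 'n set \<Rightarrow> 'n \<Rightarrow> ('n, 'k) mpoly fract)"
  by (auto simp: cech_diff_def cech_scale_def fun_eq_iff distrib_left sum.distrib sum_distrib_left
      mult.left_commute)

lemma subspace_cech_cochains: "module.subspace cech_scale (cech_cochains (log_der E :: ('n \<Rightarrow> ('n, 'k) mpoly) set) p d)"
proof -
  interpret vector_space "cech_scale :: 'k \<Rightarrow> ('n set \<Rightarrow> 'n \<Rightarrow> ('n, 'k) mpoly fract) \<Rightarrow> _"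
    by (rule vector_space_cech_scale)
  show ?thesis
  proof (rule subspaceI)
    fix a :: 'k and x assume x: "x \<in> cech_cochains (log_der E :: ('n \<Rightarrow> ('n, 'k) mpoly) set) p d"
    have "cech_scale a x F = const_fun a * x F" for F
      by (simp add: cech_scale_def const_fun_def fun_eq_iff to_fract_def)
    then show "cech_scale a x \<in> cech_cochains (log_der E) p d"
      using x log.loc_mult_D[OF _ log.D\<kappa>] by (simp add: cech_cochains_iff)
  qed (auto simp: cech_cochains_iff log.loc_zero log.loc_add)
qed

lemma subspace_cech_cocycles: "module.subspace cech_scale (cech_cocycles (log_der E :: ('n \<Rightarrow> ('n, 'k) mpoly) set) p d)"
proof -
  interpret vector_space "cech_scale :: 'k \<Rightarrow> ('n set \<Rightarrow> 'n \<Rightarrow> ('n, 'k) mpoly fract) \<Rightarrow> _"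
    by (rule vector_space_cech_scale)
  note C = subspace_cech_cochains[of p d]
  show ?thesis unfolding cech_cocycles_def
    by (rule subspaceI)
       (auto simp: cech_diff_linear subspace_0[OF C] subspace_add[OF C] subspace_scale[OF C]
         intro: subspace_0[OF C] simp del: plus_fun_apply zero_fun_apply,
        auto simp: cech_diff_def fun_eq_iff cech_scale_def)
qed

lemma subspace_cech_coboundaries: "module.subspace cech_scale (cech_coboundaries (log_der E :: ('n \<Rightarrow> ('n, 'k) mpoly) set) p d)"
proof -
  interpret vector_space "cech_scale :: 'k \<Rightarrow> ('n set \<Rightarrow> 'n \<Rightarrow> ('n, 'k) mpoly fract) \<Rightarrow> _"
    by (rule vector_space_cech_scale)
  note C = subspace_cech_cochains[of "p - 1" d]
  have "cech_diff 0 = (0 :: 'n set \<Rightarrow> 'n \<Rightarrow> ('n, 'k) mpoly fract)"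
    by (auto simp: cech_diff_def fun_eq_iff)
  then show ?thesis unfolding cech_coboundaries_def
    by (intro subspaceI)
       (auto simp flip: cech_diff_linear simp del: plus_fun_apply
         intro: subspace_0[OF C] subspace_add[OF C] subspace_scale[OF C] image_eqI[of _ _ 0])
qed

text \<open>The generators \<open>Xv v\<close> vanish nowhere, so all idempotents are 1 and the two
  complexes differ only in the naming of the index sets.\<close>

lemma quot_iso_cech_X:
  "quot_iso cech_scale (cech_cocycles (log_der E :: ('n \<Rightarrow> ('n, 'k) mpoly) set) p d)
      (cech_coboundaries (log_der E) p d)
     log.scl (log.cocycles d p (range Xv)) (log.coboundaries d p (range Xv))"
proof -
  let ?U = "range Xv :: 'n idx set"
  interpret cech_complex gix log.supp_idem ?U "log.loc d" const_fun by (rule log.cech)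
  define f where "f c = (\<lambda>F. c (Xv ` F))" for c :: "'n idx set \<Rightarrow> 'n \<Rightarrow> ('n, 'k) mpoly fract"
  have card: "card (Xv ` F) = card F" for F :: "'n set" by (simp add: card_image inj_on_def)
  have e: "prod log.supp_idem (Xv ` F) = 1" for F
  proof
    fix w
    have "prod gen (Xv ` F) w \<noteq> (0 :: ('n, 'k) mpoly fract)"
      by (simp add: prod_fun_apply prod.reindex inj_on_def gen_def gpoly_def)
    then show "prod log.supp_idem (Xv ` F) w = 1 w" by (simp add: log.prod_supp_idem)
  qed
  have "quot_iso csc (cocyc p) (cobd p) cech_scale {y \<in> cech_cochains (log_der E) p d. cech_diff y = 0}
     (cech_diff ` cech_cochains (log_der E) (p - 1) d)"
  proof (rule quot_iso_from_cech[where f = f])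
    fix q c assume c: "c \<in> coch ?U (log.loc d) q"
    show "f c \<in> cech_cochains (log_der E) q d"
      unfolding cech_cochains_iff
    proof
      fix F
      have "if Xv ` F \<subseteq> ?U \<and> int (card (Xv ` F)) = q then c (Xv ` F) \<in> log.loc d (Xv ` F) else c (Xv ` F) = 0"
        using c unfolding coch_def by blast
      then show "if int (card F) = q then f c F \<in> log.loc d (Xv ` F) else f c F = 0"
        by (simp add: card f_def image_mono)
    qed
    show "f (cdiff gix log.supp_idem ?U c) = cech_diff (f c)"
    proof (intro ext)
      fix F w
      have "f (cdiff gix log.supp_idem ?U c) F w =
        (\<Sum>v\<in>F. csign gix (Xv v) (Xv ` F) * c (Xv ` F - {Xv v})) w"
        by (simp add: f_def cdiff_def e image_mono sum.reindex inj_on_def)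
      also have "\<dots> = (\<Sum>v\<in>F. (- 1) ^ card {u \<in> F. u < v} * c (Xv ` (F - {v})) w)"
        by (simp add: sum_fun_apply csign_Xv image_set_diff inj_def)
      finally show "f (cdiff gix log.supp_idem ?U c) F w = cech_diff (f c) F w"
        by (simp add: cech_diff_def f_def)
    qed
    show "f (csc a c) = cech_scale a (f c)" for a
      by (simp add: f_def csc_def cech_scale_def const_fun_def fun_eq_iff to_fract_def)
    have "c = 0" if "f c = 0"
    proof
      fix F
      show "c F = 0 F"
      proof (cases "F \<subseteq> ?U")
        case True
        then have "F = Xv ` (Xv -` F)" by auto
        then show ?thesis using that by (metis f_def zero_fun_apply)
      qed (use c in \<open>auto simp: coch_def\<close>)
    qed
    moreover have "(0 :: 'n idx set \<Rightarrow> _) \<in> coch ?U (log.loc d) (q - 1)"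
      by (auto simp: coch_def log.loc_zero)
    moreover have "f 0 = 0" "cdiff gix log.supp_idem ?U 0 = 0"
      by (auto simp: f_def cdiff_def fun_eq_iff)
    ultimately show "\<exists>k\<in>coch ?U (log.loc d) (q - 1). f k = 0 \<and> c = cdiff gix log.supp_idem ?U k"
      if "f c = 0" using that by metis
  next
    fix q y assume y: "y \<in> cech_cochains (log_der E :: ('n \<Rightarrow> ('n, 'k) mpoly) set) q d"
    define c where "c F = (if F \<subseteq> ?U then y (Xv -` F) else 0)" for F
    have fc: "f c = y" by (auto simp: f_def c_def fun_eq_iff inj_vimage_image_eq inj_def)
    have "c \<in> coch ?U (log.loc d) q"
      unfolding coch_def
    proof (intro CollectI allI)
      fix F
      show "if F \<subseteq> ?U \<and> int (card F) = q then c F \<in> log.loc d F else c F = 0"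
      proof (cases "F \<subseteq> ?U")
        case True
        then have F: "F = Xv ` (Xv -` F)" by auto
        have "if int (card (Xv -` F)) = q then y (Xv -` F) \<in> log.loc d (Xv ` (Xv -` F)) else y (Xv -` F) = 0"
          using y unfolding cech_cochains_iff by blast
        moreover have "card (Xv -` F) = card F" using card[of "Xv -` F"] F by metis
        ultimately show ?thesis using True by (simp add: c_def Int_absorb2 split: if_splits)
      qed (simp add: c_def)
    qed
    then show "\<exists>x\<in>coch ?U (log.loc d) q. f x = y" using fc by blast
  qed (auto simp: f_def fun_eq_iff)
  moreover have "csc = log.scl" by (simp add: csc_def log.scl_def fun_eq_iff)
  ultimately show ?thesis
    unfolding cocyc_def cobd_def log.cocycles_def log.coboundaries_def cech_cocycles_def cech_coboundaries_def
    by (simp add: quot_iso_sym)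
qed

end

section \<open>Laurent expansions\<close>

text \<open>On the component \<open>w\<close> the generators \<open>Zv\<close> and \<open>Yv v\<close> (\<open>v \<noteq> w\<close>) take the
  algebraically independent values \<open>x\<^sub>w\<close> and \<open>x\<^sub>w - x\<^sub>v\<close>, while \<open>Yv w\<close> vanishes. Elements of
  the localisations at these generators thus have a Laurent expansion on every component,
  and in \<open>model E d F\<close> the logarithmic condition reads: the coefficients of a monomial are
  constant along the edges that avoid its support.\<close>

definition lmon :: "'n::{finite,linorder} \<Rightarrow> ('n idx \<Rightarrow> int) \<Rightarrow> ('n, 'k::field) mpoly fract" where
  "lmon w \<beta> = (\<Prod>j\<in>UNIV. gen j w powi \<beta> j)"

definition pmon :: "('n idx \<Rightarrow> int) \<Rightarrow> 'n::{finite,linorder} \<Rightarrow> ('n, 'k::field) mpoly" where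
  "pmon \<beta> w = (\<Prod>j\<in>UNIV. gpoly j w ^ nat (\<beta> j))"

definition psi :: "'n::{finite,linorder} \<Rightarrow> (('n idx \<Rightarrow> int) \<Rightarrow> 'k::field) \<Rightarrow> ('n, 'k) mpoly fract" where
  "psi w f = (\<Sum>\<beta> | f \<beta> \<noteq> 0. to_fract (mconst (f \<beta>)) * lmon w \<beta>)"

definition model ::
  "'n::{finite,linorder} set set \<Rightarrow> int \<Rightarrow> 'n idx set \<Rightarrow> ('n \<Rightarrow> ('n idx \<Rightarrow> int) \<Rightarrow> 'k::field) set" where
  "model E d F = {l. finite {\<beta>. \<exists>w. l w \<beta> \<noteq> 0} \<and>
     (\<forall>w \<beta>. l w \<beta> \<noteq> 0 \<longrightarrow> (\<forall>v. \<beta> (Xv v) = 0) \<and> sum \<beta> UNIV = d \<and> (\<forall>j. j \<notin> F \<longrightarrow> 0 \<le> \<beta> j) \<and>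
        Yv w \<notin> F \<and> \<beta> (Yv w) = 0) \<and>
     (\<forall>u v \<beta>. {u, v} \<in> E \<longrightarrow> Yv u \<notin> F \<longrightarrow> Yv v \<notin> F \<longrightarrow> \<beta> (Yv u) = 0 \<longrightarrow> \<beta> (Yv v) = 0 \<longrightarrow>
        l u \<beta> = l v \<beta>)}"

text \<open>As a substitution this is an involution exchanging x_v and x_w - x_v for v \<noteq> w.
  It turns the products \<open>pmon \<beta> w\<close> into ordinary monomials, so their coefficients
  can be compared.\<close>

definition chg :: "'n \<Rightarrow> 'n \<Rightarrow> ('n, 'k::field) mpoly" where
  "chg w v = (if v = w then mvar w else mvar w - mvar v)"

definition expo_to_mon :: "'n::finite \<Rightarrow> ('n idx \<Rightarrow> int) \<Rightarrow> ('n \<Rightarrow>\<^sub>0 nat)" where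
  "expo_to_mon w \<beta> = Abs_poly_mapping (\<lambda>v. if v = w then nat (\<beta> Zv) else nat (\<beta> (Yv v)))"

definition mon_to_expo :: "'n \<Rightarrow> ('n \<Rightarrow>\<^sub>0 nat) \<Rightarrow> 'n idx \<Rightarrow> int" where
  "mon_to_expo w m j = (case j of Xv v \<Rightarrow> 0 | Zv \<Rightarrow> int (Poly_Mapping.lookup m w)
     | Yv v \<Rightarrow> if v = w then 0 else int (Poly_Mapping.lookup m v))"

text \<open>The exponents of polynomials, as opposed to Laurent polynomials, in the coordinates at
  w; via \<open>expo_to_mon w\<close> they correspond bijectively to ordinary monomials.\<close>

definition expo_ok :: "'n \<Rightarrow> ('n idx \<Rightarrow> int) \<Rightarrow> bool" where
  "expo_ok w \<beta> \<longleftrightarrow> (\<forall>v. \<beta> (Xv v) = 0) \<and> \<beta> (Yv w) = 0 \<and> (\<forall>j. 0 \<le> \<beta> j)"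

lemma poly_subst_chg_chg:
  fixes p :: "('n::finite, 'k::field) mpoly"
  shows "poly_subst (chg w) (poly_subst (chg w) p) = p"
proof -
  have "(\<lambda>v. poly_subst (chg w) (chg w v)) = (mvar :: 'n \<Rightarrow> ('n, 'k) mpoly)"
    by (auto simp: chg_def fun_eq_iff poly_subst_minus)
  then show ?thesis by (simp add: poly_subst_subst poly_subst_id)
qed

lemma lookup_expo_to_mon:
  "Poly_Mapping.lookup (expo_to_mon w \<beta>) v = (if v = w then nat (\<beta> Zv) else nat (\<beta> (Yv v)))"
  by (simp add: expo_to_mon_def)

lemma expo_ok_mon_to_expo: "expo_ok w (mon_to_expo w m)"
  by (auto simp: expo_ok_def mon_to_expo_def split: idx.splits)

lemma mon_to_expo_to_mon [simp]: "expo_to_mon w (mon_to_expo w m) = m"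
  by (rule poly_mapping_eqI) (simp add: lookup_expo_to_mon mon_to_expo_def)

lemma expo_to_mon_to_expo: "expo_ok w \<beta> \<Longrightarrow> mon_to_expo w (expo_to_mon w \<beta>) = \<beta>"
  by (auto simp: fun_eq_iff mon_to_expo_def lookup_expo_to_mon expo_ok_def split: idx.splits)

lemma expo_to_mon_inj: "expo_ok w \<beta> \<Longrightarrow> expo_ok w \<gamma> \<Longrightarrow> expo_to_mon w \<beta> = expo_to_mon w \<gamma> \<Longrightarrow> \<beta> = \<gamma>"
  by (metis expo_to_mon_to_expo)

lemma prod_idx:
  fixes f :: "'n::finite idx \<Rightarrow> 'a::comm_monoid_mult"
  shows "prod f UNIV = prod (\<lambda>v. f (Xv v)) UNIV * (f Zv * prod (\<lambda>v. f (Yv v)) UNIV)"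
proof -
  have "prod f UNIV = prod f (range Xv) * prod f (insert Zv (range Yv))"
    unfolding UNIV_idx by (rule prod.union_disjoint) auto
  also have "prod f (insert Zv (range Yv)) = f Zv * prod f (range Yv)"
    by (rule prod.insert) auto
  finally show ?thesis by (simp add: prod.reindex inj_on_def)
qed

lemma sum_idx:
  fixes f :: "'n::finite idx \<Rightarrow> 'a::comm_monoid_add"
  shows "sum f UNIV = sum (\<lambda>v. f (Xv v)) UNIV + (f Zv + sum (\<lambda>v. f (Yv v)) UNIV)"
proof -
  have "sum f UNIV = sum f (range Xv) + sum f (insert Zv (range Yv))"
    unfolding UNIV_idx by (rule sum.union_disjoint) auto
  also have "sum f (insert Zv (range Yv)) = f Zv + sum f (range Yv)"
    by (rule sum.insert) auto
  finally show ?thesis by (simp add: sum.reindex inj_on_def)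
qed

lemma pmon_eq_mon: "expo_ok w \<beta> \<Longrightarrow> pmon \<beta> w = mon (chg w) (expo_to_mon w \<beta>)"
proof -
  assume ok: "expo_ok w \<beta>"
  have "pmon \<beta> w = mvar w ^ nat (\<beta> Zv) * (\<Prod>v\<in>UNIV. (mvar w - mvar v) ^ nat (\<beta> (Yv v)))"
    using ok by (simp add: pmon_def prod_idx gpoly_def expo_ok_def)
  also have "\<dots> = mvar w ^ nat (\<beta> Zv) * (\<Prod>v\<in>UNIV - {w}. (mvar w - mvar v) ^ nat (\<beta> (Yv v)))"
    using ok by (simp add: prod.remove[of UNIV w] expo_ok_def)
  also have "\<dots> = mon (chg w) (expo_to_mon w \<beta>)"
    by (simp add: mon_def prod.remove[of UNIV w] lookup_expo_to_mon chg_def cong: prod.cong_simp)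
  finally show ?thesis .
qed

lemma poly_subst_chg_pmon: "expo_ok w \<beta> \<Longrightarrow> poly_subst (chg w) (pmon \<beta> w) = Poly_Mapping.single (expo_to_mon w \<beta>) 1"
  using poly_subst_chg_chg[of w "Poly_Mapping.single (expo_to_mon w \<beta>) 1"]
  by (simp add: pmon_eq_mon poly_subst_single)

lemma sum_expo_to_mon: "expo_ok w \<beta> \<Longrightarrow> (\<Sum>v\<in>UNIV. int (Poly_Mapping.lookup (expo_to_mon w \<beta>) v)) = sum \<beta> UNIV"
  by (simp add: sum_idx sum.remove[of UNIV w] lookup_expo_to_mon expo_ok_def cong: sum.cong_simp)

lemma lmon_pmon: "(\<forall>j. 0 \<le> \<beta> j) \<Longrightarrow> lmon w \<beta> = to_fract (pmon \<beta> w)"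
  by (simp add: lmon_def pmon_def to_fract_prod gen_def power_int_def)

lemma mvar_eq_iff: "mvar w = mvar v \<longleftrightarrow> w = v"
proof
  assume "mvar w = (mvar v :: ('a, 'b) mpoly)"
  then have "Poly_Mapping.keys (mvar w :: ('a, 'b) mpoly) = Poly_Mapping.keys (mvar v :: ('a, 'b) mpoly)" by simp
  then have "Poly_Mapping.single w (1::nat) = Poly_Mapping.single v 1" by (simp add: mvar_def)
  then have "Poly_Mapping.lookup (Poly_Mapping.single w (1::nat)) w = Poly_Mapping.lookup (Poly_Mapping.single v 1) w"
    by simp
  then show "w = v" by (simp add: lookup_single when_def split: if_splits)
qed simp

lemma gen_eq_0_iff: "gen j w = 0 \<longleftrightarrow> j = Yv w"
proof -
  show ?thesis by (cases j) (auto simp: gen_def gpoly_def mvar_eq_iff)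
qed

lemma lmon_add: "\<beta> (Yv w) = 0 \<Longrightarrow> \<gamma> (Yv w) = 0 \<Longrightarrow> lmon w (\<lambda>j. \<beta> j + \<gamma> j) = lmon w \<beta> * lmon w \<gamma>"
  unfolding lmon_def prod.distrib[symmetric]
proof (intro prod.cong refl)
  fix j assume "\<beta> (Yv w) = 0" "\<gamma> (Yv w) = 0"
  then show "gen j w powi (\<beta> j + \<gamma> j) = gen j w powi \<beta> j * gen j w powi \<gamma> j"
    by (cases "j = Yv w") (auto simp: power_int_add gen_eq_0_iff)
qed

lemma psi_superset:
  assumes "finite S" "{\<beta>. f \<beta> \<noteq> 0} \<subseteq> S"
  shows "psi w f = (\<Sum>\<beta>\<in>S. to_fract (mconst (f \<beta>)) * lmon w \<beta>)"
  unfolding psi_def using assms by (intro sum.mono_neutral_left) auto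

lemma psi_add:
  assumes "finite {\<beta>. f \<beta> \<noteq> 0}" "finite {\<beta>. h \<beta> \<noteq> 0}"
  shows "psi w (f + h) = psi w f + psi w h"
proof -
  let ?S = "{\<beta>. f \<beta> \<noteq> 0} \<union> {\<beta>. h \<beta> \<noteq> 0}"
  have fin: "finite ?S" using assms by blast
  show ?thesis
    by (subst (1 2 3) psi_superset[OF fin])
       (auto simp: mconst_add distrib_right sum.distrib)
qed

lemma psi_scale: "psi w (\<lambda>\<beta>. a * f \<beta>) = to_fract (mconst a) * psi w f"
proof (cases "a = 0")
  case True then show ?thesis by (simp add: psi_def)
next
  case False
  then show ?thesis by (simp add: psi_def mconst_mult sum_distrib_left mult.assoc)
qed

lemma psi_0 [simp]: "psi w (\<lambda>\<beta>. 0) = 0"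
  by (simp add: psi_def)

lemma psi_nonneg:
  assumes "finite S" "{\<beta>. f \<beta> \<noteq> 0} \<subseteq> S" "\<And>\<beta> j. \<beta> \<in> S \<Longrightarrow> 0 \<le> \<beta> j"
  shows "psi w f = to_fract (\<Sum>\<beta>\<in>S. mconst (f \<beta>) * pmon \<beta> w)"
  using assms by (simp add: psi_superset lmon_pmon to_fract_sum)

lemma poly_subst_chg_sum_pmon:
  assumes "\<And>\<beta>. \<beta> \<in> S \<Longrightarrow> expo_ok w \<beta>"
  shows "poly_subst (chg w) (\<Sum>\<beta>\<in>S. mconst (c \<beta>) * pmon \<beta> w) = (\<Sum>\<beta>\<in>S. Poly_Mapping.single (expo_to_mon w \<beta>) (c \<beta>))"
  using assms by (simp add: poly_subst_sum poly_subst_mult poly_subst_chg_pmon mconst_times_single)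

lemma lookup_sum_singles:
  assumes "finite S" "\<And>\<beta>. \<beta> \<in> S \<Longrightarrow> expo_ok w \<beta>" "\<beta> \<in> S"
  shows "Poly_Mapping.lookup (\<Sum>\<beta>\<in>S. Poly_Mapping.single (expo_to_mon w \<beta>) (c \<beta>)) (expo_to_mon w \<beta>) = c \<beta>"
proof -
  have "Poly_Mapping.lookup (\<Sum>\<beta>\<in>S. Poly_Mapping.single (expo_to_mon w \<beta>) (c \<beta>)) (expo_to_mon w \<beta>) =
    (\<Sum>\<gamma>\<in>S. if \<gamma> = \<beta> then c \<gamma> else 0)"
    unfolding lookup_sum lookup_single when_def using assms expo_to_mon_inj
    by (intro sum.cong refl if_cong) blast+
  then show ?thesis using assms by simp
qed

lemma psi_shift:
  assumes "Yv w \<notin> F" "finite {\<beta>. f \<beta> \<noteq> 0}" "\<And>\<beta>. f \<beta> \<noteq> 0 \<Longrightarrow> \<beta> (Yv w) = 0"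
  shows "psi w (\<lambda>\<beta>. f (\<lambda>j. \<beta> j - (if j \<in> F then int K else 0))) = psi w f * prod gen F w ^ K"
proof -
  let ?\<gamma> = "\<lambda>j. if j \<in> F then int K else 0"
  have "{\<beta>. f (\<lambda>j. \<beta> j - ?\<gamma> j) \<noteq> 0} = (\<lambda>\<beta> j. \<beta> j + ?\<gamma> j) ` {\<beta>. f \<beta> \<noteq> 0}"
    by (rule set_eqI, rule iffI, rule image_eqI[of _ _ "\<lambda>j. _ j - ?\<gamma> j"]) auto
  moreover have "inj_on (\<lambda>\<beta> j. \<beta> j + ?\<gamma> j) {\<beta>. f \<beta> \<noteq> 0}"
    by (rule inj_onI) (auto simp: fun_eq_iff)
  ultimately have "psi w (\<lambda>\<beta>. f (\<lambda>j. \<beta> j - ?\<gamma> j)) =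
     (\<Sum>\<beta> | f \<beta> \<noteq> 0. to_fract (mconst (f \<beta>)) * lmon w (\<lambda>j. \<beta> j + ?\<gamma> j))"
    by (simp add: psi_def sum.reindex)
  also have "\<dots> = (\<Sum>\<beta> | f \<beta> \<noteq> 0. to_fract (mconst (f \<beta>)) * lmon w \<beta> * lmon w ?\<gamma>)"
    using assms by (intro sum.cong refl) (simp add: lmon_add[of _ w ?\<gamma>] mult.assoc)
  also have "\<dots> = psi w f * lmon w ?\<gamma>" by (simp add: psi_def sum_distrib_right)
  also have "lmon w ?\<gamma> = prod gen F w ^ K"
  proof -
    have "lmon w ?\<gamma> = (\<Prod>j\<in>UNIV. if j \<in> F then gen j w ^ K else 1)"
      unfolding lmon_def by (intro prod.cong) auto
    then show ?thesis by (simp add: prod_fun_apply prod_power_distrib flip: prod.inter_restrict)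
  qed
  finally show ?thesis .
qed

text \<open>The bound is strict so that a shift by K makes exponents positive and not only
  nonnegative; the edge condition in \<open>psi_model_loc\<close> relies on this.\<close>

lemma expo_bound:
  assumes "finite (S :: ('n::finite idx \<Rightarrow> int) set)"
  shows "\<exists>K::nat. 1 \<le> K \<and> (\<forall>\<beta>\<in>S. \<forall>j. - int K < \<beta> j)"
proof -
  let ?K = "Suc (\<Sum>\<beta>\<in>S. \<Sum>j\<in>UNIV. nat \<bar>\<beta> j\<bar>)"
  have "- int ?K < \<beta> j" if "\<beta> \<in> S" for \<beta> j
  proof -
    have "nat \<bar>\<beta> j\<bar> \<le> (\<Sum>j\<in>UNIV. nat \<bar>\<beta> j\<bar>)" by (rule member_le_sum) auto
    also have "\<dots> \<le> (\<Sum>\<beta>\<in>S. \<Sum>j\<in>UNIV. nat \<bar>\<beta> j\<bar>)"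
      using assms that by (intro member_le_sum) auto
    finally show ?thesis by linarith
  qed
  then show ?thesis by (intro exI[of _ ?K]) auto
qed

text \<open>Laurent monomials in the coordinates at w are linearly independent: after clearing
  denominators, the substitution \<open>chg w\<close> turns them into distinct ordinary
  monomials.\<close>

lemma psi_inj:
  assumes "finite {\<beta>. f \<beta> \<noteq> 0}" "\<And>\<beta>. f \<beta> \<noteq> 0 \<Longrightarrow> \<beta> (Yv w) = 0 \<and> (\<forall>v. \<beta> (Xv v) = 0)" "psi w f = 0"
  shows "f \<beta> = 0"
proof (rule ccontr)
  assume nz: "f \<beta> \<noteq> 0"
  obtain K where K: "\<And>\<beta> j. f \<beta> \<noteq> 0 \<Longrightarrow> - int K < \<beta> j" using expo_bound[OF assms(1)] by blast
  let ?F = "insert Zv (range Yv) - {Yv w}"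
  let ?\<gamma> = "\<lambda>j. if j \<in> ?F then int K else 0"
  define h where "h = (\<lambda>\<beta>. f (\<lambda>j. \<beta> j - ?\<gamma> j))"
  let ?S = "{\<beta>. h \<beta> \<noteq> 0}"
  have "{\<beta>. h \<beta> \<noteq> 0} \<subseteq> (\<lambda>\<beta> j. \<beta> j + ?\<gamma> j) ` {\<beta>. f \<beta> \<noteq> 0}"
    unfolding h_def by (rule subsetI, rule image_eqI[of _ _ "\<lambda>j. _ j - ?\<gamma> j"]) auto
  then have fin: "finite ?S" using assms(1) finite_surj by blast
  have ok: "expo_ok w \<beta>" if "\<beta> \<in> ?S" for \<beta>
    unfolding expo_ok_def
  proof (intro conjI allI)
    fix j
    have *: "f (\<lambda>j. \<beta> j - ?\<gamma> j) \<noteq> 0" using that by (simp add: h_def)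
    show "0 \<le> \<beta> j"
    proof (cases "j \<in> ?F")
      case True then show ?thesis using K[OF *, of j] by auto
    next
      case False
      then have "j = Yv w \<or> (\<exists>v. j = Xv v)" by (cases j) auto
      then show ?thesis using assms(2)[OF *] by auto
    qed
  qed (use that assms(2)[of "\<lambda>j. \<beta> j - ?\<gamma> j"] in \<open>auto simp: h_def\<close>)
  have "psi w h = 0" using psi_shift[of w ?F f K] assms by (simp add: h_def)
  moreover have "psi w h = to_fract (\<Sum>\<beta>\<in>?S. mconst (h \<beta>) * pmon \<beta> w)"
    by (rule psi_nonneg[OF fin subset_refl]) (use ok in \<open>simp add: expo_ok_def\<close>)
  ultimately have "to_fract (\<Sum>\<beta>\<in>?S. mconst (h \<beta>) * pmon \<beta> w) = 0" by (simp only:)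
  then have "(\<Sum>\<beta>\<in>?S. mconst (h \<beta>) * pmon \<beta> w) = 0" by (simp only: to_fract_eq_0_iff)
  then have "(\<Sum>\<beta>\<in>?S. Poly_Mapping.single (expo_to_mon w \<beta>) (h \<beta>)) = 0"
    using poly_subst_chg_sum_pmon[of ?S w h] ok by simp
  moreover have "h (\<lambda>j. \<beta> j + ?\<gamma> j) \<noteq> 0" using nz by (simp add: h_def)
  ultimately show False
    using lookup_sum_singles[OF fin ok, of "\<lambda>j. \<beta> j + ?\<gamma> j" h] by simp
qed

text \<open>The substitution \<open>chg u\<close> turns the divisor x_u - x_v into the variable x_v,
  and no monomial of the transformed sum contains this variable.\<close>

lemma dvd_sum_pmon_zero:
  assumes "finite S" "\<And>\<beta>. \<beta> \<in> S \<Longrightarrow> expo_ok u \<beta> \<and> \<beta> (Yv v) = 0" "u \<noteq> v"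
    and "mvar u - mvar v dvd (\<Sum>\<beta>\<in>S. mconst (c \<beta>) * pmon \<beta> u)" "\<beta> \<in> S"
  shows "c \<beta> = 0"
proof -
  obtain q where "(\<Sum>\<beta>\<in>S. mconst (c \<beta>) * pmon \<beta> u) = (mvar u - mvar v) * q"
    using assms(4) by (elim dvdE)
  then have "poly_subst (chg u) (\<Sum>\<beta>\<in>S. mconst (c \<beta>) * pmon \<beta> u) = poly_subst (chg u) ((mvar u - mvar v) * q)"
    by simp
  then have eq: "(\<Sum>\<beta>\<in>S. Poly_Mapping.single (expo_to_mon u \<beta>) (c \<beta>)) = mvar v * poly_subst (chg u) q"
    using assms(2,3) by (simp add: poly_subst_chg_sum_pmon poly_subst_mult poly_subst_minus chg_def[of u])
  have "Poly_Mapping.lookup (expo_to_mon u \<beta>) v = 0"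
    using assms(2)[OF assms(5)] assms(3) by (simp add: lookup_expo_to_mon)
  then have "expo_to_mon u \<beta> \<notin> Poly_Mapping.keys (mvar v * poly_subst (chg u) q)"
    using keys_mult[of "mvar v" "poly_subst (chg u) q"] by (auto simp: mvar_def lookup_add lookup_single)
  then show ?thesis
    using lookup_sum_singles[OF assms(1) _ assms(5), of u c] assms(2) eq by (simp add: in_keys_iff)
qed

lemma log_der_prod: "(\<And>x. x \<in> A \<Longrightarrow> f x \<in> log_der E) \<Longrightarrow> (\<lambda>v. \<Prod>x\<in>A. f x v) \<in> log_der E"
  by (induction A rule: infinite_finite_induct) (auto intro: log_der_mult log_derI_const)

lemma log_der_power: "f \<in> log_der E \<Longrightarrow> (\<lambda>v. f v ^ n) \<in> log_der E"
  by (induction n) (auto intro: log_der_mult log_derI_const)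

lemma pmon_log_der: "pmon \<beta> \<in> log_der E"
  unfolding pmon_def by (intro log_der_prod log_der_power gpoly_log_der)

lemma homogeneous_pmon:
  assumes "\<forall>j. 0 \<le> \<beta> j" shows "homogeneous (sum \<beta> UNIV) (pmon \<beta> w)"
proof -
  have "homogeneous (\<Sum>j\<in>UNIV. int (nat (\<beta> j)) * 1) (pmon \<beta> w)"
    unfolding pmon_def by (intro homogeneous_prod homogeneous_power homogeneous_gpoly)
  then show ?thesis using assms by simp
qed

lemma homogeneous_poly_subst:
  assumes "homogeneous q p" "\<And>v. homogeneous 1 (f v)"
  shows "homogeneous q (poly_subst f p)"
  unfolding poly_subst_def
proof (rule homogeneous_sum)
  fix m assume m: "m \<in> Poly_Mapping.keys p"
  have "homogeneous (\<Sum>v\<in>UNIV. int (Poly_Mapping.lookup m v) * 1) (mon f m)"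
    unfolding mon_def by (intro homogeneous_prod homogeneous_power assms)
  then have "homogeneous q (mon f m)" using m assms(1) by (simp add: homogeneous_def)
  then show "homogeneous q (mconst (Poly_Mapping.lookup p m) * mon f m)"
    using homogeneous_mult[OF homogeneous_mconst] by fastforce
qed

section \<open>The logarithmic condition on Laurent coefficients\<close>

context
  fixes E :: "'n::{finite,linorder} set set" and ty :: "'k::field itself"
  assumes E: "simple_graph E"
begin

interpretation log: graded_function_ring "log_ring E :: int \<Rightarrow> ('n \<Rightarrow> ('n, 'k) mpoly fract) set"
    gen gix const_fun
  by (rule graded_function_ring_log_ring)

lemma edge_neq: "{u, v} \<in> E \<Longrightarrow> u \<noteq> v"
  using E by (auto simp: simple_graph_def)

lemma model_finite: "l \<in> model E d F \<Longrightarrow> finite {\<beta>. l w \<beta> \<noteq> 0}"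
  by (rule finite_subset[of _ "{\<beta>. \<exists>w. l w \<beta> \<noteq> 0}"]) (auto simp: model_def)

lemma modelD:
  assumes "l \<in> model E d F" "l w \<beta> \<noteq> 0"
  shows "\<beta> (Xv v) = 0" "sum \<beta> UNIV = d" "j \<notin> F \<Longrightarrow> 0 \<le> \<beta> j" "Yv w \<notin> F" "\<beta> (Yv w) = 0"
  using assms unfolding model_def by blast+

lemma model_edge:
  assumes "l \<in> model E d F" "{u, v} \<in> E" "Yv u \<notin> F" "Yv v \<notin> F" "\<beta> (Yv u) = 0" "\<beta> (Yv v) = 0"
  shows "l u \<beta> = l v \<beta>"
  using assms unfolding model_def by blast

text \<open>The edge condition holds for each exponent separately. If \<beta> vanishes at both ends,
  the two coefficients agree and \<open>pmon \<beta>\<close> is itself logarithmic. Otherwise each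
  nonzero contribution contains the factor belonging to the other end, which is x_u - x_v up to
  sign.\<close>

lemma psi_log_ring:
  assumes l: "l \<in> model E q {}"
  shows "(\<lambda>w. psi w (l w)) \<in> (log_ring E q :: ('n \<Rightarrow> ('n, 'k) mpoly fract) set)"
proof -
  let ?S = "{\<beta>. \<exists>w. l w \<beta> \<noteq> 0}"
  have fin: "finite ?S" using l by (simp add: model_def)
  have nn: "0 \<le> \<beta> j" if "\<beta> \<in> ?S" for \<beta> j using modelD(3)[OF l] that by blast
  define \<theta> where "\<theta> w = (\<Sum>\<beta>\<in>?S. mconst (l w \<beta>) * pmon \<beta> w)" for w
  have psi: "psi w (l w) = to_fract (\<theta> w)" for w
    unfolding \<theta>_def by (rule psi_nonneg[OF fin]) (use nn in auto)
  have "\<theta> \<in> log_der E"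
    unfolding log_der_iff
  proof (intro allI impI)
    fix u v assume uv: "{u, v} \<in> E"
    have "mvar u - mvar v dvd mconst (l u \<beta>) * pmon \<beta> u - mconst (l v \<beta>) * pmon \<beta> v" if S: "\<beta> \<in> ?S" for \<beta>
    proof (cases "\<beta> (Yv u) = 0 \<and> \<beta> (Yv v) = 0")
      case True
      then have "l u \<beta> = l v \<beta>" using model_edge[OF l uv] by auto
      moreover have "(pmon \<beta> :: 'n \<Rightarrow> ('n, 'k) mpoly) \<in> log_der E" by (rule pmon_log_der)
      then have "mvar u - mvar v dvd (pmon \<beta> u - pmon \<beta> v :: ('n, 'k) mpoly)"
        using uv by (simp add: log_der_iff)
      ultimately show ?thesis by (simp flip: right_diff_distrib)
    next
      case False
      have dv: "(gpoly j w :: ('n, 'k) mpoly) dvd pmon \<beta> w" if "\<beta> j > 0" for j w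
      proof -
        have "(gpoly j w :: ('n, 'k) mpoly) dvd gpoly j w ^ nat (\<beta> j)" using that by (simp add: dvd_power)
        also have "\<dots> dvd pmon \<beta> w" unfolding pmon_def by (rule dvd_prodI) auto
        finally show ?thesis .
      qed
      have "mvar u - mvar v dvd mconst (l u \<beta>) * pmon \<beta> u"
      proof (cases "l u \<beta> = 0")
        case nz: False
        then have "\<beta> (Yv v) > 0" using False modelD(5)[OF l nz] nn[OF S, of "Yv v"] by simp
        from dv[OF this, of u] show ?thesis by (simp add: gpoly_def dvd_mult)
      qed simp
      moreover have "mvar u - mvar v dvd mconst (l v \<beta>) * pmon \<beta> v"
      proof (cases "l v \<beta> = 0")
        case nz: False
        then have "\<beta> (Yv u) > 0" using False modelD(5)[OF l nz] nn[OF S, of "Yv u"] by simp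
        from dv[OF this, of v] have "mvar v - mvar u dvd (pmon \<beta> v :: ('n, 'k) mpoly)" by (simp add: gpoly_def)
        then show ?thesis by (metis dvd_mult minus_diff_eq minus_dvd_iff)
      qed simp
      ultimately show ?thesis by (rule dvd_diff)
    qed
    then show "mvar u - mvar v dvd \<theta> u - \<theta> v"
      unfolding \<theta>_def sum_subtractf[symmetric] by (intro dvd_sum) auto
  qed
  moreover have "der_homogeneous q \<theta>"
    unfolding der_homogeneous_def \<theta>_def
  proof (intro allI homogeneous_sum)
    fix w \<beta> assume S: "\<beta> \<in> ?S"
    then have "sum \<beta> UNIV = q" using modelD(2)[OF l] by blast
    then show "homogeneous q (mconst (l w \<beta>) * pmon \<beta> w)"
      using homogeneous_mult[OF homogeneous_mconst homogeneous_pmon[of \<beta>]] nn[OF S] by fastforce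
  qed
  ultimately show ?thesis unfolding log_ring_def psi by blast
qed

lemma log_ring_psi:
  assumes "x \<in> (log_ring E q :: ('n \<Rightarrow> ('n, 'k) mpoly fract) set)"
  shows "\<exists>l\<in>model E q {}. (\<lambda>w. psi w (l w)) = x"
proof -
  obtain \<theta> where \<theta>: "\<theta> \<in> log_der E" "der_homogeneous q \<theta>" "x = (\<lambda>w. to_fract (\<theta> w))"
    using assms by (auto simp: log_ring_def)
  define P where "P w = poly_subst (chg w) (\<theta> w)" for w
  have \<theta>P: "\<theta> w = poly_subst (chg w) (P w)" for w by (simp add: P_def poly_subst_chg_chg)
  define l where "l w \<beta> = (if expo_ok w \<beta> then Poly_Mapping.lookup (P w) (expo_to_mon w \<beta>) else 0)" for w \<beta>
  have supp: "{\<beta>. l w \<beta> \<noteq> 0} = mon_to_expo w ` Poly_Mapping.keys (P w)" for w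
    by (auto simp: l_def in_keys_iff expo_to_mon_to_expo expo_ok_mon_to_expo split: if_splits
        intro!: image_eqI[of _ _ "expo_to_mon w _"])
  have fin: "finite {\<beta>. \<exists>w. l w \<beta> \<noteq> 0}"
  proof -
    have "{\<beta>. \<exists>w. l w \<beta> \<noteq> 0} = (\<Union>w. mon_to_expo w ` Poly_Mapping.keys (P w))" using supp by blast
    then show ?thesis by simp
  qed
  have ok: "expo_ok w \<beta>" if "l w \<beta> \<noteq> 0" for w \<beta> using that by (auto simp: l_def split: if_splits)
  have sum: "sum \<beta> UNIV = q" if nz: "l w \<beta> \<noteq> 0" for w \<beta>
  proof -
    have "homogeneous q (P w)"
      unfolding P_def using \<theta>(2)
      by (intro homogeneous_poly_subst) (auto simp: der_homogeneous_def chg_def intro: homogeneous_mvar homogeneous_diff)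
    moreover have "expo_to_mon w \<beta> \<in> Poly_Mapping.keys (P w)"
      using nz by (simp add: l_def in_keys_iff split: if_splits)
    ultimately show ?thesis using sum_expo_to_mon[OF ok[OF nz]] by (simp add: homogeneous_def)
  qed
  have psi0: "\<theta> w = (\<Sum>\<beta> | \<exists>w. l w \<beta> \<noteq> 0. mconst (l w \<beta>) * pmon \<beta> w)" for w
  proof -
    have inj: "inj_on (mon_to_expo w) (Poly_Mapping.keys (P w))"
      by (metis inj_onI mon_to_expo_to_mon)
    have "(\<Sum>\<beta> | \<exists>w. l w \<beta> \<noteq> 0. mconst (l w \<beta>) * pmon \<beta> w) = (\<Sum>\<beta> | l w \<beta> \<noteq> 0. mconst (l w \<beta>) * pmon \<beta> w)"
      by (rule sum.mono_neutral_right[OF fin]) auto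
    also have "\<dots> = (\<Sum>m\<in>Poly_Mapping.keys (P w). mconst (Poly_Mapping.lookup (P w) m) * mon (chg w) m)"
      unfolding supp sum.reindex[OF inj]
      by (intro sum.cong refl) (simp add: l_def expo_ok_mon_to_expo pmon_eq_mon)
    also have "\<dots> = \<theta> w" by (simp add: \<theta>P[of w] poly_subst_def)
    finally show ?thesis by simp
  qed
  have psi: "psi w (l w) = to_fract (\<theta> w)" for w
    unfolding psi0 by (rule psi_nonneg[OF fin]) (use ok in \<open>auto simp: expo_ok_def\<close>)
  have edge: "l u \<beta> = l v \<beta>"
    if uv: "{u, v} \<in> E" and \<beta>: "\<beta> (Yv u) = 0" "\<beta> (Yv v) = 0" for u v \<beta>
  proof (cases "expo_ok u \<beta>")
    case False
    then have "\<not> expo_ok v \<beta>" using \<beta> by (auto simp: expo_ok_def)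
    then show ?thesis using False by (simp add: l_def)
  next
    case oku: True
    let ?T = "{\<beta>. \<exists>w. l w \<beta> \<noteq> 0}"
    let ?S = "{\<beta>\<in>?T. expo_ok u \<beta> \<and> \<beta> (Yv v) = 0}"
    let ?d = "mvar u - mvar v :: ('n, 'k) mpoly"
    \<comment> \<open>Modulo x_u - x_v only exponents vanishing at both ends contribute, and for
      these \<open>pmon \<gamma> v\<close> may be replaced by \<open>pmon \<gamma> u\<close>. What
      remains is a sum to which \<open>dvd_sum_pmon_zero\<close> applies.\<close>
    have "?d dvd (mconst (l u \<gamma>) * pmon \<gamma> u - mconst (l v \<gamma>) * pmon \<gamma> v) -
        (if \<gamma> \<in> ?S then mconst (l u \<gamma> - l v \<gamma>) * pmon \<gamma> u else 0)" if T: "\<gamma> \<in> ?T" for \<gamma>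
    proof (cases "\<gamma> \<in> ?S")
      case True
      have "(pmon \<gamma> :: 'n \<Rightarrow> ('n, 'k) mpoly) \<in> log_der E" by (rule pmon_log_der)
      then have "?d dvd pmon \<gamma> u - pmon \<gamma> v" using uv by (simp add: log_der_iff)
      moreover have "(mconst (l u \<gamma>) * pmon \<gamma> u - mconst (l v \<gamma>) * pmon \<gamma> v) -
         mconst (l u \<gamma> - l v \<gamma>) * pmon \<gamma> u = mconst (l v \<gamma>) * (pmon \<gamma> u - pmon \<gamma> v)"
      proof -
        have "mconst (l u \<gamma>) = (mconst (l u \<gamma> - l v \<gamma>) + mconst (l v \<gamma>) :: ('n, 'k) mpoly)"
          by (simp flip: mconst_add)
        then show ?thesis by (simp only:) (simp add: algebra_simps)
      qed
      ultimately show ?thesis using True by (simp only: if_True dvd_mult)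
    next
      case False
      have pos: "0 < \<gamma> (Yv b)" if "l a \<gamma> \<noteq> 0" "{a, b} = {u, v}" for a b
      proof -
        have oka: "expo_ok a \<gamma>" using ok that by blast
        moreover have "\<gamma> (Yv b) \<noteq> 0"
        proof
          assume "\<gamma> (Yv b) = 0"
          then have "expo_ok u \<gamma>" "\<gamma> (Yv v) = 0" using oka that(2) by (auto simp: expo_ok_def doubleton_eq_iff)
          then show False using False T by blast
        qed
        ultimately show ?thesis by (simp add: expo_ok_def order.order_iff_strict) (metis)
      qed
      have dv: "mvar a - mvar b dvd (pmon \<gamma> a :: ('n, 'k) mpoly)" if "0 < \<gamma> (Yv b)" for a b
      proof -
        have "gpoly (Yv b) a dvd (gpoly (Yv b) a ^ nat (\<gamma> (Yv b)) :: ('n, 'k) mpoly)" using that by (simp add: dvd_power)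
        also have "\<dots> dvd pmon \<gamma> a" unfolding pmon_def by (rule dvd_prodI) auto
        finally show ?thesis by (simp add: gpoly_def)
      qed
      have "?d dvd mconst (l u \<gamma>) * pmon \<gamma> u"
        using pos[of u v] dv[of v u] by (cases "l u \<gamma> = 0") auto
      moreover have "?d dvd mconst (l v \<gamma>) * pmon \<gamma> v"
      proof (cases "l v \<gamma> = 0")
        case nz: False
        then have "mvar v - mvar u dvd (pmon \<gamma> v :: ('n, 'k) mpoly)" using pos[of v u] dv[of u v] by auto
        then show ?thesis by (metis dvd_mult minus_diff_eq minus_dvd_iff)
      qed simp
      ultimately show ?thesis unfolding if_not_P[OF False] by (simp add: dvd_diff)
    qed
    then have "?d dvd (\<Sum>\<gamma>\<in>?T. (mconst (l u \<gamma>) * pmon \<gamma> u - mconst (l v \<gamma>) * pmon \<gamma> v) -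
        (if \<gamma> \<in> ?S then mconst (l u \<gamma> - l v \<gamma>) * pmon \<gamma> u else 0))"
      by (intro dvd_sum) auto
    also have "(\<Sum>\<gamma>\<in>?T. (mconst (l u \<gamma>) * pmon \<gamma> u - mconst (l v \<gamma>) * pmon \<gamma> v) -
        (if \<gamma> \<in> ?S then mconst (l u \<gamma> - l v \<gamma>) * pmon \<gamma> u else 0)) =
       (\<theta> u - \<theta> v) - (\<Sum>\<gamma>\<in>?S. mconst (l u \<gamma> - l v \<gamma>) * pmon \<gamma> u)"
    proof -
      have "(\<Sum>\<gamma>\<in>?T. if \<gamma> \<in> ?S then mconst (l u \<gamma> - l v \<gamma>) * pmon \<gamma> u else 0) =
         (\<Sum>\<gamma>\<in>?S. mconst (l u \<gamma> - l v \<gamma>) * pmon \<gamma> u)"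
        by (rule sum.mono_neutral_cong_right[OF fin]) auto
      then show ?thesis by (simp only: sum_subtractf psi0)
    qed
    finally have "?d dvd (\<theta> u - \<theta> v) - (\<Sum>\<gamma>\<in>?S. mconst (l u \<gamma> - l v \<gamma>) * pmon \<gamma> u)" .
    moreover have "?d dvd \<theta> u - \<theta> v" using \<theta>(1) uv by (simp add: log_der_iff)
    ultimately have dvd: "?d dvd (\<Sum>\<gamma>\<in>?S. mconst (l u \<gamma> - l v \<gamma>) * pmon \<gamma> u)"
      by (simp only: dvd_diff_right_iff)
    show ?thesis
    proof (cases "\<beta> \<in> ?S")
      case True
      have "l u \<beta> - l v \<beta> = 0"
        by (rule dvd_sum_pmon_zero[of ?S u v "\<lambda>\<gamma>. l u \<gamma> - l v \<gamma>"]) (use fin edge_neq[OF uv] dvd True in auto)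
      then show ?thesis by simp
    next
      case False
      then have "\<beta> \<notin> ?T" using oku \<beta> by blast
      then show ?thesis by simp
    qed
  qed
  have "l \<in> model E q {}"
    unfolding model_def using fin sum ok edge by (auto simp: expo_ok_def)
  then show ?thesis using psi \<theta>(3) by auto
qed

lemma psi_model_loc:
  assumes F: "F \<subseteq> insert Zv (range Yv)" and l: "l \<in> model E d F"
  shows "(\<lambda>w. psi w (l w)) \<in> (log.loc d F :: ('n \<Rightarrow> ('n, 'k) mpoly fract) set)"
proof -
  let ?S = "{\<beta>. \<exists>w. l w \<beta> \<noteq> 0}"
  have fin: "finite ?S" using l by (simp add: model_def)
  obtain K where K: "1 \<le> K" "\<And>\<beta> j. \<beta> \<in> ?S \<Longrightarrow> - int K < \<beta> j" using expo_bound[OF fin] by blast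
  let ?\<gamma> = "\<lambda>j. if j \<in> F then int K else 0"
  define l' where "l' w \<beta> = l w (\<lambda>j. \<beta> j - ?\<gamma> j)" for w \<beta>
  have X: "Xv v \<notin> F" for v using F by auto
  have pos: "0 < \<beta> j" if "l' w \<beta> \<noteq> 0" "j \<in> F" for w \<beta> j
    using K(2)[of "\<lambda>j. \<beta> j - ?\<gamma> j" j] that by (auto simp: l'_def)
  have out: "Yv w \<notin> F" if "l' w \<beta> \<noteq> 0" for w \<beta>
    using modelD(4)[OF l] that by (auto simp: l'_def)
  have l': "l' \<in> model E (d + int (K * card F)) {}"
    unfolding model_def
  proof (intro CollectI conjI allI impI)
    have "{\<beta>. \<exists>w. l' w \<beta> \<noteq> 0} \<subseteq> (\<lambda>\<beta> j. \<beta> j + ?\<gamma> j) ` ?S"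
      unfolding l'_def by (rule subsetI, rule image_eqI[of _ _ "\<lambda>j. _ j - ?\<gamma> j"]) auto
    then show "finite {\<beta>. \<exists>w. l' w \<beta> \<noteq> 0}" using fin finite_surj by blast
  next
    fix w \<beta> assume nz: "l' w \<beta> \<noteq> 0"
    then have nz': "l w (\<lambda>j. \<beta> j - ?\<gamma> j) \<noteq> 0" by (simp add: l'_def)
    show "\<beta> (Xv v) = 0" for v using modelD(1)[OF l nz', of v] X by simp
    show "sum \<beta> UNIV = d + int (K * card F)"
    proof -
      have "sum ?\<gamma> UNIV = int (K * card F)" by (simp add: sum.If_cases)
      then show ?thesis using modelD(2)[OF l nz'] by (simp add: sum_subtractf)
    qed
    show "0 \<le> \<beta> j" for j
      using pos[OF nz, of j] modelD(3)[OF l nz', of j] by (cases "j \<in> F") auto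
    show "\<beta> (Yv w) = 0" using modelD(5)[OF l nz'] out[OF nz] by simp
  next
    fix u v and \<beta> :: "'n idx \<Rightarrow> int" assume uv: "{u, v} \<in> E" "\<beta> (Yv u) = 0" "\<beta> (Yv v) = 0"
    show "l' u \<beta> = l' v \<beta>"
    proof (cases "Yv u \<in> F \<or> Yv v \<in> F")
      case True
      \<comment> \<open>If one end is inverted, its own coefficients are zero, and nonzero
        coefficients at the other end have a positive shifted exponent there, contrary to the
        assumption on \<beta>.\<close>
      have "l' u \<beta> = 0" using True out[of u \<beta>] pos[of u \<beta> "Yv v"] uv by auto
      moreover have "l' v \<beta> = 0" using True out[of v \<beta>] pos[of v \<beta> "Yv u"] uv by auto
      ultimately show ?thesis by simp
    next
      case False
      then show ?thesis unfolding l'_def using uv by (intro model_edge[OF l uv(1)]) auto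
    qed
  qed auto
  have "(\<lambda>w. psi w (l w)) = (\<lambda>w. psi w (l' w)) * pinv (prod gen F) ^ K"
  proof
    fix w
    show "psi w (l w) = ((\<lambda>w. psi w (l' w)) * pinv (prod gen F) ^ K) w"
    proof (cases "Yv w \<in> F")
      case True
      then have "l w = (\<lambda>_. 0)" using modelD(4)[OF l] by (auto simp: fun_eq_iff)
      moreover have "prod gen F w = (0 :: ('n, 'k) mpoly fract)"
        using True by (auto simp: prod_fun_apply gen_eq_0_iff)
      ultimately show ?thesis using K(1) by (simp add: pinv_def power_0_left)
    next
      case False
      have "psi w (l' w) = psi w (l w) * prod gen F w ^ K"
        unfolding l'_def by (rule psi_shift) (use False model_finite[OF l] modelD(5)[OF l] in auto)
      moreover have "prod gen F w \<noteq> (0 :: ('n, 'k) mpoly fract)"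
        using False by (auto simp: prod_fun_apply gen_eq_0_iff)
      ultimately show ?thesis by (simp add: pinv_def field_simps)
    qed
  qed
  then show ?thesis unfolding log.loc_def using psi_log_ring[OF l'] K(1) by blast
qed

lemma loc_psi_model:
  assumes F: "F \<subseteq> insert Zv (range Yv)" and x: "x \<in> (log.loc d F :: ('n \<Rightarrow> ('n, 'k) mpoly fract) set)"
  shows "\<exists>l\<in>model E d F. (\<lambda>w. psi w (l w)) = x"
proof -
  obtain a K where a: "1 \<le> K" "a \<in> log_ring E (d + int (K * card F))" "x = a * pinv (prod gen F) ^ K"
    using x unfolding log.loc_def by blast
  obtain l0 where l0: "l0 \<in> model E (d + int (K * card F)) {}" "(\<lambda>w. psi w (l0 w)) = a"
    using log_ring_psi[OF a(2)] by blast
  let ?\<gamma> = "\<lambda>j. if j \<in> F then int K else 0"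
  \<comment> \<open>The numerator may be nonzero at a vertex w with \<open>Yv w\<close> in F, but
    the fraction is zero there, so these coefficients are reset to 0.\<close>
  define l where "l w \<beta> = (if Yv w \<in> F then 0 else l0 w (\<lambda>j. \<beta> j + ?\<gamma> j))" for w \<beta>
  have X: "Xv v \<notin> F" for v using F by auto
  have l: "l \<in> model E d F"
    unfolding model_def
  proof (intro CollectI conjI allI impI)
    have "{\<beta>. \<exists>w. l w \<beta> \<noteq> 0} \<subseteq> (\<lambda>\<beta> j. \<beta> j - ?\<gamma> j) ` {\<beta>. \<exists>w. l0 w \<beta> \<noteq> 0}"
      unfolding l_def by (rule subsetI, rule image_eqI[of _ _ "\<lambda>j. _ j + ?\<gamma> j"]) (auto split: if_splits)
    then show "finite {\<beta>. \<exists>w. l w \<beta> \<noteq> 0}"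
      using l0(1) finite_surj unfolding model_def by blast
  next
    fix w \<beta> assume nz: "l w \<beta> \<noteq> 0"
    then have out: "Yv w \<notin> F" and nz': "l0 w (\<lambda>j. \<beta> j + ?\<gamma> j) \<noteq> 0" by (auto simp: l_def split: if_splits)
    show "Yv w \<notin> F" by (rule out)
    show "\<beta> (Xv v) = 0" for v using modelD(1)[OF l0(1) nz', of v] X by simp
    show "sum \<beta> UNIV = d"
    proof -
      have "sum ?\<gamma> UNIV = int (K * card F)" by (simp add: sum.If_cases)
      then show ?thesis using modelD(2)[OF l0(1) nz'] by (simp add: sum.distrib)
    qed
    show "0 \<le> \<beta> j" if "j \<notin> F" for j
      using modelD(3)[OF l0(1) nz', of j] that by simp
    show "\<beta> (Yv w) = 0" using modelD(5)[OF l0(1) nz'] out by simp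
  next
    fix u v and \<beta> :: "'n idx \<Rightarrow> int" assume uv: "{u, v} \<in> E" "Yv u \<notin> F" "Yv v \<notin> F" "\<beta> (Yv u) = 0" "\<beta> (Yv v) = 0"
    then show "l u \<beta> = l v \<beta>"
      unfolding l_def using model_edge[OF l0(1) uv(1), of "\<lambda>j. \<beta> j + ?\<gamma> j"] by simp
  qed
  have "psi w (l w) = x w" for w
  proof (cases "Yv w \<in> F")
    case True
    then have "l w = (\<lambda>_. 0)" by (auto simp: fun_eq_iff l_def)
    moreover have "prod gen F w = (0 :: ('n, 'k) mpoly fract)"
      using True by (auto simp: prod_fun_apply gen_eq_0_iff)
    ultimately show ?thesis using a by (simp add: pinv_def power_0_left)
  next
    case False
    have "psi w (\<lambda>\<beta>. l w (\<lambda>j. \<beta> j - ?\<gamma> j)) = psi w (l w) * prod gen F w ^ K"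
      by (rule psi_shift) (use False model_finite[OF l] modelD(5)[OF l] in auto)
    moreover have "(\<lambda>\<beta>. l w (\<lambda>j. \<beta> j - ?\<gamma> j)) = l0 w" using False by (auto simp: l_def fun_eq_iff)
    moreover have "prod gen F w \<noteq> (0 :: ('n, 'k) mpoly fract)"
      using False by (auto simp: prod_fun_apply gen_eq_0_iff)
    ultimately show ?thesis using a(3) l0(2) by (auto simp: pinv_def field_simps)
  qed
  then show ?thesis using l by blast
qed

end

section \<open>The Cech complex of Laurent coefficients\<close>

definition cut :: "'n idx \<Rightarrow> 'n \<Rightarrow> ('n idx \<Rightarrow> int) \<Rightarrow> 'k::field" where
  "cut i w \<beta> = (if i = Yv w then 0 else 1)"

definition const_coeff :: "'k::field \<Rightarrow> 'n \<Rightarrow> ('n idx \<Rightarrow> int) \<Rightarrow> 'k" where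
  "const_coeff a w \<beta> = a"

text \<open>The exponents that survive \<open>quot_iso_model_neg\<close>.\<close>

definition expo_neg :: "('n idx \<Rightarrow> int) \<Rightarrow> bool" where
  "expo_neg \<beta> \<longleftrightarrow> \<beta> Zv < 0 \<and> (\<forall>v. \<beta> (Yv v) \<le> 0)"

text \<open>The generator along which the part of exponent \<beta> is contracted. For z the exponent
  0 is good enough because z vanishes nowhere. Inverting \<open>Yv v\<close> deletes the vertex v,
  which is harmless only if \<beta> is positive there, since then there is no coefficient at v to
  lose.\<close>

definition expo_pivot :: "('n idx \<Rightarrow> int) \<Rightarrow> 'n idx" where
  "expo_pivot \<beta> = (if \<beta> Zv \<ge> 0 then Zv else Yv (SOME v. \<beta> (Yv v) > 0))"

lemma expo_pivot_nonneg: "\<not> expo_neg \<beta> \<Longrightarrow> 0 \<le> \<beta> (expo_pivot \<beta>)"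
  unfolding expo_neg_def expo_pivot_def
  by (metis (mono_tags, lifting) linorder_not_le order_less_imp_le someI_ex)

lemma expo_pivot_pos: "\<not> expo_neg \<beta> \<Longrightarrow> expo_pivot \<beta> = Yv v \<Longrightarrow> 0 < \<beta> (Yv v)"
  unfolding expo_neg_def expo_pivot_def
  by (auto split: if_splits simp: not_le) (metis (mono_tags, lifting) someI_ex)

lemma expo_pivot_range: "expo_pivot \<beta> \<in> insert Zv (range Yv)"
  by (simp add: expo_pivot_def)

lemma prod_cut: "finite F \<Longrightarrow> prod cut F w \<beta> = (if Yv w \<in> F then 0 else 1)"
  by (induction F rule: finite_induct) (auto simp: cut_def)

lemma csign_coeff: "csign ix v F w \<beta> = (csign ix v F :: 'k::field)"
  by (simp add: csign_def)

lemma to_fract_mconst_csign: "to_fract (mconst (csign ix v F)) = csign ix v F"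
proof -
  have "to_fract (mconst ((- 1) ^ n)) = (- 1) ^ n" for n :: nat
    by (induction n) (auto simp: mconst_minus)
  then show ?thesis by (simp add: csign_def)
qed

lemma psi_zero [simp]: "psi w 0 = 0"
  by (simp add: psi_def)

lemma psi_sum:
  assumes "finite V" "\<And>v. v \<in> V \<Longrightarrow> finite {\<beta>. f v \<beta> \<noteq> 0}"
  shows "psi w (\<lambda>\<beta>. \<Sum>v\<in>V. a v * f v \<beta>) = (\<Sum>v\<in>V. to_fract (mconst (a v)) * psi w (f v))"
  using assms
proof (induction V rule: finite_induct)
  case (insert x V)
  have fin: "finite {\<beta>. a x * f x \<beta> \<noteq> 0}" using insert.prems[of x] by (auto intro: finite_subset)
  have "{\<beta>. (\<Sum>v\<in>V. a v * f v \<beta>) \<noteq> 0} \<subseteq> (\<Union>v\<in>V. {\<beta>. f v \<beta> \<noteq> 0})"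
    using sum.not_neutral_contains_not_neutral by fastforce
  then have fin': "finite {\<beta>. (\<Sum>v\<in>V. a v * f v \<beta>) \<noteq> 0}"
    by (rule finite_subset) (use insert in auto)
  have "(\<lambda>\<beta>. \<Sum>v\<in>insert x V. a v * f v \<beta>) = (\<lambda>\<beta>. a x * f x \<beta>) + (\<lambda>\<beta>. \<Sum>v\<in>V. a v * f v \<beta>)"
    using insert.hyps by (simp add: fun_eq_iff)
  then show ?case using insert psi_add[OF fin fin', of w] by (simp add: psi_scale)
qed simp

context
  fixes E :: "'n::{finite,linorder} set set" and ty :: "'k::field itself" and d :: int
  assumes E: "simple_graph E"
begin

interpretation log: graded_function_ring "log_ring E :: int \<Rightarrow> ('n \<Rightarrow> ('n, 'k) mpoly fract) set"
    gen gix const_fun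
  by (rule graded_function_ring_log_ring)

abbreviation YZ :: "'n idx set" where "YZ \<equiv> insert Zv (range Yv)"

lemma cech_model: "cech_complex gix cut YZ (model E d) (const_coeff :: 'k \<Rightarrow> _)"
proof
  show "finite YZ" by simp
  show "inj_on gix YZ" by (rule inj_on_subset[OF inj_gix]) simp
  show "cut i * cut i = (cut i :: 'n \<Rightarrow> _ \<Rightarrow> 'k)" for i by (auto simp: cut_def fun_eq_iff)
  show "0 \<in> model E d F" for F by (simp add: model_def)
  show "x + y \<in> model E d F" if x: "x \<in> model E d F" and y: "y \<in> model E d F"
    for F and x y :: "'n \<Rightarrow> ('n idx \<Rightarrow> int) \<Rightarrow> 'k"
  proof -
    have "{\<beta>. \<exists>w. (x + y) w \<beta> \<noteq> 0} \<subseteq> {\<beta>. \<exists>w. x w \<beta> \<noteq> 0} \<union> {\<beta>. \<exists>w. y w \<beta> \<noteq> 0}" by auto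
    then have fin: "finite {\<beta>. \<exists>w. (x + y) w \<beta> \<noteq> 0}"
      by (rule finite_subset) (use x y in \<open>simp add: model_def\<close>)
    show ?thesis unfolding model_def
    proof (intro CollectI conjI allI impI fin)
      fix w \<beta> assume nz: "(x + y) w \<beta> \<noteq> 0"
      have *: "(\<forall>v. \<beta> (Xv v) = 0) \<and> sum \<beta> UNIV = d \<and> (\<forall>j. j \<notin> F \<longrightarrow> 0 \<le> \<beta> j) \<and>
        Yv w \<notin> F \<and> \<beta> (Yv w) = 0"
      proof (cases "x w \<beta> = 0")
        case True
        then have "y w \<beta> \<noteq> 0" using nz by simp
        then show ?thesis using y unfolding model_def by blast
      next
        case False
        then show ?thesis using x unfolding model_def by blast
      qed
      show "\<beta> (Xv v) = 0" for v using * by blast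
      show "sum \<beta> UNIV = d" "Yv w \<notin> F" "\<beta> (Yv w) = 0" using * by blast+
      show "0 \<le> \<beta> j" if "j \<notin> F" for j using * that by blast
    next
      fix u v \<beta> assume "{u, v} \<in> E" "Yv u \<notin> F" "Yv v \<notin> F" "\<beta> (Yv u) = 0" "\<beta> (Yv v) = (0::int)"
      then show "(x + y) u \<beta> = (x + y) v \<beta>"
        using model_edge[OF E x, of u v \<beta>] model_edge[OF E y, of u v \<beta>] by simp
    qed
  qed
  show "- x \<in> model E d F" if "x \<in> model E d F" for F and x :: "'n \<Rightarrow> ('n idx \<Rightarrow> int) \<Rightarrow> 'k"
    using that unfolding model_def by simp
  show "const_coeff a * x \<in> model E d F" if x: "x \<in> model E d F" for F a and x :: "'n \<Rightarrow> ('n idx \<Rightarrow> int) \<Rightarrow> 'k"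
  proof (cases "a = 0")
    case True
    then show ?thesis by (simp add: model_def const_coeff_def)
  next
    case False
    then show ?thesis using x unfolding model_def by (simp add: const_coeff_def)
  qed
  show "prod cut F * x \<in> model E d F" if "v \<in> F" and x: "x \<in> model E d (F - {v})"
    for F v and x :: "'n \<Rightarrow> ('n idx \<Rightarrow> int) \<Rightarrow> 'k"
  proof -
    have "{\<beta>. \<exists>w. (prod cut F * x) w \<beta> \<noteq> 0} \<subseteq> {\<beta>. \<exists>w. x w \<beta> \<noteq> 0}" by auto
    then have fin: "finite {\<beta>. \<exists>w. (prod cut F * x) w \<beta> \<noteq> 0}"
      by (rule finite_subset) (use x in \<open>simp add: model_def\<close>)
    have nz: "x w \<beta> \<noteq> 0 \<and> Yv w \<notin> F" if "(prod cut F * x) w \<beta> \<noteq> 0" for w \<beta>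
      using that by (auto simp: prod_cut split: if_splits)
    show ?thesis unfolding model_def
    proof (intro CollectI conjI allI impI fin)
      fix u v' \<beta> assume "{u, v'} \<in> E" "Yv u \<notin> F" "Yv v' \<notin> F" "\<beta> (Yv u) = 0" "\<beta> (Yv v') = (0::int)"
      then show "(prod cut F * x) u \<beta> = (prod cut F * x) v' \<beta>"
        using model_edge[OF E x, of u v' \<beta>] by (simp add: prod_cut)
    qed (use nz modelD[OF E x] in blast)+
  qed
qed

interpretation cech_complex gix cut YZ "model E d" "const_coeff :: 'k \<Rightarrow> _"
  by (rule cech_model)

text \<open>The map on cochains is bijective: injective by \<open>psi_inj\<close>, surjective by
  \<open>loc_psi_model\<close>.\<close>

lemma quot_iso_model_log:
  "quot_iso csc (cocyc p) (cobd p) log.scl (log.cocycles d p YZ) (log.coboundaries d p YZ)"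
proof -
  define f where "f c = (\<lambda>F w. psi w (c F w))"
    for c :: "'n idx set \<Rightarrow> 'n \<Rightarrow> ('n idx \<Rightarrow> int) \<Rightarrow> 'k"
  have cF: "c F \<in> model E d F" if "c \<in> coch YZ (model E d) q" "F \<subseteq> YZ"
    for F q and c :: "'n idx set \<Rightarrow> 'n \<Rightarrow> ('n idx \<Rightarrow> int) \<Rightarrow> 'k"
  proof -
    have "if F \<subseteq> YZ \<and> int (card F) = q then c F \<in> model E d F else c F = 0"
      using that unfolding coch_def by blast
    then show ?thesis using L0[OF that(2)] by metis
  qed
  have c0: "c F = 0" if "c \<in> coch YZ (model E d) q" "\<not> (F \<subseteq> YZ \<and> int (card F) = q)"
    for F q and c :: "'n idx set \<Rightarrow> 'n \<Rightarrow> ('n idx \<Rightarrow> int) \<Rightarrow> 'k"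
    using that unfolding coch_def by auto
  have fin: "finite {\<beta>. c F w \<beta> \<noteq> 0}" if "c \<in> coch YZ (model E d) q"
    for F q w and c :: "'n idx set \<Rightarrow> 'n \<Rightarrow> ('n idx \<Rightarrow> int) \<Rightarrow> 'k"
  proof (cases "F \<subseteq> YZ")
    case True
    then show ?thesis using model_finite[OF E cF[OF that]] by blast
  qed (use c0[OF that] in auto)
  have "quot_iso csc (cocyc p) (cobd p) log.scl {y \<in> coch YZ (log.loc d) p. cdiff gix log.supp_idem YZ y = 0}
     (cdiff gix log.supp_idem YZ ` coch YZ (log.loc d) (p - 1))"
  proof (rule quot_iso_from_cech[where f = f])
    fix q and c :: "'n idx set \<Rightarrow> 'n \<Rightarrow> ('n idx \<Rightarrow> int) \<Rightarrow> 'k"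
    assume c: "c \<in> coch YZ (model E d) q"
    show "f c \<in> coch YZ (log.loc d) q"
      unfolding coch_def
    proof (intro CollectI allI)
      fix F
      show "if F \<subseteq> YZ \<and> int (card F) = q then f c F \<in> log.loc d F else f c F = 0"
      proof (cases "F \<subseteq> YZ \<and> int (card F) = q")
        case True
        then show ?thesis using psi_model_loc[OF E _ cF[OF c], of F] by (simp add: f_def)
      next
        case False
        have "f c F = 0" by (intro ext) (simp add: f_def c0[OF c False])
        then show ?thesis using False by auto
      qed
    qed
    show "f (cdiff gix cut YZ c) = cdiff gix log.supp_idem YZ (f c)"
    proof (intro ext)
      fix F w
      show "f (cdiff gix cut YZ c) F w = cdiff gix log.supp_idem YZ (f c) F w"
      proof (cases "F \<subseteq> YZ")
        case F: True
        have g: "prod gen F w = (0 :: ('n, 'k) mpoly fract) \<longleftrightarrow> Yv w \<in> F"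
          by (auto simp: prod_fun_apply gen_eq_0_iff)
        show ?thesis
        proof (cases "Yv w \<in> F")
          case True
          have "cdiff gix cut YZ c F w = (\<lambda>_. 0)"
            using F True by (simp add: cdiff_def fun_eq_iff prod_cut)
          then show ?thesis using F True by (simp add: f_def cdiff_def log.prod_supp_idem g)
        next
          case False
          have "cdiff gix cut YZ c F w = (\<lambda>\<beta>. \<Sum>v\<in>F. csign gix v F * c (F - {v}) w \<beta>)"
            using F False by (simp add: cdiff_def fun_eq_iff prod_cut sum_fun_apply csign_coeff)
          then have "f (cdiff gix cut YZ c) F w = (\<Sum>v\<in>F. csign gix v F * psi w (c (F - {v}) w))"
            unfolding f_def by (simp add: psi_sum fin[OF c] to_fract_mconst_csign)
          then show ?thesis using F False
            by (simp add: f_def cdiff_def log.prod_supp_idem g sum_fun_apply)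
               (simp add: csign_def)
        qed
      qed (simp add: f_def cdiff_def)
    qed
    show "f (csc a c) = log.scl a (f c)" for a
    proof (intro ext)
      fix F w
      have "csc a c F w = (\<lambda>\<beta>. a * c F w \<beta>)" by (simp add: csc_def const_coeff_def fun_eq_iff)
      then show "f (csc a c) F w = log.scl a (f c) F w"
        by (simp add: f_def log.scl_def const_fun_def psi_scale)
    qed
    have "c = 0" if f0: "f c = 0"
    proof (intro ext)
      fix F w \<beta>
      have "psi w (c F w) = 0" using f0 by (metis f_def zero_fun_apply)
      then show "c F w \<beta> = 0 F w \<beta>"
      proof (cases "F \<subseteq> YZ")
        case True
        show ?thesis
          using psi_inj[OF fin[OF c] _ \<open>psi w (c F w) = 0\<close>] modelD(1,5)[OF E cF[OF c True]] by simp
      qed (use c0[OF c] in simp)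
    qed
    moreover have "(0 :: 'n idx set \<Rightarrow> 'n \<Rightarrow> ('n idx \<Rightarrow> int) \<Rightarrow> 'k) \<in> coch YZ (model E d) (q - 1)"
      using L0 by (auto simp: coch_def)
    moreover have "f 0 = 0" by (intro ext) (simp add: f_def)
    moreover have "cdiff gix cut YZ 0 = (0 :: 'n idx set \<Rightarrow> 'n \<Rightarrow> ('n idx \<Rightarrow> int) \<Rightarrow> 'k)"
      using cdiff_minus[of gix cut YZ 0 0] by simp
    ultimately show "\<exists>k\<in>coch YZ (model E d) (q - 1). f k = 0 \<and> c = cdiff gix cut YZ k" if "f c = 0"
      using that by metis
  next
    fix q and c b :: "'n idx set \<Rightarrow> 'n \<Rightarrow> ('n idx \<Rightarrow> int) \<Rightarrow> 'k"
    assume cb: "c \<in> coch YZ (model E d) q" "b \<in> coch YZ (model E d) q"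
    show *: "f (c + b) = f c + f b"
      by (intro ext) (simp add: f_def psi_add fin[OF cb(1)] fin[OF cb(2)])
    show "f (c - b) = f c - f b"
    proof -
      have "f (c - b + b) = f (c - b) + f b"
        by (intro ext) (simp only: f_def plus_fun_apply psi_add[OF fin[OF coch_diff[OF cb]] fin[OF cb(2)]])
      then show ?thesis by (simp add: algebra_simps)
    qed
  next
    fix q y assume y: "y \<in> coch YZ (log.loc d) q"
    have "\<forall>F\<in>Pow YZ. \<exists>l\<in>model E d F. (\<lambda>w. psi w (l w)) = y F"
    proof
      fix F assume F: "F \<in> Pow YZ"
      have "if F \<subseteq> YZ \<and> int (card F) = q then y F \<in> log.loc d F else y F = 0"
        using y unfolding coch_def by blast
      then have "y F \<in> log.loc d F" using log.loc_zero by (auto split: if_splits)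
      then show "\<exists>l\<in>model E d F. (\<lambda>w. psi w (l w)) = y F" using loc_psi_model[OF E] F by blast
    qed
    then obtain l where l: "\<And>F. F \<subseteq> YZ \<Longrightarrow> l F \<in> model E d F" "\<And>F. F \<subseteq> YZ \<Longrightarrow> (\<lambda>w. psi w (l F w)) = y F"
      unfolding Bex_def bchoice_iff by blast
    define c where "c F = (if F \<subseteq> YZ \<and> int (card F) = q then l F else 0)" for F
    have "c \<in> coch YZ (model E d) q" using l(1) by (auto simp: coch_def c_def)
    moreover have "f c = y"
    proof
      fix F
      show "f c F = y F"
        using l(2)[of F] y by (auto simp: f_def c_def coch_def zero_fun_def)
    qed
    ultimately show "\<exists>x\<in>coch YZ (model E d) q. f x = y" by blast
  qed
  then show ?thesis unfolding log.cocycles_def log.coboundaries_def .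
qed

definition neg_cochains :: "int \<Rightarrow> ('n idx set \<Rightarrow> 'n \<Rightarrow> ('n idx \<Rightarrow> int) \<Rightarrow> 'k) set" where
  "neg_cochains q = {c \<in> coch YZ (model E d) q. \<forall>F w \<beta>. c F w \<beta> \<noteq> 0 \<longrightarrow> expo_neg \<beta>}"

text \<open>In an exponent with \<open>\<beta> j \<ge> 0\<close> (and \<open>j = Zv\<close> or \<open>\<beta> j > 0\<close>), inverting the generator \<open>j\<close>
  changes nothing, so that part of the complex is contractible.\<close>

lemma quot_iso_model_neg:
  "quot_iso csc (cocyc p) (cobd p) csc {y \<in> neg_cochains p. cdiff gix cut YZ y = 0}
     (cdiff gix cut YZ ` neg_cochains (p - 1))"
proof -
  define f where "f c = (\<lambda>F w \<beta>. if expo_neg \<beta> then c F w \<beta> else 0)"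
    for c :: "'n idx set \<Rightarrow> 'n \<Rightarrow> ('n idx \<Rightarrow> int) \<Rightarrow> 'k"
  \<comment> \<open>A partition of unity that depends on the exponent and selects its pivot, so that
    one homotopy contracts all exponents simultaneously. The condition
    \<open>i \<noteq> Yv w\<close> is what makes \<open>r i * cut i = r i\<close> true.\<close>
  define r :: "'n idx \<Rightarrow> 'n \<Rightarrow> ('n idx \<Rightarrow> int) \<Rightarrow> 'k"
    where "r i w \<beta> = (if \<not> expo_neg \<beta> \<and> i = expo_pivot \<beta> \<and> i \<noteq> Yv w then 1 else 0)" for i w \<beta>
  show ?thesis
  proof (rule quot_iso_from_cech[where f = f])
    fix q and c :: "'n idx set \<Rightarrow> 'n \<Rightarrow> ('n idx \<Rightarrow> int) \<Rightarrow> 'k"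
    assume c: "c \<in> coch YZ (model E d) q"
    have cF: "c F \<in> model E d F" if "F \<subseteq> YZ" for F
    proof -
      have "if F \<subseteq> YZ \<and> int (card F) = q then c F \<in> model E d F else c F = 0"
        using c unfolding coch_def by blast
      then show ?thesis using L0[OF that] by metis
    qed
    have c0: "c F = 0" if "\<not> (F \<subseteq> YZ \<and> int (card F) = q)" for F
      using that c unfolding coch_def by auto
    have "f c F \<in> model E d F" if F: "F \<subseteq> YZ" for F
    proof -
      have "{\<beta>. \<exists>w. f c F w \<beta> \<noteq> 0} \<subseteq> {\<beta>. \<exists>w. c F w \<beta> \<noteq> 0}" by (auto simp: f_def)
      then have fin: "finite {\<beta>. \<exists>w. f c F w \<beta> \<noteq> 0}"
        by (rule finite_subset) (use cF[OF F] in \<open>simp add: model_def\<close>)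
      have nz: "c F w \<beta> \<noteq> 0" if "f c F w \<beta> \<noteq> 0" for w \<beta> using that by (auto simp: f_def split: if_splits)
      show ?thesis unfolding model_def
      proof (intro CollectI conjI allI impI fin)
        fix u v \<beta> assume "{u, v} \<in> E" "Yv u \<notin> F" "Yv v \<notin> F" "\<beta> (Yv u) = 0" "\<beta> (Yv v) = (0::int)"
        then show "f c F u \<beta> = f c F v \<beta>"
          using model_edge[OF E cF[OF F], of u v \<beta>] by (simp add: f_def)
      qed (use nz modelD[OF E cF[OF F]] in blast)+
    qed
    moreover have "f c F = 0" if "\<not> (F \<subseteq> YZ \<and> int (card F) = q)" for F
      using c0[OF that] by (simp add: f_def fun_eq_iff)
    ultimately show "f c \<in> neg_cochains q"
      by (auto simp: neg_cochains_def coch_def f_def)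
    show "f (cdiff gix cut YZ c) = cdiff gix cut YZ (f c)"
      by (intro ext) (simp add: f_def cdiff_def sum_fun_apply)
    show "f (csc a c) = csc a (f c)" for a
      by (intro ext) (simp add: f_def csc_def)
    show "\<exists>k\<in>coch YZ (model E d) (q - 1). f k = 0 \<and> c = cdiff gix cut YZ k"
      if f0: "f c = 0" and d0: "cdiff gix cut YZ c = 0"
    proof (intro bexI conjI)
      let ?k = "htpy gix YZ r c"
      have neg0: "c F w \<beta> = 0" if "expo_neg \<beta>" for F w \<beta>
        using f0 that by (metis (mono_tags) f_def zero_fun_apply)
      show "f ?k = 0"
        by (intro ext) (simp add: f_def htpy_def sum_fun_apply r_def)
      have rid: "r i * cut i = r i" for i
        by (auto simp: r_def cut_def fun_eq_iff)
      have rsum: "(\<Sum>i\<in>YZ. r i) w \<beta> = (if \<not> expo_neg \<beta> \<and> expo_pivot \<beta> \<noteq> Yv w then 1 else 0)" for w \<beta>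
      proof -
        have "(\<Sum>i\<in>YZ. r i) w \<beta> = (\<Sum>i\<in>YZ. if i = expo_pivot \<beta> then
           (if \<not> expo_neg \<beta> \<and> expo_pivot \<beta> \<noteq> Yv w then 1 else 0) else 0)"
          unfolding sum_fun_apply by (intro sum.cong) (auto simp: r_def)
        then show ?thesis using expo_pivot_range[of \<beta>] by (subst (asm) sum.delta) auto
      qed
      show "c = cdiff gix cut YZ ?k"
      proof
        fix F
        show "c F = cdiff gix cut YZ ?k F"
        proof (cases "F \<subseteq> YZ")
          case F: True
          have "htpy gix YZ r (cdiff gix cut YZ c) F = 0"
            unfolding d0 by (simp add: htpy_def)
          then have eq: "cdiff gix cut YZ ?k F = prod cut F * (\<Sum>i\<in>YZ. r i) * c F"
            using cdiff_htpy[OF finU inj F, of r cut c, OF rid] by simp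
          show ?thesis
          proof (intro ext)
            fix w \<beta>
            show "c F w \<beta> = cdiff gix cut YZ ?k F w \<beta>"
            proof (cases "c F w \<beta> = 0")
              case nz: False
              have "\<not> expo_neg \<beta>" using neg0 nz by blast
              moreover have "Yv w \<notin> F" "\<beta> (Yv w) = 0" using modelD[OF E cF[OF F] nz] by auto
              \<comment> \<open>Such a pivot would have a positive exponent, but coefficients at w
                have exponent 0 at \<open>Yv w\<close>.\<close>
              moreover have "expo_pivot \<beta> \<noteq> Yv w" using expo_pivot_pos calculation by fastforce
              ultimately show ?thesis unfolding eq times_fun_apply by (simp add: prod_cut rsum)
            qed (simp add: eq)
          qed
        qed (use c0 in \<open>simp add: cdiff_def\<close>)
      qed
      have kF: "?k F \<in> model E d F" if F: "F \<subseteq> YZ" for F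
      proof -
        have "r i * c (insert i F) \<in> model E d F" if i: "i \<in> YZ - F" for i
        proof -
          have iF: "insert i F \<subseteq> YZ" using F i by auto
          note m = cF[OF iF]
          have "{\<beta>. \<exists>w. (r i * c (insert i F)) w \<beta> \<noteq> 0} \<subseteq> {\<beta>. \<exists>w. c (insert i F) w \<beta> \<noteq> 0}" by auto
          then have fin: "finite {\<beta>. \<exists>w. (r i * c (insert i F)) w \<beta> \<noteq> 0}"
            by (rule finite_subset) (use m in \<open>simp add: model_def\<close>)
          have nz: "c (insert i F) w \<beta> \<noteq> 0 \<and> \<not> expo_neg \<beta> \<and> i = expo_pivot \<beta>"
            if "(r i * c (insert i F)) w \<beta> \<noteq> 0" for w \<beta>
            using that by (auto simp: r_def split: if_splits)
          show ?thesis unfolding model_def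
          proof (intro CollectI conjI allI impI fin)
            fix w \<beta> assume n: "(r i * c (insert i F)) w \<beta> \<noteq> 0"
            note n' = nz[OF n]
            show "\<beta> (Xv v) = 0" for v using modelD(1)[OF E m] n' by blast
            show "sum \<beta> UNIV = d" using modelD(2)[OF E m] n' by blast
            show "Yv w \<notin> F" using modelD(4)[OF E m] n' by blast
            show "\<beta> (Yv w) = 0" using modelD(5)[OF E m] n' by blast
            \<comment> \<open>Only j = i is new compared with \<open>insert i F\<close>, and i is
              the pivot, whose exponent is nonnegative.\<close>
            show "0 \<le> \<beta> j" if "j \<notin> F" for j
              using modelD(3)[OF E m conjunct1[OF n'], of j] expo_pivot_nonneg[of \<beta>] n' that
              by (cases "j = i") auto
          next
            fix u v \<beta> assume uv: "{u, v} \<in> E" "Yv u \<notin> F" "Yv v \<notin> F" "\<beta> (Yv u) = 0" "\<beta> (Yv v) = (0::int)"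
            show "(r i * c (insert i F)) u \<beta> = (r i * c (insert i F)) v \<beta>"
            proof (cases "i = Yv u \<or> i = Yv v")
              case True
              then have "r i u \<beta> = 0" "r i v \<beta> = 0"
                using expo_pivot_pos[of \<beta> u] expo_pivot_pos[of \<beta> v] uv(4,5) by (auto simp: r_def)
              then show ?thesis by simp
            next
              case False
              then have "c (insert i F) u \<beta> = c (insert i F) v \<beta>" using uv by (intro model_edge[OF E m]) auto
              moreover have "r i u \<beta> = r i v \<beta>" using False by (simp add: r_def)
              ultimately show ?thesis by simp
            qed
          qed
        qed
        then show ?thesis using F by (auto simp: htpy_def intro!: Lsum Lsign)
      qed
      show "?k \<in> coch YZ (model E d) (q - 1)"
        unfolding coch_def
      proof (intro CollectI allI)
        fix F
        have "c (insert i F) = 0" if "i \<in> YZ - F" "F \<subseteq> YZ" "int (card F) \<noteq> q - 1" for i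
        proof (rule c0)
          have "finite F" by simp
          then show "\<not> (insert i F \<subseteq> YZ \<and> int (card (insert i F)) = q)" using that by simp
        qed
        then have "?k F = 0" if "\<not> (F \<subseteq> YZ \<and> int (card F) = q - 1)"
          using that by (auto simp: htpy_def)
        then show "if F \<subseteq> YZ \<and> int (card F) = q - 1 then ?k F \<in> model E d F else ?k F = 0"
          using kF by auto
      qed
    qed
  next
    fix q y assume y: "y \<in> neg_cochains q"
    then have "f y = y" by (auto simp: f_def neg_cochains_def fun_eq_iff)
    then show "\<exists>x\<in>coch YZ (model E d) q. f x = y" using y by (auto simp: neg_cochains_def)
  qed (auto simp: f_def fun_eq_iff)
qed

end

section \<open>Links in the graph poset\<close>

lemma component_of_refl: "v \<in> component_of E T v"
  by (simp add: component_of_def)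

lemma component_of_sym: "w \<in> component_of E T v \<Longrightarrow> v \<in> component_of E T w"
proof -
  have "sym {(a, b). {a, b} \<in> E \<and> a \<notin> T \<and> b \<notin> T}"
    by (auto simp: sym_def insert_commute)
  from symD[OF sym_rtrancl[OF this]]
  show "w \<in> component_of E T v \<Longrightarrow> v \<in> component_of E T w"
    unfolding component_of_def by blast
qed

lemma component_of_eq: "w \<in> component_of E T v \<Longrightarrow> component_of E T w = component_of E T v"
  using component_of_sym[of w E T v] unfolding component_of_def by (auto intro: rtrancl_trans)

lemma component_of_mono: "S \<subseteq> T \<Longrightarrow> component_of E T v \<subseteq> component_of E S v"
proof -
  assume "S \<subseteq> T"
  then have "{(a, b). {a, b} \<in> E \<and> a \<notin> T \<and> b \<notin> T} \<subseteq> {(a, b). {a, b} \<in> E \<and> a \<notin> S \<and> b \<notin> S}" by auto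
  then show ?thesis unfolding component_of_def using rtrancl_mono by blast
qed

lemma component_of_disjoint:
  assumes "v \<notin> T" "w \<in> component_of E T v" shows "w \<notin> T"
proof -
  have "(v, w) \<in> {(a, b). {a, b} \<in> E \<and> a \<notin> T \<and> b \<notin> T}\<^sup>*" using assms by (simp add: component_of_def)
  then show ?thesis using assms(1) by (induction rule: rtrancl_induct) auto
qed

lemma component_of_constant:
  assumes "w \<in> component_of E T v" "\<And>a b. {a, b} \<in> E \<Longrightarrow> a \<notin> T \<Longrightarrow> b \<notin> T \<Longrightarrow> f a = f b"
  shows "f w = f v"
proof -
  have "(v, w) \<in> {(a, b). {a, b} \<in> E \<and> a \<notin> T \<and> b \<notin> T}\<^sup>*" using assms by (simp add: component_of_def)
  then show ?thesis
  proof (induction rule: rtrancl_induct)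
    case (step y z)
    then show ?case using assms(2)[of y z] by simp
  qed simp
qed

text \<open>An element (W, T) of the poset is determined by T and any one vertex of W; orders and
  facets are computed in this parametrisation.\<close>

definition cell :: "'n set set \<Rightarrow> 'n set \<Rightarrow> 'n \<Rightarrow> 'n set \<times> 'n set" where
  "cell E T w = (component_of E T w, T)"

lemma snd_cell [simp]: "snd (cell E T w) = T" and fst_cell: "fst (cell E T w) = component_of E T w"
  by (simp_all add: cell_def)

lemma graph_poset_iff: "\<tau> \<in> graph_poset E \<longleftrightarrow> (\<exists>w. w \<notin> snd \<tau> \<and> \<tau> = cell E (snd \<tau>) w)"
  by (cases \<tau>) (auto simp: graph_poset_def cell_def)

lemma cell_in_graph_poset: "w \<notin> T \<Longrightarrow> cell E T w \<in> graph_poset E"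
  by (auto simp: graph_poset_iff)

lemma cell_eq_iff_mem: "cell E T w = cell E T v \<longleftrightarrow> w \<in> component_of E T v"
  using component_of_eq[of w E T v] component_of_refl[of w E T] by (auto simp: cell_def)

definition rep :: "'n set \<times> 'n set \<Rightarrow> 'n" where
  "rep \<tau> = (SOME w. w \<in> fst \<tau>)"

lemma rep:
  assumes "\<tau> \<in> graph_poset E"
  shows "rep \<tau> \<in> fst \<tau>" "rep \<tau> \<notin> snd \<tau>" "cell E (snd \<tau>) (rep \<tau>) = \<tau>"
proof -
  obtain w where w: "w \<notin> snd \<tau>" "\<tau> = cell E (snd \<tau>) w"
    using iffD1[OF graph_poset_iff assms] by (elim exE conjE)
  have fst: "fst \<tau> = component_of E (snd \<tau>) w" using arg_cong[OF w(2), of fst] unfolding fst_cell .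
  have "w \<in> fst \<tau>" unfolding fst by (rule component_of_refl)
  then show r: "rep \<tau> \<in> fst \<tau>" unfolding rep_def by (rule someI)
  then have r': "rep \<tau> \<in> component_of E (snd \<tau>) w" by (simp only: fst)
  show "rep \<tau> \<notin> snd \<tau>" using component_of_disjoint[OF w(1) r'] .
  have "cell E (snd \<tau>) (rep \<tau>) = cell E (snd \<tau>) w" using r' by (simp only: cell_eq_iff_mem)
  also note w(2)[symmetric]
  finally show "cell E (snd \<tau>) (rep \<tau>) = \<tau>" .
qed

lemma mem_fst_cell:
  assumes "\<tau> \<in> graph_poset E" "w \<in> fst \<tau>"
  shows "cell E (snd \<tau>) w = \<tau>" "w \<notin> snd \<tau>"
proof -
  note r = rep[OF assms(1)]
  have "fst \<tau> = component_of E (snd \<tau>) (rep \<tau>)" using arg_cong[OF r(3), of fst] unfolding fst_cell by (rule sym)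
  then have w: "w \<in> component_of E (snd \<tau>) (rep \<tau>)" using assms(2) by simp
  then have "cell E (snd \<tau>) w = cell E (snd \<tau>) (rep \<tau>)" by (simp only: cell_eq_iff_mem)
  with r(3) show "cell E (snd \<tau>) w = \<tau>" by (rule trans[rotated])
  show "w \<notin> snd \<tau>" by (rule component_of_disjoint[OF r(2) w])
qed

text \<open>With a vertex w of W fixed, the elements below (W, T) are the cells of w for the subsets
  of T in place of T. This is the reason why intervals are Boolean.\<close>

lemma le_cell_iff:
  assumes "\<sigma> \<in> graph_poset E" "w \<notin> T"
  shows "graph_poset_le \<sigma> (cell E T w) \<longleftrightarrow> snd \<sigma> \<subseteq> T \<and> \<sigma> = cell E (snd \<sigma>) w"
proof
  assume le: "graph_poset_le \<sigma> (cell E T w)"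
  then have "w \<in> fst \<sigma>" "snd \<sigma> \<subseteq> T"
    using component_of_refl[of w E T] by (auto simp: graph_poset_le_def cell_def)
  then show "snd \<sigma> \<subseteq> T \<and> \<sigma> = cell E (snd \<sigma>) w"
    using mem_fst_cell(1)[OF assms(1), of w] by simp
next
  assume *: "snd \<sigma> \<subseteq> T \<and> \<sigma> = cell E (snd \<sigma>) w"
  then have "fst \<sigma> = component_of E (snd \<sigma>) w" using arg_cong[of \<sigma> "cell E (snd \<sigma>) w" fst] unfolding fst_cell by blast
  then show "graph_poset_le \<sigma> (cell E T w)"
    using * component_of_mono[of "snd \<sigma>" T E w] by (simp add: graph_poset_le_def fst_cell)
qed

context
  fixes E :: "'n::finite set set" and \<sigma> :: "'n set \<times> 'n set"
  assumes \<sigma>: "\<sigma> \<in> graph_poset E"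
begin

abbreviation lk :: "('n set \<times> 'n set) set" where
  "lk \<equiv> poset_link graph_poset_le (graph_poset E) \<sigma>"

lemma lk_iff: "\<tau> \<in> lk \<longleftrightarrow> \<tau> \<in> graph_poset E \<and> snd \<sigma> \<subseteq> snd \<tau> \<and> \<sigma> = cell E (snd \<sigma>) (rep \<tau>)"
  using le_cell_iff[OF \<sigma>, of "rep \<tau>" "snd \<tau>"] rep[of \<tau> E] unfolding poset_link_def by auto

lemma cell_in_lk_iff: "w \<notin> T \<Longrightarrow> cell E T w \<in> lk \<longleftrightarrow> snd \<sigma> \<subseteq> T \<and> \<sigma> = cell E (snd \<sigma>) w"
  using le_cell_iff[OF \<sigma>, of w T] cell_in_graph_poset[of w T E] by (simp add: poset_link_def)

lemma poset_bot_lk: "poset_bot graph_poset_le lk = \<sigma>"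
  unfolding poset_bot_def
proof (rule the_equality)
  show "\<sigma> \<in> lk \<and> (\<forall>x\<in>lk. graph_poset_le \<sigma> x)"
    using \<sigma> by (auto simp: poset_link_def graph_poset_le_def)
next
  fix b assume "b \<in> lk \<and> (\<forall>x\<in>lk. graph_poset_le b x)"
  moreover have "\<sigma> \<in> lk" using \<sigma> by (auto simp: poset_link_def graph_poset_le_def)
  ultimately have "graph_poset_le b \<sigma>" by blast
  moreover have "graph_poset_le \<sigma> b" using \<open>b \<in> lk \<and> _\<close> by (simp add: poset_link_def)
  ultimately show "b = \<sigma>" by (auto simp: graph_poset_le_def prod_eq_iff)
qed

lemma le_in_lk:
  assumes "\<tau> \<in> lk" "w \<in> fst \<tau>" "x \<in> lk"
  shows "graph_poset_le x \<tau> \<longleftrightarrow> snd x \<subseteq> snd \<tau> \<and> x = cell E (snd x) w"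
proof -
  have \<tau>: "\<tau> \<in> graph_poset E" using assms by (simp add: lk_iff)
  show ?thesis using le_cell_iff[of x E w "snd \<tau>"] mem_fst_cell[OF \<tau> assms(2)] assms(3) by (simp add: lk_iff)
qed

lemma lk_cell:
  assumes "\<tau> \<in> lk" "w \<in> fst \<tau>"
  shows "\<tau> = cell E (snd \<tau>) w" "w \<notin> snd \<tau>" "\<sigma> = cell E (snd \<sigma>) w" "snd \<sigma> \<subseteq> snd \<tau>"
proof -
  have \<tau>: "\<tau> \<in> graph_poset E" using assms by (simp add: lk_iff)
  show *: "\<tau> = cell E (snd \<tau>) w" "w \<notin> snd \<tau>"
    using mem_fst_cell[OF \<tau> assms(2)] by simp_all
  show "\<sigma> = cell E (snd \<sigma>) w" "snd \<sigma> \<subseteq> snd \<tau>" using cell_in_lk_iff[OF *(2)] * assms(1) by auto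
qed

lemma atoms_below_lk:
  assumes \<tau>: "\<tau> \<in> lk" and w: "w \<in> fst \<tau>"
  shows "atoms_below graph_poset_le lk \<tau> = (\<lambda>v. cell E (insert v (snd \<sigma>)) w) ` (snd \<tau> - snd \<sigma>)"
proof (intro set_eqI iffI)
  note c = lk_cell[OF \<tau> w]
  fix a assume "a \<in> atoms_below graph_poset_le lk \<tau>"
  then have a: "a \<in> lk" "a \<noteq> \<sigma>" "\<And>x. x \<in> lk \<Longrightarrow> graph_poset_le x a \<Longrightarrow> x = \<sigma> \<or> x = a" "graph_poset_le a \<tau>"
    by (auto simp: atoms_below_def poset_atoms_def poset_bot_lk)
  then have a': "snd a \<subseteq> snd \<tau>" "a = cell E (snd a) w" "snd \<sigma> \<subseteq> snd a"
    using le_in_lk[OF \<tau> w a(1)] by (auto simp: lk_iff)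
  then have "snd a \<noteq> snd \<sigma>" using a(2) c(3) by auto
  then obtain v where v: "v \<in> snd a" "v \<notin> snd \<sigma>" using a'(3) by blast
  let ?x = "cell E (insert v (snd \<sigma>)) w"
  have "w \<notin> insert v (snd \<sigma>)" using c(2,4) v a'(1) by auto
  then have "?x \<in> lk" using cell_in_lk_iff c(3) by blast
  moreover have "graph_poset_le ?x a"
    using le_cell_iff[of ?x E w "snd a"] cell_in_graph_poset[OF \<open>w \<notin> insert v (snd \<sigma>)\<close>, of E] a' v c(2)
    by (auto simp: subset_iff)
  ultimately have "?x = \<sigma> \<or> ?x = a" using a(3) by blast
  moreover have "?x \<noteq> \<sigma>" using v by (metis insertI1 snd_cell)
  ultimately show "a \<in> (\<lambda>v. cell E (insert v (snd \<sigma>)) w) ` (snd \<tau> - snd \<sigma>)"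
    using v a'(1) by auto
next
  note c = lk_cell[OF \<tau> w]
  fix a assume "a \<in> (\<lambda>v. cell E (insert v (snd \<sigma>)) w) ` (snd \<tau> - snd \<sigma>)"
  then obtain v where v: "v \<in> snd \<tau>" "v \<notin> snd \<sigma>" and a: "a = cell E (insert v (snd \<sigma>)) w" by blast
  have w': "w \<notin> insert v (snd \<sigma>)" using c(2,4) v by auto
  have alk: "a \<in> lk" unfolding a using w' cell_in_lk_iff c(3) by blast
  moreover have "a \<noteq> \<sigma>" using v unfolding a by (metis insertI1 snd_cell)
  moreover have "graph_poset_le a \<tau>" using le_in_lk[OF \<tau> w alk] v c(4) by (auto simp: a)
  moreover have "x = \<sigma> \<or> x = a" if x: "x \<in> lk" "graph_poset_le x a" for x
  proof -
    have wa: "w \<in> fst a" unfolding a fst_cell by (rule component_of_refl)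
    have "snd x \<subseteq> insert v (snd \<sigma>)" "x = cell E (snd x) w"
      using le_in_lk[OF alk wa x(1)] x(2) by (auto simp: a)
    moreover have "snd \<sigma> \<subseteq> snd x" using x(1) by (simp add: lk_iff)
    ultimately have "snd x = snd \<sigma> \<or> snd x = insert v (snd \<sigma>)" by auto
    then show ?thesis using \<open>x = cell E (snd x) w\<close> c(3) a by auto
  qed
  ultimately show "a \<in> atoms_below graph_poset_le lk \<tau>"
    by (auto simp: atoms_below_def poset_atoms_def poset_bot_lk)
qed

lemma inj_atom: "inj_on (\<lambda>v. cell E (insert v S) w) (A - S)"
  by (rule inj_onI) (auto simp: cell_def)

lemma poset_rank_lk:
  assumes "\<tau> \<in> lk" shows "poset_rank graph_poset_le lk \<tau> + card (snd \<sigma>) = card (snd \<tau>)"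
proof -
  have "rep \<tau> \<in> fst \<tau>" using assms rep(1) lk_iff by blast
  then have "poset_rank graph_poset_le lk \<tau> = card (snd \<tau> - snd \<sigma>)"
    unfolding poset_rank_def using atoms_below_lk[OF assms] card_image[OF inj_atom] by simp
  moreover have "snd \<sigma> \<subseteq> snd \<tau>" using assms by (simp add: lk_iff)
  ultimately show ?thesis by (simp add: card_Diff_subset card_mono)
qed

text \<open>The position depends on w and not only on v: deleting v may split the component of
  \<sigma>, and each piece is a different atom.\<close>

definition atom_pos :: "'n \<Rightarrow> 'n \<Rightarrow> nat" where
  "atom_pos w v = atom_index graph_poset_le lk (cell E (insert v (snd \<sigma>)) w)"

lemma inj_atom_pos:
  assumes "\<tau> \<in> lk" "w \<in> fst \<tau>" shows "inj_on (atom_pos w) (snd \<tau> - snd \<sigma>)"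
proof -
  have "\<exists>f :: 'n set \<times> 'n set \<Rightarrow> nat. inj_on f (poset_atoms graph_poset_le lk)"
    using finite_imp_inj_to_nat_seg[of "poset_atoms graph_poset_le lk"] by auto
  then have inj: "inj_on (atom_index graph_poset_le lk) (poset_atoms graph_poset_le lk)"
    unfolding atom_index_def by (rule someI_ex)
  have "(\<lambda>v. cell E (insert v (snd \<sigma>)) w) ` (snd \<tau> - snd \<sigma>) \<subseteq> poset_atoms graph_poset_le lk"
    using atoms_below_lk[OF assms] unfolding atoms_below_def by blast
  then have "inj_on (atom_index graph_poset_le lk \<circ> (\<lambda>v. cell E (insert v (snd \<sigma>)) w)) (snd \<tau> - snd \<sigma>)"
    by (intro comp_inj_on inj_atom inj_on_subset[OF inj])
  moreover have "atom_pos w = atom_index graph_poset_le lk \<circ> (\<lambda>v. cell E (insert v (snd \<sigma>)) w)"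
    by (simp add: fun_eq_iff atom_pos_def)
  ultimately show ?thesis by simp
qed

text \<open>Exactly one atom of \<tau> is missing from the facet, and the atoms of both are images
  of vertex sets under the same injection, so the sign can be counted on vertices.\<close>

lemma incidence_lk:
  assumes \<tau>: "\<tau> \<in> lk" and w: "w \<in> fst \<tau>" and v: "v \<in> snd \<tau> - snd \<sigma>"
  shows "incidence graph_poset_le lk (cell E (snd \<tau> - {v}) w) \<tau> =
    (- 1) ^ card {b \<in> snd \<tau> - snd \<sigma>. atom_pos w b < atom_pos w v}"
proof -
  note c = lk_cell[OF \<tau> w]
  let ?\<rho> = "cell E (snd \<tau> - {v}) w"
  have \<rho>: "?\<rho> \<in> lk" using cell_in_lk_iff[of w "snd \<tau> - {v}"] c v by auto
  have w\<rho>: "w \<in> fst ?\<rho>" unfolding fst_cell by (rule component_of_refl)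
  let ?a = "\<lambda>v. cell E (insert v (snd \<sigma>)) w"
  have "atoms_below graph_poset_le lk \<tau> - atoms_below graph_poset_le lk ?\<rho> = ?a ` {v}"
  proof -
    have "?a ` (snd \<tau> - snd \<sigma>) - ?a ` (snd \<tau> - {v} - snd \<sigma>) =
        ?a ` ((snd \<tau> - snd \<sigma>) - (snd \<tau> - {v} - snd \<sigma>))"
      by (rule inj_on_image_set_diff[OF inj_atom[of "snd \<sigma>" w "snd \<tau>"], symmetric]) auto
    also have "(snd \<tau> - snd \<sigma>) - (snd \<tau> - {v} - snd \<sigma>) = {v}" using v by auto
    finally show ?thesis using atoms_below_lk[OF \<tau> w] atoms_below_lk[OF \<rho> w\<rho>] by simp
  qed
  then have "incidence graph_poset_le lk ?\<rho> \<tau> =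
    (- 1) ^ card {b \<in> ?a ` (snd \<tau> - snd \<sigma>). atom_index graph_poset_le lk b < atom_pos w v}"
    unfolding incidence_def using atoms_below_lk[OF \<tau> w] by (simp add: atom_pos_def)
  also have "{b \<in> ?a ` (snd \<tau> - snd \<sigma>). atom_index graph_poset_le lk b < atom_pos w v} =
    ?a ` {b \<in> snd \<tau> - snd \<sigma>. atom_pos w b < atom_pos w v}"
    by (auto simp: atom_pos_def)
  also have "card \<dots> = card {b \<in> snd \<tau> - snd \<sigma>. atom_pos w b < atom_pos w v}"
    by (rule card_image, rule inj_on_subset[OF inj_atom[of "snd \<sigma>" w "snd \<tau>"]]) auto
  finally show ?thesis .
qed

text \<open>Needed because \<open>rep\<close> may pick different vertices for a cell and for its
  facets.\<close>

lemma atom_pos_cong: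
  assumes "\<tau> \<in> lk" "w \<in> fst \<tau>" "w' \<in> fst \<tau>" "v \<in> snd \<tau> - snd \<sigma>"
  shows "atom_pos w v = atom_pos w' v"
proof -
  have "cell E (snd \<tau>) w = cell E (snd \<tau>) w'"
    using lk_cell(1)[OF assms(1,2)] lk_cell(1)[OF assms(1,3)] by (rule trans[OF sym])
  then have mem: "w \<in> component_of E (snd \<tau>) w'" by (simp only: cell_eq_iff_mem)
  have sub: "insert v (snd \<sigma>) \<subseteq> snd \<tau>" using assms(4) lk_cell(4)[OF assms(1,2)] by blast
  have "w \<in> component_of E (insert v (snd \<sigma>)) w'" by (rule subsetD[OF component_of_mono[OF sub] mem])
  then have "cell E (insert v (snd \<sigma>)) w = cell E (insert v (snd \<sigma>)) w'" by (simp only: cell_eq_iff_mem)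
  then show ?thesis by (simp add: atom_pos_def)
qed

end

section \<open>Comparison of orientations\<close>

text \<open>For h injective on T - N, this is the number of inversions of the list of T that has T -
  N first, in the order of h, followed by N in increasing order.\<close>

definition inversions :: "'n::linorder set \<Rightarrow> ('n \<Rightarrow> nat) \<Rightarrow> 'n set \<Rightarrow> nat" where
  "inversions N h T = card {(a, b). a \<in> N \<and> b \<in> T - N \<and> a < b} +
     card {(a, b). a \<in> T - N \<and> b \<in> T - N \<and> a < b \<and> h b < h a}"

text \<open>Deleting v removes the inversions that involve v. Their number has the parity of the sum
  of the positions of v in the increasing list of T and in the list described by
  \<open>inversions\<close>.\<close>

lemma even_inversions:
  fixes T :: "'n::{finite,linorder} set"
  assumes "N \<subseteq> T" "v \<in> T - N" "inj_on h (T - N)"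
  shows "even (inversions N h T + inversions N h (T - {v}) + card {b \<in> T. b < v} +
    card {b \<in> T - N. h b < h v})"
proof -
  let ?M = "T - {v} - N"
  have 1: "card {(a, b). a \<in> N \<and> b \<in> T - N \<and> a < b} =
    card {(a, b). a \<in> N \<and> b \<in> ?M \<and> a < b} + card {a \<in> N. a < v}"
  proof -
    have eq: "{(a, b). a \<in> N \<and> b \<in> T - N \<and> a < b} =
      {(a, b). a \<in> N \<and> b \<in> ?M \<and> a < b} \<union> (\<lambda>a. (a, v)) ` {a \<in> N. a < v}"
      using assms(2) by auto
    have "card {(a, b). a \<in> N \<and> b \<in> T - N \<and> a < b} = card {(a, b). a \<in> N \<and> b \<in> ?M \<and> a < b} + card ((\<lambda>a. (a, v)) ` {a \<in> N. a < v})"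
      unfolding eq by (rule card_Un_disjoint) auto
    also have "card ((\<lambda>a. (a, v)) ` {a \<in> N. a < v}) = card {a \<in> N. a < v}"
      by (rule card_image) (simp add: inj_on_def)
    finally show ?thesis .
  qed
  have 2: "card {(a, b). a \<in> T - N \<and> b \<in> T - N \<and> a < b \<and> h b < h a} =
    card {(a, b). a \<in> ?M \<and> b \<in> ?M \<and> a < b \<and> h b < h a} +
    (card {b \<in> ?M. b < v \<and> h v < h b} + card {b \<in> ?M. v < b \<and> h b < h v})"
  proof -
    have eq: "{(a, b). a \<in> T - N \<and> b \<in> T - N \<and> a < b \<and> h b < h a} =
      {(a, b). a \<in> ?M \<and> b \<in> ?M \<and> a < b \<and> h b < h a} \<union>
      ((\<lambda>a. (a, v)) ` {b \<in> ?M. b < v \<and> h v < h b} \<union> (\<lambda>b. (v, b)) ` {b \<in> ?M. v < b \<and> h b < h v})"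
      using assms(2) by auto
    have "card {(a, b). a \<in> T - N \<and> b \<in> T - N \<and> a < b \<and> h b < h a} = card {(a, b). a \<in> ?M \<and> b \<in> ?M \<and> a < b \<and> h b < h a} +
      card ((\<lambda>a. (a, v)) ` {b \<in> ?M. b < v \<and> h v < h b} \<union> (\<lambda>b. (v, b)) ` {b \<in> ?M. v < b \<and> h b < h v})"
      unfolding eq by (rule card_Un_disjoint) auto
    also have "card ((\<lambda>a. (a, v)) ` {b \<in> ?M. b < v \<and> h v < h b} \<union> (\<lambda>b. (v, b)) ` {b \<in> ?M. v < b \<and> h b < h v}) =
      card ((\<lambda>a. (a, v)) ` {b \<in> ?M. b < v \<and> h v < h b}) + card ((\<lambda>b. (v, b)) ` {b \<in> ?M. v < b \<and> h b < h v})"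
      by (rule card_Un_disjoint) auto
    also have "card ((\<lambda>a. (a, v)) ` {b \<in> ?M. b < v \<and> h v < h b}) = card {b \<in> ?M. b < v \<and> h v < h b}"
      by (rule card_image) (simp add: inj_on_def)
    also have "card ((\<lambda>b. (v, b)) ` {b \<in> ?M. v < b \<and> h b < h v}) = card {b \<in> ?M. v < b \<and> h b < h v}"
      by (rule card_image) (simp add: inj_on_def)
    finally show ?thesis .
  qed
  have 3: "card {b \<in> T. b < v} = card {a \<in> N. a < v} + (card {b \<in> ?M. b < v \<and> h b < h v} + card {b \<in> ?M. b < v \<and> h v < h b})"
  proof -
    have ne: "h b < h v \<or> h v < h b" if "b \<in> ?M" for b
    proof -
      have "h b \<noteq> h v" using inj_onD[OF assms(3), of b v] that assms(2) by auto
      then show ?thesis by (simp add: neq_iff)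
    qed
    have eq: "{b \<in> T. b < v} = {a \<in> N. a < v} \<union> ({b \<in> ?M. b < v \<and> h b < h v} \<union> {b \<in> ?M. b < v \<and> h v < h b})"
      using assms(1) ne by auto
    have "card {b \<in> T. b < v} = card {a \<in> N. a < v} + card ({b \<in> ?M. b < v \<and> h b < h v} \<union> {b \<in> ?M. b < v \<and> h v < h b})"
      unfolding eq by (rule card_Un_disjoint) auto
    also have "card ({b \<in> ?M. b < v \<and> h b < h v} \<union> {b \<in> ?M. b < v \<and> h v < h b}) =
      card {b \<in> ?M. b < v \<and> h b < h v} + card {b \<in> ?M. b < v \<and> h v < h b}"
      by (rule card_Un_disjoint) auto
    finally show ?thesis .
  qed
  have 4: "card {b \<in> T - N. h b < h v} = card {b \<in> ?M. b < v \<and> h b < h v} + card {b \<in> ?M. v < b \<and> h b < h v}"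
  proof -
    have eq: "{b \<in> T - N. h b < h v} = {b \<in> ?M. b < v \<and> h b < h v} \<union> {b \<in> ?M. v < b \<and> h b < h v}"
    proof -
      have "b < v \<or> v < b" if "h b < h v" for b using that by (cases "b = v") auto
      then show ?thesis by auto
    qed
    show ?thesis unfolding eq by (rule card_Un_disjoint) auto
  qed
  show ?thesis unfolding inversions_def 1 2 3 4 by presburger
qed

section \<open>The negative part as a sum of cochain complexes of links\<close>

definition expo_supp :: "('n idx \<Rightarrow> int) \<Rightarrow> 'n set" where
  "expo_supp \<beta> = {v. \<beta> (Yv v) < 0}"

definition neg_expos :: "int \<Rightarrow> ('n::finite idx \<Rightarrow> int) set" where
  "neg_expos d = {\<beta>. (\<forall>v. \<beta> (Xv v) = 0) \<and> expo_neg \<beta> \<and> sum \<beta> UNIV = d}"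

text \<open>The only index sets that matter for negative exponents, since a negative entry at z
  forces \<open>Zv\<close> into the set.\<close>

definition face :: "'n set \<Rightarrow> 'n idx set" where
  "face T = insert Zv (Yv ` T)"

text \<open>Graded by the Cech degree \<open>card (face T)\<close> and not by dimension.\<close>

definition cells :: "'n::finite set set \<Rightarrow> 'n set \<times> 'n set \<Rightarrow> int \<Rightarrow> ('n set \<times> 'n set) set" where
  "cells E \<sigma> q = {\<tau> \<in> lk E \<sigma>. int (card (snd \<tau>)) + 1 = q}"

definition link_matrix ::
  "'n::finite set set \<Rightarrow> 'n set \<times> 'n set \<Rightarrow> 'n set \<times> 'n set \<Rightarrow> 'n set \<times> 'n set \<Rightarrow> 'k::field" where
  "link_matrix E \<sigma> \<rho> \<tau> = (if graph_poset_le \<rho> \<tau> then incidence graph_poset_le (lk E \<sigma>) \<rho> \<tau> else 0)"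

definition neg_index :: "'n::finite set set \<Rightarrow> int \<Rightarrow> (('n idx \<Rightarrow> int) \<times> ('n set \<times> 'n set)) set" where
  "neg_index E d = {(\<beta>, \<sigma>). \<beta> \<in> neg_expos d \<and> \<sigma> \<in> graph_poset E \<and> snd \<sigma> = expo_supp \<beta>}"

text \<open>The change of sign between the Cech orientation, which uses the order of all deleted
  vertices, and the orientation of the cell by the arbitrary order of its atoms.\<close>

definition orient :: "'n::{finite,linorder} set set \<Rightarrow> 'n set \<times> 'n set \<Rightarrow> 'n set \<times> 'n set \<Rightarrow> 'k::field" where
  "orient E \<sigma> \<tau> = (- 1) ^ inversions (snd \<sigma>) (atom_pos E \<sigma> (rep \<tau>)) (snd \<tau>)"

lemma face_YZ: "face T \<subseteq> insert Zv (range Yv)"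
  by (auto simp: face_def)

lemma card_face: "card (face (T :: 'n::finite set)) = card T + 1"
proof -
  have "Zv \<notin> Yv ` T" by auto
  then show ?thesis by (simp add: face_def card_image inj_on_def)
qed

lemma mem_face [simp]: "Yv v \<in> face T \<longleftrightarrow> v \<in> T" "Zv \<in> face T"
  by (auto simp: face_def)

lemma face_vimage: "F \<subseteq> insert Zv (range Yv) \<Longrightarrow> Zv \<in> F \<Longrightarrow> F = face (Yv -` F)"
  by (auto simp: face_def)

lemma face_remove: "face T - {Yv v} = face (T - {v})"
  by (auto simp: face_def)

lemma csign_face: "csign gix (Yv v) (face T) = (- 1) ^ card {b \<in> T. b < v}"
proof -
  have "{u \<in> face T. gix u < gix (Yv v)} = Yv ` {b \<in> T. b < v}"
    using vpos_less[of v] by (auto simp: face_def gix_def vpos_less_iff)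
  then show ?thesis by (simp add: csign_def card_image inj_on_def)
qed

lemma inversions_cong:
  assumes "\<And>v. v \<in> T - N \<Longrightarrow> h v = h' v" shows "inversions N h T = inversions N h' T"
proof -
  have "{(a, b). a \<in> T - N \<and> b \<in> T - N \<and> a < b \<and> h b < h a} =
    {(a, b). a \<in> T - N \<and> b \<in> T - N \<and> a < b \<and> h' b < h' a}"
    using assms by auto
  then show ?thesis by (simp add: inversions_def)
qed

lemma neg_expos_nonpos: "\<beta> \<in> neg_expos d \<Longrightarrow> \<beta> j \<le> 0"
  by (cases j) (auto simp: neg_expos_def expo_neg_def)

lemma finite_neg_expos: "finite (neg_expos d :: ('n::finite idx \<Rightarrow> int) set)"
proof (rule finite_subset)
  show "(neg_expos d :: ('n idx \<Rightarrow> int) set) \<subseteq> PiE UNIV (\<lambda>_. {d..0})"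
  proof
    fix \<beta> :: "'n idx \<Rightarrow> int" assume \<beta>: "\<beta> \<in> neg_expos d"
    have "d \<le> \<beta> j" for j
    proof -
      have "- \<beta> j \<le> (\<Sum>j\<in>UNIV. - \<beta> j)"
        by (rule member_le_sum) (use neg_expos_nonpos[OF \<beta>] in auto)
      also have "\<dots> = - d" using \<beta> by (simp add: neg_expos_def sum_negf)
      finally show ?thesis by simp
    qed
    then show "\<beta> \<in> PiE UNIV (\<lambda>_. {d..0})" using neg_expos_nonpos[OF \<beta>] by auto
  qed
qed (simp add: finite_PiE)

lemma finite_neg_index: "finite (neg_index E d)"
  by (rule finite_subset[of _ "neg_expos d \<times> graph_poset E"])
     (auto simp: neg_index_def finite_neg_expos)

text \<open>The degree of \<tau> is \<open>card (snd \<tau>) + 1\<close>, so the degree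
  \<open>card (snd \<tau>)\<close> singles out its facets in the link.\<close>

lemma cells_below:
  assumes \<sigma>: "\<sigma> \<in> graph_poset E" and \<tau>: "\<tau> \<in> lk E \<sigma>" and w: "w \<in> fst \<tau>"
  shows "{\<rho> \<in> cells E \<sigma> (int (card (snd \<tau>))). graph_poset_le \<rho> \<tau>} =
    (\<lambda>v. cell E (snd \<tau> - {v}) w) ` (snd \<tau> - snd \<sigma>)"
proof (intro set_eqI iffI)
  note c = lk_cell[OF \<sigma> \<tau> w]
  fix \<rho> assume "\<rho> \<in> {\<rho> \<in> cells E \<sigma> (int (card (snd \<tau>))). graph_poset_le \<rho> \<tau>}"
  then have \<rho>: "\<rho> \<in> lk E \<sigma>" "card (snd \<rho>) + 1 = card (snd \<tau>)" "graph_poset_le \<rho> \<tau>"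
    by (auto simp: cells_def)
  have \<rho>': "snd \<rho> \<subseteq> snd \<tau>" "\<rho> = cell E (snd \<rho>) w" "snd \<sigma> \<subseteq> snd \<rho>"
    using le_in_lk[OF \<sigma> \<tau> w \<rho>(1)] \<rho> lk_iff[OF \<sigma>] by blast+
  have "card (snd \<tau> - snd \<rho>) = 1" using \<rho>(2) \<rho>'(1) by (simp add: card_Diff_subset)
  then obtain v where v: "snd \<tau> - snd \<rho> = {v}" by (auto simp: card_1_singleton_iff)
  then have "snd \<rho> = snd \<tau> - {v}" "v \<in> snd \<tau> - snd \<sigma>" using \<rho>' by auto
  then show "\<rho> \<in> (\<lambda>v. cell E (snd \<tau> - {v}) w) ` (snd \<tau> - snd \<sigma>)"
    using \<rho>'(2) by (intro image_eqI[of _ _ v]) simp_all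
next
  note c = lk_cell[OF \<sigma> \<tau> w]
  fix \<rho> assume "\<rho> \<in> (\<lambda>v. cell E (snd \<tau> - {v}) w) ` (snd \<tau> - snd \<sigma>)"
  then obtain v where v: "v \<in> snd \<tau>" "v \<notin> snd \<sigma>" "\<rho> = cell E (snd \<tau> - {v}) w" by blast
  have \<rho>: "\<rho> \<in> lk E \<sigma>" unfolding v(3) using cell_in_lk_iff[OF \<sigma>, of w "snd \<tau> - {v}"] c v by blast
  moreover have "card (snd \<tau> - {v}) + 1 = card (snd \<tau>)"
    using card_Suc_Diff1[OF _ v(1)] by simp
  moreover have "graph_poset_le \<rho> \<tau>" using le_in_lk[OF \<sigma> \<tau> w \<rho>] by (auto simp: v(3))
  ultimately show "\<rho> \<in> {\<rho> \<in> cells E \<sigma> (int (card (snd \<tau>))). graph_poset_le \<rho> \<tau>}"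
    by (simp add: cells_def v(3))
qed

text \<open>\<open>even_inversions\<close> expressed in signs; this identity turns the Cech
  differential into the coboundary of the link.\<close>

lemma orient_incidence:
  fixes E :: "'n::{finite,linorder} set set"
  assumes \<sigma>: "\<sigma> \<in> graph_poset E" and \<tau>: "\<tau> \<in> lk E \<sigma>" and v: "v \<in> snd \<tau> - snd \<sigma>"
  shows "orient E \<sigma> \<tau> * (- 1) ^ card {b \<in> snd \<tau>. b < v} =
    (link_matrix E \<sigma> (cell E (snd \<tau> - {v}) (rep \<tau>)) \<tau> *
    orient E \<sigma> (cell E (snd \<tau> - {v}) (rep \<tau>)) :: 'k::field)"
proof -
  let ?w = "rep \<tau>" and ?T = "snd \<tau>" and ?N = "snd \<sigma>"
  let ?\<rho> = "cell E (?T - {v}) ?w"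
  let ?h = "atom_pos E \<sigma> ?w"
  have w: "?w \<in> fst \<tau>" using \<tau> rep(1) lk_iff[OF \<sigma>] by blast
  have \<rho>: "?\<rho> \<in> cells E \<sigma> (int (card ?T))" "graph_poset_le ?\<rho> \<tau>"
    using cells_below[OF \<sigma> \<tau> w] v by blast+
  then have \<rho>lk: "?\<rho> \<in> lk E \<sigma>" by (simp add: cells_def)
  have r\<rho>: "rep ?\<rho> \<in> fst ?\<rho>" using \<rho>lk rep(1) lk_iff[OF \<sigma>] by blast
  have w\<rho>: "?w \<in> fst ?\<rho>" unfolding fst_cell by (rule component_of_refl)
  have inv: "inversions ?N (atom_pos E \<sigma> (rep ?\<rho>)) (?T - {v}) = inversions ?N ?h (?T - {v})"
    by (rule inversions_cong, rule atom_pos_cong[OF \<sigma> \<rho>lk r\<rho> w\<rho>]) simp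
  have "even (inversions ?N ?h ?T + inversions ?N ?h (?T - {v}) + card {b \<in> ?T. b < v} +
      card {b \<in> ?T - ?N. ?h b < ?h v})"
    by (rule even_inversions) (use lk_cell(4)[OF \<sigma> \<tau> w] v inj_atom_pos[OF \<sigma> \<tau> w] in auto)
  then have "(- 1 :: 'k) ^ (inversions ?N ?h ?T + card {b \<in> ?T. b < v}) =
    (- 1) ^ (card {b \<in> ?T - ?N. ?h b < ?h v} + inversions ?N ?h (?T - {v}))"
    by (auto simp: minus_one_power_iff)
  then show ?thesis
    unfolding orient_def link_matrix_def using \<rho>(2)
    by (simp add: incidence_lk[OF \<sigma> \<tau> w v] inv power_add)
qed

context
  fixes E :: "'n::{finite,linorder} set set" and ty :: "'k::field itself" and d :: int
  assumes E: "simple_graph E"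
begin

interpretation cech_complex gix cut "insert Zv (range Yv)" "model E d" "const_coeff :: 'k \<Rightarrow> 'n \<Rightarrow> _"
  by (rule cech_model[OF E])

definition link_cochains :: "int \<Rightarrow> (('n idx \<Rightarrow> int) \<times> ('n set \<times> 'n set) \<Rightarrow> 'n set \<times> 'n set \<Rightarrow> 'k) set" where
  "link_cochains q = {\<phi>. \<forall>t. if t \<in> neg_index E d then \<phi> t \<in> coords (cells E (snd t) q) else \<phi> t = 0}"

text \<open>The degree is read off from \<tau>, so that one operator serves all degrees.\<close>

definition link_diff where
  "link_diff \<phi> = (\<lambda>t \<tau>. if t \<in> neg_index E d \<and> \<tau> \<in> lk E (snd t)
     then \<Sum>\<rho>\<in>cells E (snd t) (int (card (snd \<tau>))). link_matrix E (snd t) \<rho> \<tau> * (\<phi> t \<rho> :: 'k) else 0)"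

text \<open>One vertex of the component is enough, because the coefficient is constant on it by
  \<open>neg_cochains_const\<close>.\<close>

definition to_link ::
  "('n idx set \<Rightarrow> 'n \<Rightarrow> ('n idx \<Rightarrow> int) \<Rightarrow> 'k) \<Rightarrow> ('n idx \<Rightarrow> int) \<times> ('n set \<times> 'n set) \<Rightarrow> 'n set \<times> 'n set \<Rightarrow> 'k" where
  "to_link c = (\<lambda>t \<tau>. if t \<in> neg_index E d \<and> \<tau> \<in> lk E (snd t)
     then orient E (snd t) \<tau> * c (face (snd \<tau>)) (rep \<tau>) (fst t) else 0)"

lemma neg_cochains_model:
  assumes "c \<in> neg_cochains E d q" "F \<subseteq> insert Zv (range Yv)" shows "c F \<in> model E d F"
proof -
  have "if F \<subseteq> insert Zv (range Yv) \<and> int (card F) = q then c F \<in> model E d F else c F = 0"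
    using assms unfolding neg_cochains_def[OF E] coch_def by blast
  then show ?thesis using cech_complex.L0[OF cech_model[OF E] assms(2)] by metis
qed

text \<open>Entries of \<beta> outside F are nonnegative, so F must contain z and all y_v with v in
  the support of \<beta>.\<close>

lemma neg_cochains_nonzero:
  assumes "c \<in> neg_cochains E d q" "c F w \<beta> \<noteq> 0"
  shows "F = face (Yv -` F)" "int (card (Yv -` F)) + 1 = q" "\<beta> \<in> neg_expos d" "w \<notin> Yv -` F"
    "expo_supp \<beta> \<subseteq> Yv -` F"
proof -
  have "if F \<subseteq> insert Zv (range Yv) \<and> int (card F) = q then c F \<in> model E d F else c F = 0"
    using assms(1) unfolding neg_cochains_def[OF E] coch_def by blast
  then have F: "F \<subseteq> insert Zv (range Yv)" "int (card F) = q" and m: "c F \<in> model E d F"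
    using assms(2) by (auto split: if_splits)
  have neg: "expo_neg \<beta>" using assms unfolding neg_cochains_def[OF E] by blast
  note M = modelD[OF E m assms(2)]
  have "Zv \<in> F" using M(3)[of Zv] neg by (force simp: expo_neg_def)
  then show f: "F = face (Yv -` F)" using face_vimage F by blast
  show "int (card (Yv -` F)) + 1 = q" using F(2) card_face[of "Yv -` F"] f by simp
  show "\<beta> \<in> neg_expos d" using M(1,2) neg by (simp add: neg_expos_def)
  show "w \<notin> Yv -` F" using M(4) by simp
  show "expo_supp \<beta> \<subseteq> Yv -` F" using M(3)[of "Yv _"] by (force simp: expo_supp_def)
qed

lemma neg_cochains_const:
  assumes c: "c \<in> neg_cochains E d q" and \<beta>: "\<beta> \<in> neg_expos d" "expo_supp \<beta> \<subseteq> T"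
    and w: "w \<in> component_of E T v"
  shows "c (face T) w \<beta> = c (face T) v \<beta>"
proof (rule component_of_constant[OF w])
  fix a b assume ab: "{a, b} \<in> E" "a \<notin> T" "b \<notin> T"
  have "\<beta> (Yv x) = 0" if "x \<notin> T" for x
  proof -
    have "\<not> \<beta> (Yv x) < 0" using \<beta>(2) that by (auto simp: expo_supp_def)
    then show ?thesis using neg_expos_nonpos[OF \<beta>(1), of "Yv x"] by simp
  qed
  then show "c (face T) a \<beta> = c (face T) b \<beta>"
    using ab by (intro model_edge[OF E neg_cochains_model[OF c face_YZ]]) auto
qed

lemma to_link_cdiff:
  assumes c: "c \<in> neg_cochains E d q"
  shows "to_link (cdiff gix cut (insert Zv (range Yv)) c) = link_diff (to_link c)"
proof (intro ext)
  fix t \<tau>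
  show "to_link (cdiff gix cut (insert Zv (range Yv)) c) t \<tau> = link_diff (to_link c) t \<tau>"
  proof (cases "t \<in> neg_index E d \<and> \<tau> \<in> lk E (snd t)")
    case True
    obtain \<beta> \<sigma> where t: "t = (\<beta>, \<sigma>)" by (cases t)
    have \<beta>: "\<beta> \<in> neg_expos d" and \<sigma>: "\<sigma> \<in> graph_poset E" and N: "snd \<sigma> = expo_supp \<beta>" and \<tau>: "\<tau> \<in> lk E \<sigma>"
      using True by (auto simp: t neg_index_def)
    let ?w = "rep \<tau>" and ?T = "snd \<tau>"
    have w: "?w \<in> fst \<tau>" using \<tau> rep(1) lk_iff[OF \<sigma>] by blast
    note L = lk_cell[OF \<sigma> \<tau> w]
    \<comment> \<open>Terms that omit z or a vertex of the support of \<beta> vanish, so only the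
      facets in the link of \<sigma> remain in the Cech sum.\<close>
    have z: "c (face ?T - {Zv}) ?w \<beta> = 0"
      using neg_cochains_nonzero(1)[OF c, of "face ?T - {Zv}" ?w \<beta>] mem_face(2) by fastforce
    have zN: "c (face (?T - {v})) ?w \<beta> = 0" if "v \<in> snd \<sigma>" for v
      using neg_cochains_nonzero(5)[OF c, of "face (?T - {v})" ?w \<beta>] that N by force
    have "cdiff gix cut (insert Zv (range Yv)) c (face ?T) ?w \<beta> =
      (\<Sum>j\<in>face ?T. csign gix j (face ?T) * c (face ?T - {j}) ?w \<beta>)"
      using face_YZ[of ?T] L(2) by (simp add: cdiff_def prod_cut sum_fun_apply csign_coeff)
    also have "\<dots> = (\<Sum>j\<in>Yv ` ?T. csign gix j (face ?T) * c (face ?T - {j}) ?w \<beta>)"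
      using z by (intro sum.mono_neutral_right) (auto simp: face_def)
    also have "\<dots> = (\<Sum>v\<in>?T. (- 1) ^ card {b \<in> ?T. b < v} * c (face (?T - {v})) ?w \<beta>)"
      by (simp add: sum.reindex inj_on_def face_remove csign_face)
    also have "\<dots> = (\<Sum>v\<in>?T - snd \<sigma>. (- 1) ^ card {b \<in> ?T. b < v} * c (face (?T - {v})) ?w \<beta>)"
      using zN by (intro sum.mono_neutral_right) auto
    finally have "to_link (cdiff gix cut (insert Zv (range Yv)) c) t \<tau> =
       (\<Sum>v\<in>?T - snd \<sigma>. (orient E \<sigma> \<tau> * (- 1) ^ card {b \<in> ?T. b < v}) * c (face (?T - {v})) ?w \<beta>)"
      using True by (simp add: to_link_def t sum_distrib_left mult.assoc)
    also have "\<dots> = (\<Sum>v\<in>?T - snd \<sigma>. link_matrix E \<sigma> (cell E (?T - {v}) ?w) \<tau> * to_link c t (cell E (?T - {v}) ?w))"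
    proof (intro sum.cong refl)
      fix v assume v: "v \<in> ?T - snd \<sigma>"
      let ?\<rho> = "cell E (?T - {v}) ?w"
      have \<rho>: "?\<rho> \<in> lk E \<sigma>" using cells_below[OF \<sigma> \<tau> w] v by (auto simp: cells_def)
      then have "rep ?\<rho> \<in> fst ?\<rho>" using rep(1) lk_iff[OF \<sigma>] by blast
      then have r: "rep ?\<rho> \<in> component_of E (?T - {v}) ?w" by (simp only: fst_cell)
      have "expo_supp \<beta> \<subseteq> ?T - {v}" using L(4) N v by auto
      from neg_cochains_const[OF c \<beta> this r]
      have "to_link c t ?\<rho> = orient E \<sigma> ?\<rho> * c (face (?T - {v})) ?w \<beta>"
        using True \<rho> by (simp add: to_link_def t)
      then show "(orient E \<sigma> \<tau> * (- 1) ^ card {b \<in> ?T. b < v}) * c (face (?T - {v})) ?w \<beta> =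
        link_matrix E \<sigma> ?\<rho> \<tau> * to_link c t ?\<rho>"
        unfolding orient_incidence[OF \<sigma> \<tau> v] by (simp add: mult.assoc)
    qed
    also have "\<dots> = (\<Sum>\<rho>\<in>(\<lambda>v. cell E (?T - {v}) ?w) ` (?T - snd \<sigma>). link_matrix E \<sigma> \<rho> \<tau> * to_link c t \<rho>)"
    proof (subst sum.reindex)
      show "inj_on (\<lambda>v. cell E (?T - {v}) ?w) (?T - snd \<sigma>)"
      proof (rule inj_onI)
        fix a b assume "a \<in> ?T - snd \<sigma>" "b \<in> ?T - snd \<sigma>" "cell E (?T - {a}) ?w = cell E (?T - {b}) ?w"
        then have "?T - {a} = ?T - {b}" by (metis snd_cell)
        then show "a = b" using \<open>a \<in> _\<close> \<open>b \<in> _\<close> by blast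
      qed
    qed simp
    also have "\<dots> = (\<Sum>\<rho>\<in>cells E \<sigma> (int (card ?T)). link_matrix E \<sigma> \<rho> \<tau> * to_link c t \<rho>)"
      unfolding cells_below[OF \<sigma> \<tau> w, symmetric]
      by (intro sum.mono_neutral_left) (auto simp: link_matrix_def)
    also have "\<dots> = link_diff (to_link c) t \<tau>" using True by (simp add: link_diff_def t)
    finally show ?thesis .
  qed (auto simp: to_link_def link_diff_def)
qed

lemma orient_sq: "orient E \<sigma> \<tau> * orient E \<sigma> \<tau> = (1 :: 'k)"
  by (simp add: orient_def flip: power_add)

lemma to_link_eq_0:
  assumes c: "c \<in> neg_cochains E d q" and 0: "to_link c = 0"
  shows "c = 0"
proof (intro ext, rule ccontr)
  fix F w \<beta> assume "c F w \<beta> \<noteq> 0 F w \<beta>"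
  then have nz: "c F w \<beta> \<noteq> 0" by simp
  let ?T = "Yv -` F"
  note n = neg_cochains_nonzero[OF c nz]
  \<comment> \<open>A nonzero coefficient at w is detected in the summand whose \<sigma> is the
    component of w after deletion of the support of \<beta>.\<close>
  let ?\<tau> = "cell E ?T w" and ?\<sigma> = "cell E (expo_supp \<beta>) w"
  have "w \<notin> expo_supp \<beta>" using n by blast
  then have \<sigma>: "?\<sigma> \<in> graph_poset E" by (rule cell_in_graph_poset)
  have \<tau>: "?\<tau> \<in> lk E ?\<sigma>" using cell_in_lk_iff[OF \<sigma> n(4)] n(5) by simp
  have t: "(\<beta>, ?\<sigma>) \<in> neg_index E d" using n(3) \<sigma> by (simp add: neg_index_def)
  have "rep ?\<tau> \<in> fst ?\<tau>" using \<tau> rep(1) lk_iff[OF \<sigma>] by blast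
  then have "c (face ?T) (rep ?\<tau>) \<beta> = c (face ?T) w \<beta>"
    using neg_cochains_const[OF c n(3,5)] by (simp only: fst_cell)
  then have "to_link c (\<beta>, ?\<sigma>) ?\<tau> = orient E ?\<sigma> ?\<tau> * c F w \<beta>"
    using t \<tau> n(1) by (simp add: to_link_def)
  moreover have "orient E ?\<sigma> ?\<tau> \<noteq> (0 :: 'k)" by (simp add: orient_def)
  ultimately show False using 0 nz by simp
qed

lemma to_link_surj:
  assumes \<phi>: "\<phi> \<in> link_cochains q"
  shows "\<exists>c\<in>neg_cochains E d q. to_link c = \<phi>"
proof -
  \<comment> \<open>Multiplying by the sign \<open>orient\<close> a second time undoes it. Cells of
    w are used instead of w itself, which makes the value constant on components.\<close>
  define c where "c F w \<beta> = (if F \<subseteq> insert Zv (range Yv) \<and> Zv \<in> F \<and> int (card F) = q \<and> \<beta> \<in> neg_expos d \<and>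
      Yv w \<notin> F \<and> expo_supp \<beta> \<subseteq> Yv -` F
    then orient E (cell E (expo_supp \<beta>) w) (cell E (Yv -` F) w) *
      \<phi> (\<beta>, cell E (expo_supp \<beta>) w) (cell E (Yv -` F) w) else 0)" for F w \<beta>
  have "c F \<in> model E d F" if F: "F \<subseteq> insert Zv (range Yv)" for F
    unfolding model_def
  proof (intro CollectI conjI allI impI)
    show "finite {\<beta>. \<exists>w. c F w \<beta> \<noteq> 0}"
      by (rule finite_subset[OF _ finite_neg_expos[of d]]) (auto simp: c_def split: if_splits)
  next
    fix w \<beta> assume "c F w \<beta> \<noteq> 0"
    then have n: "Zv \<in> F" "\<beta> \<in> neg_expos d" "Yv w \<notin> F" "expo_supp \<beta> \<subseteq> Yv -` F"
      by (auto simp: c_def split: if_splits)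
    show "\<beta> (Xv v) = 0" for v using n by (simp add: neg_expos_def)
    show "sum \<beta> UNIV = d" using n by (simp add: neg_expos_def)
    show "Yv w \<notin> F" by (rule n)
    show nn: "0 \<le> \<beta> j" if "j \<notin> F" for j
    proof (cases j)
      case (Yv v)
      then have "v \<notin> expo_supp \<beta>" using n(4) that by auto
      then show ?thesis using Yv by (simp add: expo_supp_def)
    qed (use n that in \<open>auto simp: neg_expos_def\<close>)
    show "\<beta> (Yv w) = 0" using nn[OF n(3)] neg_expos_nonpos[OF n(2), of "Yv w"] by simp
  next
    fix u v \<beta> assume uv: "{u, v} \<in> E" "Yv u \<notin> F" "Yv v \<notin> F"
    show "c F u \<beta> = c F v \<beta>"
    proof (cases "expo_supp \<beta> \<subseteq> Yv -` F")
      case True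
      have "u \<in> component_of E (Yv -` F) v"
        using uv by (auto simp: component_of_def insert_commute intro!: r_into_rtrancl)
      moreover have "u \<in> component_of E (expo_supp \<beta>) v"
        using calculation component_of_mono[OF True] by blast
      ultimately have "cell E (Yv -` F) u = cell E (Yv -` F) v" "cell E (expo_supp \<beta>) u = cell E (expo_supp \<beta>) v"
        by (simp_all only: cell_eq_iff_mem)
      then show ?thesis using uv by (simp add: c_def)
    qed (simp add: c_def)
  qed
  moreover have "c F = 0" if "\<not> (F \<subseteq> insert Zv (range Yv) \<and> int (card F) = q)" for F
    using that by (intro ext) (auto simp: c_def)
  moreover have "expo_neg \<beta>" if "c F w \<beta> \<noteq> 0" for F w \<beta>
    using that by (auto simp: c_def neg_expos_def split: if_splits)
  ultimately have "c \<in> neg_cochains E d q"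
    unfolding neg_cochains_def[OF E] coch_def by auto
  moreover have "to_link c = \<phi>"
  proof (intro ext)
    fix t :: "('n idx \<Rightarrow> int) \<times> ('n set \<times> 'n set)" and \<tau>
    obtain \<beta> \<sigma> where t: "t = (\<beta>, \<sigma>)" by (cases t)
    show "to_link c t \<tau> = \<phi> t \<tau>"
    proof (cases "t \<in> neg_index E d \<and> \<tau> \<in> cells E \<sigma> q")
      case True
      then have \<beta>: "\<beta> \<in> neg_expos d" and \<sigma>: "\<sigma> \<in> graph_poset E" and N: "snd \<sigma> = expo_supp \<beta>" and \<tau>: "\<tau> \<in> lk E \<sigma>"
        and card: "int (card (snd \<tau>)) + 1 = q"
        by (auto simp: t neg_index_def cells_def)
      have w: "rep \<tau> \<in> fst \<tau>" using \<tau> rep(1) lk_iff[OF \<sigma>] by blast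
      note L = lk_cell[OF \<sigma> \<tau> w]
      have vi: "Yv -` face (snd \<tau>) = snd \<tau>" by (auto simp: face_def)
      have cond: "face (snd \<tau>) \<subseteq> insert Zv (range Yv) \<and> Zv \<in> face (snd \<tau>) \<and> int (card (face (snd \<tau>))) = q \<and>
          \<beta> \<in> neg_expos d \<and> Yv (rep \<tau>) \<notin> face (snd \<tau>) \<and> snd \<sigma> \<subseteq> snd \<tau>"
        using face_YZ[of "snd \<tau>"] \<beta> L(2,4) card by (simp add: card_face)
      have "c (face (snd \<tau>)) (rep \<tau>) \<beta> = orient E \<sigma> \<tau> * \<phi> (\<beta>, \<sigma>) \<tau>"
        unfolding c_def vi N[symmetric] L(1)[symmetric] L(3)[symmetric] using cond by (rule if_P)
      then show ?thesis using True \<tau>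
        by (simp add: to_link_def t orient_sq flip: mult.assoc)
    next
      case False
      have "\<phi> t \<tau> = 0"
      proof -
        have "if t \<in> neg_index E d then \<phi> t \<in> coords (cells E (snd t) q) else \<phi> t = 0"
          using \<phi> unfolding link_cochains_def by blast
        then show ?thesis using False by (cases \<tau>) (simp add: coords_def t split: if_splits)
      qed
      moreover have "to_link c t \<tau> = 0"
      proof (rule ccontr)
        assume "to_link c t \<tau> \<noteq> 0"
        then have *: "t \<in> neg_index E d" "\<tau> \<in> lk E \<sigma>" "c (face (snd \<tau>)) (rep \<tau>) \<beta> \<noteq> 0"
          by (auto simp: to_link_def t split: if_splits)
        then have "int (card (face (snd \<tau>))) = q" by (auto simp: c_def split: if_splits)
        then show False using False * by (simp add: cells_def card_face)
      qed
      ultimately show ?thesis by simp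
    qed
  qed
  ultimately show ?thesis by blast
qed

lemma to_link_mem:
  assumes c: "c \<in> neg_cochains E d q"
  shows "to_link c \<in> link_cochains q"
proof -
  have "to_link c t \<in> coords (cells E (snd t) q)" if t: "t \<in> neg_index E d" for t
    unfolding coords_def
  proof (intro CollectI allI impI, rule ccontr)
    fix \<tau> assume \<tau>: "\<tau> \<notin> cells E (snd t) q" and "to_link c t \<tau> \<noteq> 0"
    then have *: "\<tau> \<in> lk E (snd t)" "c (face (snd \<tau>)) (rep \<tau>) (fst t) \<noteq> 0"
      by (auto simp: to_link_def split: if_splits)
    have "Yv -` face (snd \<tau>) = snd \<tau>" by (auto simp: face_def)
    then show False using neg_cochains_nonzero(2)[OF c *(2)] \<tau> *(1) by (simp add: cells_def)
  qed
  then show ?thesis by (auto simp: link_cochains_def to_link_def fun_eq_iff)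
qed

lemma quot_iso_neg_link:
  "quot_iso csc {y \<in> neg_cochains E d p. cdiff gix cut (insert Zv (range Yv)) y = 0}
     (cdiff gix cut (insert Zv (range Yv)) ` neg_cochains E d (p - 1))
     (\<lambda>a \<phi> t. pscale a (\<phi> t)) {\<phi> \<in> link_cochains p. link_diff \<phi> = 0} (link_diff ` link_cochains (p - 1))"
proof (rule quot_iso_complex_map[where C = "neg_cochains E d" and f = to_link])
  let ?d = "cdiff gix cut (insert Zv (range Yv)) :: _ \<Rightarrow> 'n idx set \<Rightarrow> 'n \<Rightarrow> ('n idx \<Rightarrow> int) \<Rightarrow> 'k"
  fix q and x y :: "'n idx set \<Rightarrow> 'n \<Rightarrow> ('n idx \<Rightarrow> int) \<Rightarrow> 'k" and a :: 'k
  assume x: "x \<in> neg_cochains E d q"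
  then have xc: "x \<in> coch (insert Zv (range Yv)) (model E d) q" and xn: "\<And>F w \<beta>. x F w \<beta> \<noteq> 0 \<Longrightarrow> expo_neg \<beta>"
    unfolding neg_cochains_def[OF E] by blast+
  show "csc a x \<in> neg_cochains E d q"
    unfolding neg_cochains_def[OF E] using coch_scale[OF xc, of a] xn by (auto simp: csc_def)
  show "?d x \<in> neg_cochains E d (q + 1)"
    unfolding neg_cochains_def[OF E]
  proof (intro CollectI conjI allI impI coch_cdiff xc)
    fix F w \<beta> assume "?d x F w \<beta> \<noteq> 0"
    then have "(\<Sum>v\<in>F. csign gix v F * x (F - {v}) w \<beta>) \<noteq> 0"
      by (auto simp: cdiff_def sum_fun_apply csign_coeff split: if_splits)
    then obtain v where "csign gix v F * x (F - {v}) w \<beta> \<noteq> 0" by (rule sum.not_neutral_contains_not_neutral)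
    then show "expo_neg \<beta>" using xn by auto
  qed
  show "?d (?d x) = 0" by (rule cdiff_cdiff[OF finU inj idem])
  show "?d (csc a x) = csc a (?d x)" by (simp add: csc_def cdiff_scale)
  show "to_link x \<in> link_cochains q" by (rule to_link_mem[OF x])
  show "to_link (csc a x) = (\<lambda>t. pscale a (to_link x t))"
    by (intro ext) (simp add: to_link_def csc_def const_coeff_def pscale_def)
  show "to_link (?d x) = link_diff (to_link x)" by (rule to_link_cdiff[OF x])
  show "\<exists>k\<in>neg_cochains E d (q - 1). to_link k = 0 \<and> x = ?d k" if "to_link x = 0"
  proof -
    have "x = 0" by (rule to_link_eq_0[OF x that])
    moreover have "?d 0 = 0" using cdiff_minus[of gix cut _ 0 0] by simp
    moreover have "to_link 0 = 0" by (simp add: to_link_def fun_eq_iff)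
    moreover have "(0 :: 'n idx set \<Rightarrow> 'n \<Rightarrow> ('n idx \<Rightarrow> int) \<Rightarrow> 'k) \<in> neg_cochains E d (q - 1)"
      unfolding neg_cochains_def[OF E] coch_def using L0 by auto
    ultimately show ?thesis by metis
  qed
  assume y: "y \<in> neg_cochains E d q"
  then have yc: "y \<in> coch (insert Zv (range Yv)) (model E d) q" and yn: "\<And>F w \<beta>. y F w \<beta> \<noteq> 0 \<Longrightarrow> expo_neg \<beta>"
    unfolding neg_cochains_def[OF E] by blast+
  have "x F w \<beta> \<noteq> 0 \<or> y F w \<beta> \<noteq> 0" if "x F w \<beta> + y F w \<beta> \<noteq> 0" for F w \<beta> using that by auto
  then show "x + y \<in> neg_cochains E d q"
    unfolding neg_cochains_def[OF E] using coch_add[OF xc yc] xn yn by (auto simp del: add_eq_0_iff) blast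
  have "x F w \<beta> \<noteq> 0 \<or> y F w \<beta> \<noteq> 0" if "x F w \<beta> - y F w \<beta> \<noteq> 0" for F w \<beta> using that by auto
  then show "x - y \<in> neg_cochains E d q"
    unfolding neg_cochains_def[OF E] using coch_diff[OF xc yc] xn yn by (auto simp del: right_minus_eq) blast
next
  show "\<exists>x\<in>neg_cochains E d q. to_link x = y" if "y \<in> link_cochains q" for q y
    by (rule to_link_surj[OF that])
qed (auto simp: to_link_def fun_eq_iff algebra_simps cdiff_add cdiff_minus csc_def)

end

section \<open>Homology of links\<close>

lemma scale_eq_pscale: "(\<lambda>a c \<tau>. a * c \<tau>) = pscale"
  by (simp add: fun_eq_iff pscale_def)

definition link_cocycles :: "'n::{finite,linorder} set set \<Rightarrow> 'n set \<times> 'n set \<Rightarrow> int \<Rightarrow> ('n set \<times> 'n set \<Rightarrow> 'k::field) set" where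
  "link_cocycles E \<sigma> p = {\<phi> \<in> coords (cells E \<sigma> p).
     \<forall>\<tau>\<in>cells E \<sigma> (p + 1). (\<Sum>\<rho>\<in>cells E \<sigma> p. link_matrix E \<sigma> \<rho> \<tau> * \<phi> \<rho>) = 0}"

definition link_coboundaries :: "'n::{finite,linorder} set set \<Rightarrow> 'n set \<times> 'n set \<Rightarrow> int \<Rightarrow> ('n set \<times> 'n set \<Rightarrow> 'k::field) set" where
  "link_coboundaries E \<sigma> p = (\<lambda>\<psi> \<tau>. if \<tau> \<in> cells E \<sigma> p
     then \<Sum>\<rho>\<in>cells E \<sigma> (p - 1). link_matrix E \<sigma> \<rho> \<tau> * \<psi> \<rho> else 0) ` coords (cells E \<sigma> (p - 1))"

context
  fixes E :: "'n::{finite,linorder} set set" and \<sigma> :: "'n set \<times> 'n set" and p :: int and ty :: "'k::field itself"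
  assumes \<sigma>: "\<sigma> \<in> graph_poset E"
begin

abbreviation deg :: int where "deg \<equiv> p - int (card (snd \<sigma>)) - 2"

definition link_cycles :: "('n set \<times> 'n set \<Rightarrow> 'k) set" where
  "link_cycles = {c \<in> coords (cells E \<sigma> p). \<forall>\<rho>\<in>cells E \<sigma> (p - 1). (\<Sum>\<tau>\<in>cells E \<sigma> p. link_matrix E \<sigma> \<rho> \<tau> * c \<tau>) = 0}"

definition link_boundaries :: "('n set \<times> 'n set \<Rightarrow> 'k) set" where
  "link_boundaries = (\<lambda>c \<rho>. if \<rho> \<in> cells E \<sigma> p
     then \<Sum>\<tau>\<in>cells E \<sigma> (p + 1). link_matrix E \<sigma> \<rho> \<tau> * c \<tau> else 0) ` coords (cells E \<sigma> (p + 1))"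

text \<open>A face (W', T') of dimension j in the link satisfies |T'| - |snd \<sigma>| = j + 1,
  while its Cech degree is |T'| + 1. This is the origin of the shift by rank + 2.\<close>

lemma cell_chains_eq: "q = j + int (card (snd \<sigma>)) + 2 \<Longrightarrow> cell_chains graph_poset_le (lk E \<sigma>) j = coords (cells E \<sigma> q)"
proof -
  assume q: "q = j + int (card (snd \<sigma>)) + 2"
  have "\<tau> \<in> lk E \<sigma> \<and> int (poset_rank graph_poset_le (lk E \<sigma>) \<tau>) = j + 1 \<longleftrightarrow> \<tau> \<in> cells E \<sigma> q" for \<tau>
    using poset_rank_lk[OF \<sigma>, of \<tau>] q by (auto simp: cells_def)
  then show ?thesis unfolding cell_chains_def coords_def by blast
qed

lemma cell_boundary_eq:
  assumes c: "c \<in> coords (cells E \<sigma> q)"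
  shows "cell_boundary graph_poset_le (lk E \<sigma>) c =
    (\<lambda>\<rho>. if \<rho> \<in> cells E \<sigma> (q - 1) then \<Sum>\<tau>\<in>cells E \<sigma> q. link_matrix E \<sigma> \<rho> \<tau> * (c \<tau> :: 'k) else 0)"
proof
  fix \<rho>
  let ?S = "{\<tau>. \<tau> \<in> lk E \<sigma> \<and> graph_poset_le \<rho> \<tau> \<and>
    poset_rank graph_poset_le (lk E \<sigma>) \<tau> = poset_rank graph_poset_le (lk E \<sigma>) \<rho> + 1}"
  show "cell_boundary graph_poset_le (lk E \<sigma>) c \<rho> =
    (if \<rho> \<in> cells E \<sigma> (q - 1) then \<Sum>\<tau>\<in>cells E \<sigma> q. link_matrix E \<sigma> \<rho> \<tau> * c \<tau> else 0)"
  proof (cases "\<rho> \<in> lk E \<sigma>")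
    case \<rho>: True
    have S: "?S = {\<tau> \<in> lk E \<sigma>. graph_poset_le \<rho> \<tau> \<and> card (snd \<tau>) = card (snd \<rho>) + 1}"
      using poset_rank_lk[OF \<sigma>] poset_rank_lk[OF \<sigma> \<rho>] by force
    show ?thesis
    proof (cases "\<rho> \<in> cells E \<sigma> (q - 1)")
      case True
      have "?S = {\<tau> \<in> cells E \<sigma> q. graph_poset_le \<rho> \<tau>}"
        unfolding S using True by (auto simp: cells_def)
      then have "cell_boundary graph_poset_le (lk E \<sigma>) c \<rho> =
        (\<Sum>\<tau>\<in>{\<tau> \<in> cells E \<sigma> q. graph_poset_le \<rho> \<tau>}. incidence graph_poset_le (lk E \<sigma>) \<rho> \<tau> * c \<tau>)"
        using \<rho> by (simp add: cell_boundary_def)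
      also have "\<dots> = (\<Sum>\<tau>\<in>cells E \<sigma> q. link_matrix E \<sigma> \<rho> \<tau> * c \<tau>)"
        by (rule sum.mono_neutral_cong_left) (auto simp: link_matrix_def)
      finally show ?thesis using True by simp
    next
      case False
      \<comment> \<open>Here \<rho> lies in the link but has another degree, so its cofaces lie
        outside the support of c.\<close>
      have "c \<tau> = 0" if "\<tau> \<in> ?S" for \<tau>
      proof -
        have "\<tau> \<notin> cells E \<sigma> q" using that False \<rho> unfolding S by (auto simp: cells_def)
        then show ?thesis using c unfolding coords_def by blast
      qed
      then have "(\<Sum>\<tau>\<in>?S. incidence graph_poset_le (lk E \<sigma>) \<rho> \<tau> * c \<tau>) = 0"
        by (intro sum.neutral) auto
      then show ?thesis using False by (simp add: cell_boundary_def)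
    qed
  next
    case False
    then show ?thesis by (simp add: cell_boundary_def cells_def)
  qed
qed

lemma reduced_betti_lk:
  "reduced_betti TYPE('k) graph_poset_le (lk E \<sigma>) deg = quot_dim pscale link_cycles link_boundaries"
proof -
  have "{c \<in> cell_chains graph_poset_le (lk E \<sigma>) deg. cell_boundary graph_poset_le (lk E \<sigma>) c = (0 :: _ \<Rightarrow> 'k)} = link_cycles"
    unfolding cell_chains_eq[of p deg, simplified] link_cycles_def
    using cell_boundary_eq[of _ p] by (auto simp: fun_eq_iff split: if_splits)
  moreover have "cell_boundary graph_poset_le (lk E \<sigma>) ` cell_chains graph_poset_le (lk E \<sigma>) (deg + 1) = link_boundaries"
  proof -
    have "cell_chains graph_poset_le (lk E \<sigma>) (deg + 1) = (coords (cells E \<sigma> (p + 1)) :: (_ \<Rightarrow> 'k) set)"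
      by (rule cell_chains_eq) simp
    then show ?thesis unfolding link_boundaries_def
      by (intro image_cong) (use cell_boundary_eq[of _ "p + 1"] in simp_all)
  qed
  ultimately show ?thesis by (simp add: reduced_betti_def scale_eq_pscale)
qed

lemma link_cohomology:
  "\<exists>X. finite X \<and> card X = reduced_betti TYPE('k) graph_poset_le (lk E \<sigma>) deg \<and>
    quot_iso pscale (link_cocycles E \<sigma> p :: (_ \<Rightarrow> 'k) set) (link_coboundaries E \<sigma> p)
      pscale (coords (X :: ('n set \<times> 'n set \<Rightarrow> 'k) set)) {0}"
proof -
  interpret vector_space "pscale :: 'k \<Rightarrow> ('n set \<times> 'n set \<Rightarrow> 'k) \<Rightarrow> _" by (rule vector_space_pscale)
  have Z: "subspace link_cycles"
    unfolding link_cycles_def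
    by (rule subspaceI) (auto simp: coords_def pscale_def distrib_left sum.distrib mult.left_commute
        simp flip: sum_distrib_left)
  have B: "subspace link_boundaries"
    unfolding link_boundaries_def
  proof (rule subspaceI, goal_cases)
    case 1 show ?case by (rule image_eqI[of _ _ 0]) (auto simp: coords_def fun_eq_iff)
  next
    case (2 x y)
    then obtain a b where "a \<in> coords (cells E \<sigma> (p + 1))" "b \<in> coords (cells E \<sigma> (p + 1))"
      "x = (\<lambda>\<rho>. if \<rho> \<in> cells E \<sigma> p then \<Sum>\<tau>\<in>cells E \<sigma> (p + 1). link_matrix E \<sigma> \<rho> \<tau> * a \<tau> else 0)"
      "y = (\<lambda>\<rho>. if \<rho> \<in> cells E \<sigma> p then \<Sum>\<tau>\<in>cells E \<sigma> (p + 1). link_matrix E \<sigma> \<rho> \<tau> * b \<tau> else 0)" by blast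
    then show ?case
      by (intro image_eqI[of _ _ "a + b"]) (auto simp: coords_def fun_eq_iff distrib_left sum.distrib)
  next
    case (3 k x)
    then obtain a where "a \<in> coords (cells E \<sigma> (p + 1))"
      "x = (\<lambda>\<rho>. if \<rho> \<in> cells E \<sigma> p then \<Sum>\<tau>\<in>cells E \<sigma> (p + 1). link_matrix E \<sigma> \<rho> \<tau> * a \<tau> else 0)" by blast
    then show ?case
      by (intro image_eqI[of _ _ "pscale k a"]) (auto simp: coords_def pscale_def fun_eq_iff sum_distrib_left mult.left_commute)
  qed
  have "\<exists>X. quot_basis pscale link_cycles link_boundaries X"
    by (rule quot_basis_exists[OF _ _ Z B, of "cells E \<sigma> p"]) (auto simp: link_cycles_def)
  \<comment> \<open>This is the very set chosen in \<open>quot_dim\<close>, so its cardinality is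
    the Betti number by definition.\<close>
  then have X: "quot_basis pscale link_cycles link_boundaries (SOME X. quot_basis pscale link_cycles link_boundaries X)"
    by (rule someI_ex)
  show ?thesis
  proof (intro exI conjI)
    show "finite (SOME X. quot_basis pscale link_cycles link_boundaries X)"
      using X by (simp add: quot_basis_def)
    show "card (SOME X. quot_basis pscale link_cycles link_boundaries X) =
        reduced_betti TYPE('k) graph_poset_le (lk E \<sigma>) deg"
      unfolding reduced_betti_lk quot_dim_def ..
  qed (rule quot_iso_cohomology[OF _ _ _ X[unfolded link_cycles_def link_boundaries_def],
        folded link_cycles_def link_boundaries_def link_cocycles_def link_coboundaries_def], simp_all)
qed

end

section \<open>The local cohomology as a direct sum\<close>

context
  fixes E :: "'n::{finite,linorder} set set" and ty :: "'k::field itself" and d :: int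
  assumes E: "simple_graph E"
begin

lemma link_diff_eq:
  assumes \<phi>: "\<phi> \<in> (link_cochains E d q :: (_ \<Rightarrow> _ \<Rightarrow> 'k) set)"
  shows "link_diff E d \<phi> t \<tau> = (if t \<in> neg_index E d \<and> \<tau> \<in> cells E (snd t) (q + 1)
    then \<Sum>\<rho>\<in>cells E (snd t) q. link_matrix E (snd t) \<rho> \<tau> * \<phi> t \<rho> else 0)"
proof (cases "t \<in> neg_index E d \<and> \<tau> \<in> lk E (snd t)")
  case True
  have \<phi>t: "\<phi> t \<in> coords (cells E (snd t) q)"
  proof -
    have "if t \<in> neg_index E d then \<phi> t \<in> coords (cells E (snd t) q) else \<phi> t = 0"
      using \<phi> unfolding link_cochains_def[OF E] by blast
    then show ?thesis using True by simp
  qed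
  show ?thesis
  proof (cases "int (card (snd \<tau>)) = q")
    case q: True
    then show ?thesis using True by (simp add: link_diff_def[OF E] cells_def)
  next
    case False
    have "\<phi> t \<rho> = 0" if "\<rho> \<in> cells E (snd t) (int (card (snd \<tau>)))" for \<rho>
    proof -
      have "\<rho> \<notin> cells E (snd t) q" using that False by (auto simp: cells_def)
      then show ?thesis using \<phi>t unfolding coords_def by blast
    qed
    then show ?thesis using False by (simp add: link_diff_def[OF E] cells_def)
  qed
next
  case False
  then have "\<not> (t \<in> neg_index E d \<and> \<tau> \<in> cells E (snd t) (q + 1))" by (auto simp: cells_def)
  then show ?thesis using False unfolding link_diff_def[OF E] by presburger
qed

text \<open>The differential does not mix different t, so the cocycle condition splits into
  conditions on the links.\<close>

lemma link_cocycles_eq: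
  "{\<phi> \<in> link_cochains E d p. link_diff E d \<phi> = (0 :: _ \<Rightarrow> _ \<Rightarrow> 'k)} =
   {\<phi>. \<forall>t. if t \<in> neg_index E d then \<phi> t \<in> link_cocycles E (snd t) p else \<phi> t = 0}"
proof -
  have "link_diff E d \<phi> = 0 \<longleftrightarrow> (\<forall>t\<in>neg_index E d. \<forall>\<tau>\<in>cells E (snd t) (p + 1).
      (\<Sum>\<rho>\<in>cells E (snd t) p. link_matrix E (snd t) \<rho> \<tau> * \<phi> t \<rho>) = 0)"
    if "\<phi> \<in> link_cochains E d p" for \<phi> :: "_ \<Rightarrow> _ \<Rightarrow> 'k"
    unfolding fun_eq_iff[of "link_diff E d \<phi>"] fun_eq_iff[of "link_diff E d \<phi> _"] link_diff_eq[OF that]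
    by (simp only: zero_fun_apply) meson
  note iff = this
  have lc: "\<phi> \<in> link_cochains E d p \<longleftrightarrow> (\<forall>t. if t \<in> neg_index E d then \<phi> t \<in> coords (cells E (snd t) p) else \<phi> t = 0)"
    for \<phi> :: "_ \<Rightarrow> _ \<Rightarrow> 'k"
    unfolding link_cochains_def[OF E] by (rule mem_Collect_eq)
  show ?thesis unfolding link_cocycles_def
  proof (rule Collect_cong)
    fix \<phi> :: "_ \<Rightarrow> _ \<Rightarrow> 'k"
    let ?c = "\<lambda>t \<psi>. \<forall>\<tau>\<in>cells E (snd t) (p + 1). (\<Sum>\<rho>\<in>cells E (snd t) p. link_matrix E (snd t) \<rho> \<tau> * \<psi> \<rho>) = 0"
    have "\<phi> \<in> link_cochains E d p \<and> link_diff E d \<phi> = 0 \<longleftrightarrow> \<phi> \<in> link_cochains E d p \<and> (\<forall>t\<in>neg_index E d. ?c t (\<phi> t))"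
      using iff[of \<phi>] by blast
    also have "\<dots> \<longleftrightarrow> (\<forall>t. if t \<in> neg_index E d then \<phi> t \<in> {\<psi> \<in> coords (cells E (snd t) p). ?c t \<psi>} else \<phi> t = 0)"
      unfolding lc mem_Collect_eq by meson
    finally show "\<phi> \<in> link_cochains E d p \<and> link_diff E d \<phi> = 0 \<longleftrightarrow>
      (\<forall>t. if t \<in> neg_index E d then \<phi> t \<in> {\<psi> \<in> coords (cells E (snd t) p). ?c t \<psi>} else \<phi> t = 0)" .
  qed
qed

lemma link_coboundaries_eq:
  "link_diff E d ` link_cochains E d (p - 1) =
   {\<phi>. \<forall>t. if t \<in> neg_index E d then \<phi> t \<in> link_coboundaries E (snd t) p else \<phi> t = (0 :: _ \<Rightarrow> 'k)}"
  (is "_ = ?R")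
proof (intro set_eqI iffI)
  define D where "D t = (\<lambda>\<psi> \<tau>. if \<tau> \<in> cells E (snd t) p
     then \<Sum>\<rho>\<in>cells E (snd t) (p - 1). link_matrix E (snd t) \<rho> \<tau> * (\<psi> \<rho> :: 'k) else 0)"
    for t :: "('n idx \<Rightarrow> int) \<times> ('n set \<times> 'n set)"
  have cob: "link_coboundaries E (snd t) p = D t ` coords (cells E (snd t) (p - 1))" for t
    by (simp add: link_coboundaries_def D_def)
  have diff: "link_diff E d \<psi> t = (if t \<in> neg_index E d then D t (\<psi> t) else 0)"
    if "\<psi> \<in> link_cochains E d (p - 1)" for \<psi> t
    by (rule ext) (simp add: link_diff_eq[OF that] D_def)
  have coch: "if t \<in> neg_index E d then \<psi> t \<in> coords (cells E (snd t) (p - 1)) else \<psi> t = 0"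
    if "\<psi> \<in> link_cochains E d (p - 1)" for t and \<psi> :: "_ \<Rightarrow> _ \<Rightarrow> 'k"
    using that unfolding link_cochains_def[OF E] by blast
  {
    fix \<phi> :: "_ \<Rightarrow> _ \<Rightarrow> 'k" assume "\<phi> \<in> link_diff E d ` link_cochains E d (p - 1)"
    then obtain \<psi> where \<psi>: "\<psi> \<in> link_cochains E d (p - 1)" "\<phi> = link_diff E d \<psi>" by blast
    have "if t \<in> neg_index E d then \<phi> t \<in> link_coboundaries E (snd t) p else \<phi> t = 0" for t
      unfolding \<psi>(2) diff[OF \<psi>(1)] cob using coch[OF \<psi>(1), of t] by simp
    then show "\<phi> \<in> ?R" by blast
  next
    fix \<phi> assume \<phi>: "\<phi> \<in> ?R"
    have "\<forall>t\<in>neg_index E d. \<exists>\<psi>. \<psi> \<in> coords (cells E (snd t) (p - 1)) \<and> \<phi> t = D t \<psi>"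
    proof
      fix t assume t: "t \<in> neg_index E d"
      from \<phi> have "if t \<in> neg_index E d then \<phi> t \<in> link_coboundaries E (snd t) p else \<phi> t = 0" by blast
      then show "\<exists>\<psi>. \<psi> \<in> coords (cells E (snd t) (p - 1)) \<and> \<phi> t = D t \<psi>"
        unfolding if_P[OF t] cob by blast
    qed
    then obtain \<psi> where \<psi>: "\<And>t. t \<in> neg_index E d \<Longrightarrow> \<psi> t \<in> coords (cells E (snd t) (p - 1)) \<and> \<phi> t = D t (\<psi> t)"
      unfolding bchoice_iff by blast
    define \<psi>' where "\<psi>' t = (if t \<in> neg_index E d then \<psi> t else 0)" for t
    have \<psi>': "\<psi>' \<in> link_cochains E d (p - 1)"
      unfolding link_cochains_def[OF E] \<psi>'_def using \<psi> by auto
    have "\<phi> t = link_diff E d \<psi>' t" for t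
    proof -
      have "if t \<in> neg_index E d then \<phi> t \<in> link_coboundaries E (snd t) p else \<phi> t = 0" using \<phi> by blast
      then show ?thesis unfolding diff[OF \<psi>'] using \<psi>[of t] by (simp add: \<psi>'_def split: if_splits)
    qed
    then have "\<phi> = link_diff E d \<psi>'" by (rule ext)
    then show "\<phi> \<in> link_diff E d ` link_cochains E d (p - 1)" using \<psi>' by blast
  }
qed

lemma local_cohomology_dim:
  fixes p :: int
  defines "b \<equiv> \<lambda>\<sigma>. reduced_betti TYPE('k) graph_poset_le (poset_link graph_poset_le (graph_poset E) \<sigma>)
      (p - int (card (snd \<sigma>)) - 2)"
  shows "lc_finite_dim (log_der E :: ('n \<Rightarrow> ('n, 'k) mpoly) set) p d"
    "lc_hilb (log_der E :: ('n \<Rightarrow> ('n, 'k) mpoly) set) p d = (\<Sum>t\<in>neg_index E d. b (snd t))"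
proof -
  have "\<forall>t\<in>neg_index E d. \<exists>X. finite X \<and> card X = b (snd t) \<and>
    quot_iso pscale (link_cocycles E (snd t) p :: (_ \<Rightarrow> 'k) set) (link_coboundaries E (snd t) p)
      pscale (coords (X :: ('n set \<times> 'n set \<Rightarrow> 'k) set)) {0}"
    unfolding b_def by (intro ballI link_cohomology) (auto simp: neg_index_def)
  then obtain X where X: "\<forall>t\<in>neg_index E d. finite (X t) \<and> card (X t) = b (snd t) \<and>
    quot_iso pscale (link_cocycles E (snd t) p :: (_ \<Rightarrow> 'k) set) (link_coboundaries E (snd t) p)
      pscale (coords (X t :: ('n set \<times> 'n set \<Rightarrow> 'k) set)) {0}"
    unfolding bchoice_iff by blast
  have sum: "quot_iso (\<lambda>a \<phi> t. pscale a (\<phi> t)) {\<phi> \<in> link_cochains E d p. link_diff E d \<phi> = (0 :: _ \<Rightarrow> _ \<Rightarrow> 'k)}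
     (link_diff E d ` link_cochains E d (p - 1)) pscale (coords (Sigma (neg_index E d) X)) {0}"
    unfolding link_cocycles_eq link_coboundaries_eq
  proof (rule quot_iso_direct_sum)
    fix t assume "t \<in> neg_index E d"
    from bspec[OF X this] show "quot_iso pscale (link_cocycles E (snd t) p :: (_ \<Rightarrow> 'k) set) (link_coboundaries E (snd t) p)
      pscale (coords (X t)) {0}" by (elim conjE)
  qed
  \<comment> \<open>The chain leads from the Cech complex on the x_v to the one on z and the y_v,
    then to Laurent coefficients, to negative exponents, and to the links.\<close>
  note chain = quot_iso_trans[OF quot_iso_cech_X quot_iso_trans[OF quot_iso_X_YZ
      quot_iso_trans[OF quot_iso_sym[OF quot_iso_model_log[OF E]]
      quot_iso_trans[OF quot_iso_model_neg[OF E] quot_iso_trans[OF quot_iso_neg_link[OF E] sum]]]]]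
  have fin: "finite (Sigma (neg_index E d) X)"
    using X finite_neg_index[of E d] by (intro finite_SigmaI) auto
  note dim = quot_dim_eq[OF vector_space_cech_scale subspace_cech_cocycles subspace_cech_coboundaries chain fin]
  show "lc_finite_dim (log_der E :: ('n \<Rightarrow> ('n, 'k) mpoly) set) p d"
    unfolding lc_finite_dim_def by (rule dim(1))
  have "card (Sigma (neg_index E d) X) = (\<Sum>t\<in>neg_index E d. b (snd t))"
    using X finite_neg_index[of E d] by (subst card_SigmaI) auto
  then show "lc_hilb (log_der E :: ('n \<Rightarrow> ('n, 'k) mpoly) set) p d = (\<Sum>t\<in>neg_index E d. b (snd t))"
    unfolding lc_hilb_def using dim(2) by simp
qed

end

section \<open>Counting exponents\<close>

definition compositions :: "'i set \<Rightarrow> nat \<Rightarrow> ('i \<Rightarrow> nat) set" where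
  "compositions U m = {\<gamma>. (\<forall>i. 0 < \<gamma> i \<longleftrightarrow> i \<in> U) \<and> sum \<gamma> U = m}"

text \<open>This is X / (1 - X), the generating function of one positive part.\<close>

definition pos_fps :: "rat fps" where
  "pos_fps = Abs_fps (\<lambda>n. if n = 0 then 0 else 1)"

text \<open>Splitting off the part k at the new index turns the count into a convolution, hence into
  a product of series.\<close>

lemma card_compositions:
  assumes "finite U"
  shows "finite (compositions U m) \<and> of_nat (card (compositions U m)) = fps_nth (pos_fps ^ card U) m"
  using assms
proof (induction U arbitrary: m rule: finite_induct)
  case empty
  have eq: "compositions {} m = (if m = 0 then {\<lambda>_. 0} else {})"
    by (auto simp: compositions_def fun_eq_iff)
  show ?case unfolding eq by simp
next
  case (insert x U)
  let ?S = "Sigma {1..m} (\<lambda>k. compositions U (m - k))"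
  have bij: "bij_betw (\<lambda>(k, \<gamma>). \<gamma>(x := k)) ?S (compositions (insert x U) m)"
  proof (rule bij_betwI[where g = "\<lambda>\<gamma>. (\<gamma> x, \<gamma>(x := 0))"])
    have s: "sum (\<gamma>(x := k)) U = sum \<gamma> U" for \<gamma> :: "'a \<Rightarrow> nat" and k
      using insert.hyps by (intro sum.cong) auto
    have x: "\<gamma> x = 0" if "\<gamma> \<in> compositions U n" for \<gamma> n
      using that insert.hyps unfolding compositions_def by blast
    show "(\<lambda>(k, \<gamma>). \<gamma>(x := k)) \<in> ?S \<rightarrow> compositions (insert x U) m"
    proof clarify
      fix k \<gamma> assume k: "k \<in> {1..m}" and \<gamma>: "\<gamma> \<in> compositions U (m - k)"
      have "0 < (\<gamma>(x := k)) i \<longleftrightarrow> i \<in> insert x U" for i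
        using k \<gamma> by (cases "i = x") (simp_all add: compositions_def)
      moreover have "sum (\<gamma>(x := k)) (insert x U) = m"
        using insert.hyps k \<gamma> by (simp add: s compositions_def del: fun_upd_apply) simp
      ultimately show "\<gamma>(x := k) \<in> compositions (insert x U) m" by (simp add: compositions_def)
    qed
    show "(\<lambda>\<gamma>. (\<gamma> x, \<gamma>(x := 0))) \<in> compositions (insert x U) m \<rightarrow> ?S"
    proof
      fix \<gamma> assume "\<gamma> \<in> compositions (insert x U) m"
      then have \<gamma>: "\<And>i. 0 < \<gamma> i \<longleftrightarrow> i \<in> insert x U" "\<gamma> x + sum \<gamma> U = m"
        using insert.hyps by (simp_all add: compositions_def)
      have "0 < (\<gamma>(x := 0)) i \<longleftrightarrow> i \<in> U" for i
        using \<gamma>(1)[of i] insert.hyps by (cases "i = x") simp_all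
      then have "\<gamma>(x := 0) \<in> compositions U (m - \<gamma> x)"
        using \<gamma>(2) by (simp add: compositions_def s del: fun_upd_apply)
      moreover have "\<gamma> x \<in> {1..m}" using \<gamma>(1)[of x] \<gamma>(2) by simp
      ultimately show "(\<gamma> x, \<gamma>(x := 0)) \<in> ?S" by blast
    qed
    show "(\<lambda>\<gamma>. (\<gamma> x, \<gamma>(x := 0))) ((\<lambda>(k, \<gamma>). \<gamma>(x := k)) y) = y" if "y \<in> ?S" for y
      using that x by (auto simp: fun_eq_iff)
    show "(\<lambda>(k, \<gamma>). \<gamma>(x := k)) ((\<lambda>\<gamma>. (\<gamma> x, \<gamma>(x := 0))) \<gamma>) = \<gamma>" for \<gamma> by simp
  qed
  have fin: "finite ?S" using insert.IH by (intro finite_SigmaI) auto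
  have "of_nat (card (compositions (insert x U) m)) = (of_nat (card ?S) :: rat)"
    using bij_betw_same_card[OF bij] by simp
  also have "\<dots> = (\<Sum>k\<in>{1..m}. fps_nth (pos_fps ^ card U) (m - k))"
    using insert.IH by (subst card_SigmaI) (auto simp: of_nat_sum)
  also have "\<dots> = (\<Sum>k\<in>{0..m}. fps_nth pos_fps k * fps_nth (pos_fps ^ card U) (m - k))"
    by (rule sum.mono_neutral_cong_left) (auto simp: pos_fps_def)
  also have "\<dots> = fps_nth (pos_fps ^ card (insert x U)) m"
    using insert.hyps by (simp add: fps_mult_nth)
  finally show ?case using bij_betw_finite[OF bij] fin by simp
qed

lemma fls_pos_power: "fls_X ^ n / (1 - fls_X) ^ n = fps_to_fls (pos_fps ^ n)"
proof -
  have "pos_fps * (1 - fps_X) = fps_X"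
    by (rule fps_ext) (auto simp: pos_fps_def right_diff_distrib fps_X_mult_right_nth fps_X_nth)
  then have "fps_to_fls (pos_fps * (1 - fps_X)) = fls_X" by simp
  then have "fps_to_fls pos_fps * (1 - fls_X) = (fls_X :: rat fls)"
    by (simp add: fls_times_fps_to_fls fps_to_fls_minus)
  moreover have "(1 - fls_X :: rat fls) \<noteq> 0"
  proof
    assume "1 - fls_X = (0 :: rat fls)"
    then have "fls_nth (1 - fls_X) 0 = (0 :: rat)" by simp
    then show False by simp
  qed
  ultimately have "fls_X / (1 - fls_X) = fps_to_fls pos_fps" by (simp add: field_simps)
  then show ?thesis by (simp add: fps_to_fls_power flip: power_divide)
qed

text \<open>After a change of sign these exponents are the compositions of -d into card S + 1
  positive parts, one for z and one for each vertex in S. The formal variable is t^-1, hence the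
  coefficient at \<open>- d\<close>.\<close>

lemma card_neg_expos:
  fixes S :: "'n::{finite,linorder} set"
  shows "of_nat (card {\<beta> \<in> neg_expos d. expo_supp \<beta> = S}) =
    fls_nth (fls_X ^ (card S + 1) / (1 - fls_X :: rat fls) ^ (card S + 1)) (- d)"
proof (cases "d \<le> 0")
  case True
  have UN: "sum \<beta> UNIV = sum \<beta> (face S)" if "\<And>j. j \<notin> face S \<Longrightarrow> \<beta> j = 0" for \<beta> :: "'n idx \<Rightarrow> int"
    using that by (intro sum.mono_neutral_right) auto
  have bij: "bij_betw (\<lambda>\<beta> j. nat (- \<beta> j)) {\<beta> \<in> neg_expos d. expo_supp \<beta> = S} (compositions (face S) (nat (- d)))"
  proof (rule bij_betwI[where g = "\<lambda>\<gamma> j. - int (\<gamma> j)"])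
    show "(\<lambda>\<beta> j. nat (- \<beta> j)) \<in> {\<beta> \<in> neg_expos d. expo_supp \<beta> = S} \<rightarrow> compositions (face S) (nat (- d))"
    proof
      fix \<beta> :: "'n idx \<Rightarrow> int" assume "\<beta> \<in> {\<beta> \<in> neg_expos d. expo_supp \<beta> = S}"
      then have \<beta>: "\<beta> \<in> neg_expos d" "expo_supp \<beta> = S" by auto
      have neg: "\<beta> j < 0 \<longleftrightarrow> j \<in> face S" for j
        using \<beta> by (cases j) (auto simp: neg_expos_def expo_neg_def expo_supp_def face_def)
      have "\<beta> j = 0" if "j \<notin> face S" for j
        using neg[of j] neg_expos_nonpos[OF \<beta>(1), of j] that by simp
      then have "sum \<beta> (face S) = d" using UN[of \<beta>] \<beta>(1) by (simp add: neg_expos_def)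
      moreover have "int (\<Sum>j\<in>face S. nat (- \<beta> j)) = (\<Sum>j\<in>face S. - \<beta> j)"
        unfolding of_nat_sum by (intro sum.cong refl) (use neg_expos_nonpos[OF \<beta>(1)] in simp)
      ultimately have "int (\<Sum>j\<in>face S. nat (- \<beta> j)) = - d" by (simp only: sum_negf)
      then have "(\<Sum>j\<in>face S. nat (- \<beta> j)) = nat (- d)" by (metis nat_int)
      then show "(\<lambda>j. nat (- \<beta> j)) \<in> compositions (face S) (nat (- d))"
        using neg by (simp add: compositions_def)
    qed
    show "(\<lambda>\<gamma> j. - int (\<gamma> j)) \<in> compositions (face S) (nat (- d)) \<rightarrow> {\<beta> \<in> neg_expos d. expo_supp \<beta> = S}"
    proof
      fix \<gamma> :: "'n idx \<Rightarrow> nat" assume "\<gamma> \<in> compositions (face S) (nat (- d))"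
      then have \<gamma>: "\<And>i. 0 < \<gamma> i \<longleftrightarrow> i \<in> face S" "sum \<gamma> (face S) = nat (- d)" by (auto simp: compositions_def)
      have "(\<Sum>j\<in>UNIV. - int (\<gamma> j)) = (\<Sum>j\<in>face S. - int (\<gamma> j))"
        by (rule UN) (use \<gamma>(1) in auto)
      also have "\<dots> = - int (sum \<gamma> (face S))" by (simp add: sum_negf)
      also have "\<dots> = d" using \<gamma>(2) True by simp
      finally have "(\<Sum>j\<in>UNIV. - int (\<gamma> j)) = d" .
      moreover have "\<gamma> (Xv v) = 0" for v using \<gamma>(1)[of "Xv v"] by (auto simp: face_def)
      moreover have "0 < \<gamma> Zv" using \<gamma>(1)[of Zv] by simp
      moreover have "expo_supp (\<lambda>j. - int (\<gamma> j)) = S" using \<gamma>(1)[of "Yv _"] by (auto simp: expo_supp_def)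
      ultimately show "(\<lambda>j. - int (\<gamma> j)) \<in> {\<beta> \<in> neg_expos d. expo_supp \<beta> = S}"
        by (simp add: neg_expos_def expo_neg_def)
    qed
  qed (auto simp: fun_eq_iff neg_expos_nonpos)
  have "of_nat (card {\<beta> \<in> neg_expos d. expo_supp \<beta> = S}) = fps_nth (pos_fps ^ card (face S)) (nat (- d))"
    using bij_betw_same_card[OF bij] card_compositions[of "face S" "nat (- d)"] by simp
  then show ?thesis unfolding fls_pos_power card_face using True by simp
next
  case False
  \<comment> \<open>In positive degree there are no such exponents, and the series has no terms of
    negative index.\<close>
  have "\<beta> \<notin> neg_expos d" for \<beta> :: "'n idx \<Rightarrow> int"
  proof
    assume \<beta>: "\<beta> \<in> neg_expos d"
    have "sum \<beta> UNIV \<le> 0" using neg_expos_nonpos[OF \<beta>] by (intro sum_nonpos) auto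
    then show False using \<beta> False by (simp add: neg_expos_def)
  qed
  then show ?thesis unfolding fls_pos_power using False by simp
qed

lemma fls_nth_of_nat_mult: "fls_nth (of_nat n * f) k = of_nat n * fls_nth f k"
  by (induction n) (auto simp: distrib_right)

lemma fls_nth_sum': "fls_nth (sum f A) k = (\<Sum>x\<in>A. fls_nth (f x) k)"
  by (induction A rule: infinite_finite_induct) auto

text \<open>\<open>fls_X\<close> stands for t^-1, so the coefficient of t^d is read off at
  \<open>- d\<close>. Finite dimensionality is part of the claim because \<open>lc_hilb\<close> is
  meaningful only together with it.\<close>

theorem corollary3p11:
  fixes E :: "'n::{finite,linorder} set set" and i :: int
  assumes "simple_graph E" and "connected_graph E"
  shows "(\<forall>d. lc_finite_dim (log_der E :: ('n \<Rightarrow> ('n, 'k::field) mpoly) set) i d) \<and>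
    (\<lambda>d. rat_of_nat (lc_hilb (log_der E :: ('n \<Rightarrow> ('n, 'k) mpoly) set) i d)) =
    (\<lambda>d. fls_nth
       (\<Sum>\<sigma>\<in>graph_poset E.
          of_nat (reduced_betti TYPE('k) graph_poset_le
                    (poset_link graph_poset_le (graph_poset E) \<sigma>)
                    (i - int (graph_poset_rank \<sigma>) - 2))
          * (fls_X ^ (graph_poset_rank \<sigma> + 1) / (1 - fls_X) ^ (graph_poset_rank \<sigma> + 1)))
       (- d))"
proof (intro conjI allI ext)
  fix d
  show "lc_finite_dim (log_der E :: ('n \<Rightarrow> ('n, 'k) mpoly) set) i d"
    by (rule local_cohomology_dim(1)[OF assms(1)])
  define b where "b \<sigma> = reduced_betti TYPE('k) graph_poset_le (poset_link graph_poset_le (graph_poset E) \<sigma>)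
      (i - int (card (snd \<sigma>)) - 2)" for \<sigma>
  have lc: "lc_hilb (log_der E :: ('n \<Rightarrow> ('n, 'k) mpoly) set) i d = (\<Sum>t\<in>neg_index E d. b (snd t))"
    unfolding b_def by (rule local_cohomology_dim(2)[OF assms(1)])
  let ?S = "\<lambda>\<sigma>. {\<beta> \<in> neg_expos d. expo_supp \<beta> = snd \<sigma>}"
  \<comment> \<open>The pairs (\<beta>, \<sigma>) are regrouped by \<sigma>, on which alone the
    Betti number depends.\<close>
  have "neg_index E d = (\<lambda>(\<sigma>, \<beta>). (\<beta>, \<sigma>)) ` Sigma (graph_poset E) ?S"
    by (auto simp: neg_index_def)
  then have "(\<Sum>t\<in>neg_index E d. b (snd t)) = (\<Sum>(\<sigma>, \<beta>)\<in>Sigma (graph_poset E) ?S. b \<sigma>)"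
    by (simp add: sum.reindex inj_on_def case_prod_unfold prod_eq_iff)
  also have "\<dots> = (\<Sum>\<sigma>\<in>graph_poset E. card (?S \<sigma>) * b \<sigma>)"
    by (subst sum.Sigma[symmetric]) (auto simp: finite_neg_expos)
  finally have "rat_of_nat (lc_hilb (log_der E :: ('n \<Rightarrow> ('n, 'k) mpoly) set) i d) =
     (\<Sum>\<sigma>\<in>graph_poset E. of_nat (b \<sigma>) * of_nat (card (?S \<sigma>)))"
    unfolding lc by (simp add: mult.commute)
  then show "rat_of_nat (lc_hilb (log_der E :: ('n \<Rightarrow> ('n, 'k) mpoly) set) i d) =
    fls_nth
       (\<Sum>\<sigma>\<in>graph_poset E.
          of_nat (reduced_betti TYPE('k) graph_poset_le
                    (poset_link graph_poset_le (graph_poset E) \<sigma>)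
                    (i - int (graph_poset_rank \<sigma>) - 2))
          * (fls_X ^ (graph_poset_rank \<sigma> + 1) / (1 - fls_X) ^ (graph_poset_rank \<sigma> + 1)))
       (- d)"
    by (simp only: fls_nth_sum' fls_nth_of_nat_mult card_neg_expos b_def graph_poset_rank_def)
qed

end
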